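(* Assume that $\varphi>0$ on $\overline{D}$ and that the Green function $g_A$ satisfies $g_A(x,t;y,s)>0$ for all $x,y\in\overline{D}$ and all $s,t\in[0,T]$ with $t>s$ and is jointly continuous in these variables. Let $\mu$ be a positive integrable function on $\overline{D}\times\overline{D}$ such that $\mu(E\times F):=\int_{E\times F}dx\,dy\,\mu(x,y)$ defines a probability measure on $\mathcal{B}(\overline{D})\times\mathcal{B}(\overline{D})$. Then there exist a probability space $(\Omega,\mathcal{F},\mathbb{P}_\mu)$ and a $\overline{D}$-valued Bernstein process $Z_{\tau\in[0,T]}$ on $(\Omega,\mathcal{F},\mathbb{P}_\mu)$ such that $$\mathbb{P}_\mu(Z_0\in E_0,\,Z_T\in E_T)=\mu(E_0\times E_T)$$ for all $E_0,E_T\in\mathcal{B}(\overline{D})$. Furthermore $$\mathbb{P}_\mu(Z_r\in E\mid Z_s,Z_t)=P(Z_t,t;E,r;Z_s,s)$$ for every $E\in\mathcal{B}(\overline{D})$ and all $r,s,t$ satisfying $r\in(s,t)\subset[0,T]$, and the finite-dimensional distributions are given by $$\mathbb{P}_\mu(Z_0\in E_0,Z_{t_1}\in E_1,\dots,Z_{t_n}\in E_n,Z_T\in E_T)=\int_{E_0\times E_T}dx\,dy\,\mu(x,y)\int_{E_1}dx_1\cdots\int_{E_n}dx_n\prod_{i=1}^n p(y,T;x_i,t_i;x_{i-1},t_{i-1})$$ where $x_0=x$, for all $E_0,E_1,\dots,E_n,E_T\in\mathcal{B}(\overline{D})$ and all $t_0,\dots,t_n\in[0,T)$ satisfying $t_0=0<t_1<\dots<t_n<T$.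 Finally, $\mathbb{P}_\mu$ is the unique probability measure with these properties.
   Context: Setting. $T\in(0,+\infty)$; $D\subset\mathbb{R}^d$ is a bounded open convex set whose boundary $\partial D$ is of class $\mathcal{C}^{2+\alpha}$ for some $\alpha\in(0,1)$; $\overline{D}=D\cup\partial D$ with Borel $\sigma$-algebra $\mathcal{B}(\overline{D})$; $n(x)$ is the unit outer normal at $x\in\partial D$. $\mathcal{C}^{\alpha,\alpha/2}$ etc. denote the usual parabolic Hölder spaces. Standing hypotheses: (K) $k:\overline{D}\times[0,T]\to\mathbb{R}^{d^2}$ is matrix-valued with $k_{i,j}=k_{j,i}\in\mathcal{C}^{\alpha,\alpha/2}(\overline{D}\times[0,T])$ and $\partial k_{i,j}/\partial x_l\in\mathcal{C}^{\alpha,\alpha/2}(\overline{D}\times[0,T])$ for all $i,j,l$; $(k(x,t)q,q)_{\mathbb{R}^d}\ge\underline{k}|q|^2$ with a constant $\underline{k}>0$ for all $(x,t)\in\overline{D}\times[0,T]$, $q\in\mathbb{R}^d$; the conormal field $n_k(x,t):=k(x,t)n(x)$ is uniformly outward pointing, nowhere tangent to $\partial D$ for every $t$, and $(x,t)\mapsto\sum_i k_{i,j}(x,t)n_i(x)\in\mathcal{C}^{1+\alpha,(1+\alpha)/2}(\partial D\times[0,T])$ for each $j$. (L) $l:\overline{D}\times[0,T]\to\mathbb{R}^d$ satisfies $l_i,\partial l_i/\partial x_j\in\mathcal{C}^{\alpha,\alpha/2}(\overline{D}\times[0,T])$ for all $i,j$. (V) $V\in\mathcal{C}^{\alpha,\alpha/2}(\overline{D}\times[0,T])$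 is real-valued. (IF) $\varphi,\psi\in\mathcal{C}^{2+\alpha}(\overline{D})$ are real-valued, $\varphi$ satisfying the conormal boundary condition relative to $k$ at $t=0$ and $\psi$ satisfying it at $t=T$. Green function. $g_A(x,t;y,s)$, $x,y\in\overline{D}$, $0\le s<t\le T$, is the parabolic Green function of the initial-boundary value problem $\partial_t u=\frac12\operatorname{div}_x(k\nabla_x u)-(l,\nabla_x u)_{\mathbb{R}^d}-Vu$ in $D\times(0,T]$, $u(\cdot,0)=\varphi$, $\partial u/\partial n_k=0$ on $\partial D\times(0,T]$ (conormal derivative). That is, $U_A(t,s)f(x)=\int_D dy\,g_A(x,t;y,s)f(y)$ for $t>s$, $U_A(s,s)f=f$, is the evolution system in $L^2(D)$ solving this equation with the boundary condition and with datum $f$ at time $s$; it satisfies $U_A(t,s)=U_A(t,r)U_A(r,s)$ for $s\le r\le t$. Functions $p$ and $P$. For $x,y,z\in\overline{D}$ and $r\in(s,t)\subset[0,T]$, $p(x,t;z,r;y,s):=\dfrac{g_A(x,t;z,r)\,g_A(z,r;y,s)}{g_A(x,t;y,s)}$, and $P(x,t;E,r;y,s):=\int_E dz\,p(x,t;z,r;y,s)$ for $E\in\mathcal{B}(\overline{D})$. Bernstein process. A $\overline{D}$-valued process $Z_{\tau\in[0,T]}$ on a complete probability space $(\Omega,\mathcal{F},\mathbb{P})$ is a Bernstein process if $\mathbb{E}(h(Z_r)\mid\mathcal{F}_s^+\vee\mathcal{F}_t^-)=\mathbb{E}(h(Z_r)\mid Z_s,Z_t)$ for every bounded Borel measurable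 $h:\overline{D}\to\mathbb{R}$ and all $r\in(s,t)\subset[0,T]$, where $\mathcal{F}_s^+=\sigma(Z_\tau:\tau\in[0,s])$ and $\mathcal{F}_t^-=\sigma(Z_\tau:\tau\in[t,T])$. *)

theory Defs
  imports "HOL-Probability.Probability"
begin

section \<open>Hoelder classes\<close>

definition parabolic_holder ::
  "real \<Rightarrow> 'a::metric_space set \<Rightarrow> real set \<Rightarrow> ('a \<Rightarrow> real \<Rightarrow> 'b::metric_space) \<Rightarrow> bool" where
  "parabolic_holder \<alpha> S J f \<longleftrightarrow>
     (\<exists>C. \<forall>x\<in>S. \<forall>y\<in>S. \<forall>t\<in>J. \<forall>s\<in>J.
        dist (f x t) (f y s) \<le> C * (dist x y powr \<alpha> + \<bar>t - s\<bar> powr (\<alpha> / 2)))"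

text \<open>Functions that are, together with their spatial gradient, of parabolic Hoelder class
  \<open>(\<alpha>, \<alpha>/2)\<close> up to the boundary of the open set \<open>D\<close>. As usual, boundary values of
  derivatives are those of the continuous extension from \<open>D\<close>.\<close>

definition parabolic_holder_with_gradient ::
  "real \<Rightarrow> (real^'d) set \<Rightarrow> real set \<Rightarrow> (real^'d \<Rightarrow> real \<Rightarrow> real) \<Rightarrow> bool" where
  "parabolic_holder_with_gradient \<alpha> D J f \<longleftrightarrow>
     parabolic_holder \<alpha> (closure D) J f \<and>
     (\<exists>G. (\<forall>x\<in>D. \<forall>t\<in>J. GDERIV (\<lambda>\<xi>. f \<xi> t) x :> G x t) \<and>
          parabolic_holder \<alpha> (closure D) J G)"

text \<open>The class of order \<open>(1 + \<alpha>, (1 + \<alpha>)/2)\<close> on an open set.\<close>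

definition parabolic_holder_1 ::
  "real \<Rightarrow> (real^'d) set \<Rightarrow> real set \<Rightarrow> (real^'d \<Rightarrow> real \<Rightarrow> real) \<Rightarrow> bool" where
  "parabolic_holder_1 \<alpha> S J f \<longleftrightarrow>
     (\<exists>G. (\<forall>x\<in>S. \<forall>t\<in>J. GDERIV (\<lambda>\<xi>. f \<xi> t) x :> G x t) \<and> parabolic_holder \<alpha> S J G) \<and>
     (\<exists>C. \<forall>x\<in>S. \<forall>t\<in>J. \<forall>s\<in>J. \<bar>f x t - f x s\<bar> \<le> C * \<bar>t - s\<bar> powr ((1 + \<alpha>) / 2))"

text \<open>The class of order \<open>2 + \<alpha>\<close> on the closure of a bounded open set.\<close>

definition holder_2 :: "real \<Rightarrow> (real^'d) set \<Rightarrow> (real^'d \<Rightarrow> real) \<Rightarrow> bool" where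
  "holder_2 \<alpha> D f \<longleftrightarrow>
     (\<exists>G H. continuous_on (closure D) f \<and> continuous_on (closure D) G \<and>
        (\<forall>x\<in>D. GDERIV f x :> G x \<and> (G has_derivative ((*v) (H x))) (at x)) \<and>
        (\<exists>C. \<forall>x\<in>closure D. \<forall>y\<in>closure D. dist (H x) (H y) \<le> C * dist x y powr \<alpha>))"

section \<open>Boundary regularity and outer normal\<close>

text \<open>Near \<open>x0\<close> the set \<open>D\<close> lies above the graph of a \<open>C\<^sup>2\<^sup>+\<^sup>\<alpha>\<close> function over the
  hyperplane orthogonal to the unit vector \<open>e\<close>; such a function is encoded as a
  function on the whole space that is invariant in the direction \<open>e\<close>.\<close>

definition boundary_chart ::
  "real \<Rightarrow> (real^'d) set \<Rightarrow> real^'d \<Rightarrow> real \<Rightarrow> real^'d \<Rightarrow> (real^'d \<Rightarrow> real) \<Rightarrow> bool" where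
  "boundary_chart \<alpha> D x0 r e \<gamma> \<longleftrightarrow>
     0 < r \<and> norm e = 1 \<and> (\<forall>x c. \<gamma> (x + c *\<^sub>R e) = \<gamma> x) \<and>
     holder_2 \<alpha> (ball x0 r) \<gamma> \<and> D \<inter> ball x0 r = {x \<in> ball x0 r. \<gamma> x < x \<bullet> e}"

definition boundary_holder_2 :: "real \<Rightarrow> (real^'d) set \<Rightarrow> bool" where
  "boundary_holder_2 \<alpha> D \<longleftrightarrow> (\<forall>x0\<in>frontier D. \<exists>r e \<gamma>. boundary_chart \<alpha> D x0 r e \<gamma>)"

text \<open>Locally \<open>D = {x. \<gamma> x - x \<bullet> e < 0}\<close>, so the outer normal is the normalised gradient of
  \<open>\<lambda>x. \<gamma> x - x \<bullet> e\<close>.\<close>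

definition unit_outer_normal :: "real \<Rightarrow> (real^'d) set \<Rightarrow> (real^'d \<Rightarrow> real^'d) \<Rightarrow> bool" where
  "unit_outer_normal \<alpha> D n \<longleftrightarrow>
     (\<forall>x0\<in>frontier D. \<exists>r e \<gamma> w. boundary_chart \<alpha> D x0 r e \<gamma> \<and> (GDERIV \<gamma> x0 :> w) \<and>
        n x0 = (w - e) /\<^sub>R norm (w - e))"

text \<open>The class of order \<open>(1 + \<alpha>, (1 + \<alpha>)/2)\<close> on \<open>frontier D \<times> J\<close>, in local coordinates:
  \<open>x + (\<gamma> x - x \<bullet> e) e\<close> is the point of the graph of \<open>\<gamma>\<close> over the projection of \<open>x\<close>
  along \<open>e\<close>.\<close>

definition boundary_parabolic_holder_1 ::
  "real \<Rightarrow> (real^'d) set \<Rightarrow> real set \<Rightarrow> (real^'d \<Rightarrow> real \<Rightarrow> real) \<Rightarrow> bool" where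
  "boundary_parabolic_holder_1 \<alpha> D J f \<longleftrightarrow>
     (\<forall>x0\<in>frontier D. \<exists>r e \<gamma> \<delta>. boundary_chart \<alpha> D x0 r e \<gamma> \<and> 0 < \<delta> \<and>
        (\<forall>x\<in>ball x0 \<delta>. x + (\<gamma> x - x \<bullet> e) *\<^sub>R e \<in> ball x0 r) \<and>
        parabolic_holder_1 \<alpha> (ball x0 \<delta>) J (\<lambda>x t. f (x + (\<gamma> x - x \<bullet> e) *\<^sub>R e) t))"

section \<open>Hypotheses on the data\<close>

definition hyp_K ::
  "real \<Rightarrow> real \<Rightarrow> (real^'d) set \<Rightarrow> (real^'d \<Rightarrow> real^'d) \<Rightarrow> (real^'d \<Rightarrow> real \<Rightarrow> real^'d^'d) \<Rightarrow> bool" where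
  "hyp_K \<alpha> T D n k \<longleftrightarrow>
     (\<forall>i j. \<forall>x\<in>closure D. \<forall>t\<in>{0..T}. k x t $ i $ j = k x t $ j $ i) \<and>
     (\<forall>i j. parabolic_holder_with_gradient \<alpha> D {0..T} (\<lambda>x t. k x t $ i $ j)) \<and>
     (\<exists>\<kappa>>0. \<forall>x\<in>closure D. \<forall>t\<in>{0..T}. \<forall>q. (k x t *v q) \<bullet> q \<ge> \<kappa> * (norm q)\<^sup>2) \<and>
     (\<exists>c>0. \<forall>x\<in>frontier D. \<forall>t\<in>{0..T}. (k x t *v n x) \<bullet> n x \<ge> c) \<and>
     (\<forall>j. boundary_parabolic_holder_1 \<alpha> D {0..T} (\<lambda>x t. \<Sum>i\<in>UNIV. k x t $ i $ j * n x $ i))"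

definition hyp_L :: "real \<Rightarrow> real \<Rightarrow> (real^'d) set \<Rightarrow> (real^'d \<Rightarrow> real \<Rightarrow> real^'d) \<Rightarrow> bool" where
  "hyp_L \<alpha> T D l \<longleftrightarrow> (\<forall>i. parabolic_holder_with_gradient \<alpha> D {0..T} (\<lambda>x t. l x t $ i))"

definition hyp_V :: "real \<Rightarrow> real \<Rightarrow> (real^'d) set \<Rightarrow> (real^'d \<Rightarrow> real \<Rightarrow> real) \<Rightarrow> bool" where
  "hyp_V \<alpha> T D V \<longleftrightarrow> parabolic_holder \<alpha> (closure D) {0..T} V"

definition conormal_condition ::
  "(real^'d) set \<Rightarrow> (real^'d \<Rightarrow> real^'d) \<Rightarrow> (real^'d \<Rightarrow> real^'d^'d) \<Rightarrow> (real^'d \<Rightarrow> real) \<Rightarrow> bool" where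
  "conormal_condition D n k f \<longleftrightarrow>
     (\<exists>G. (\<forall>x\<in>D. GDERIV f x :> G x) \<and> continuous_on (closure D) G \<and>
          (\<forall>x\<in>frontier D. (k x *v n x) \<bullet> G x = 0))"

definition hyp_IF ::
  "real \<Rightarrow> real \<Rightarrow> (real^'d) set \<Rightarrow> (real^'d \<Rightarrow> real^'d) \<Rightarrow> (real^'d \<Rightarrow> real \<Rightarrow> real^'d^'d) \<Rightarrow>
    (real^'d \<Rightarrow> real) \<Rightarrow> (real^'d \<Rightarrow> real) \<Rightarrow> bool" where
  "hyp_IF \<alpha> T D n k \<phi> \<psi> \<longleftrightarrow>
     holder_2 \<alpha> D \<phi> \<and> holder_2 \<alpha> D \<psi> \<and>
     conormal_condition D n (\<lambda>x. k x 0) \<phi> \<and> conormal_condition D n (\<lambda>x. k x T) \<psi>"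

section \<open>The parabolic Green function\<close>

definition divergence :: "(real^'d \<Rightarrow> real^'d) \<Rightarrow> real^'d \<Rightarrow> real" where
  "divergence F x = (\<Sum>i\<in>UNIV. frechet_derivative F (at x) (axis i 1) $ i)"

text \<open>\<open>u\<close> is a classical solution on \<open>D \<times> (s, T]\<close> of
  \<open>\<partial>\<^sub>t u = 1/2 div (k \<nabla>u) - l \<bullet> \<nabla>u - V u\<close> with vanishing conormal derivative. Its initial
  behaviour at time \<open>s\<close> is fixed separately, by the strong continuity of the evolution
  system.\<close>

definition classical_solution ::
  "real \<Rightarrow> (real^'d) set \<Rightarrow> (real^'d \<Rightarrow> real^'d) \<Rightarrow> (real^'d \<Rightarrow> real \<Rightarrow> real^'d^'d) \<Rightarrow>
    (real^'d \<Rightarrow> real \<Rightarrow> real^'d) \<Rightarrow> (real^'d \<Rightarrow> real \<Rightarrow> real) \<Rightarrow> real \<Rightarrow>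
    (real^'d \<Rightarrow> real \<Rightarrow> real) \<Rightarrow> bool" where
  "classical_solution T D n k l V s u \<longleftrightarrow>
     (\<exists>u\<^sub>t G H.
        continuous_on (closure D \<times> {s<..T}) (\<lambda>(x, t). u x t) \<and>
        continuous_on (closure D \<times> {s<..T}) (\<lambda>(x, t). G x t) \<and>
        continuous_on (D \<times> {s<..T}) (\<lambda>(x, t). u\<^sub>t x t) \<and>
        continuous_on (D \<times> {s<..T}) (\<lambda>(x, t). H x t) \<and>
        (\<forall>x\<in>D. \<forall>t\<in>{s<..T}.
           (u x has_real_derivative u\<^sub>t x t) (at t within {s<..T}) \<and>
           (GDERIV (\<lambda>\<xi>. u \<xi> t) x :> G x t) \<and>
           ((\<lambda>\<xi>. G \<xi> t) has_derivative ((*v) (H x t))) (at x) \<and>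
           u\<^sub>t x t = divergence (\<lambda>\<xi>. k \<xi> t *v G \<xi> t) x / 2 - l x t \<bullet> G x t - V x t * u x t) \<and>
        (\<forall>x\<in>frontier D. \<forall>t\<in>{s<..T}. (k x t *v n x) \<bullet> G x t = 0))"

text \<open>Elements of the Hilbert space \<open>L\<^sup>2(D)\<close> are represented by functions, identified up to
  equality almost everywhere in \<open>D\<close>.\<close>

definition L2_space :: "(real^'d) set \<Rightarrow> (real^'d \<Rightarrow> real) set" where
  "L2_space D = {f. set_borel_measurable lborel D f \<and> set_integrable lborel D (\<lambda>x. (f x)\<^sup>2)}"

definition L2_dist :: "(real^'d) set \<Rightarrow> (real^'d \<Rightarrow> real) \<Rightarrow> (real^'d \<Rightarrow> real) \<Rightarrow> real" where
  "L2_dist D f h = sqrt (set_lebesgue_integral lborel D (\<lambda>x. (f x - h x)\<^sup>2))"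

definition evolution_system_L2 ::
  "real \<Rightarrow> (real^'d) set \<Rightarrow> (real \<Rightarrow> real \<Rightarrow> (real^'d \<Rightarrow> real) \<Rightarrow> real^'d \<Rightarrow> real) \<Rightarrow> bool" where
  "evolution_system_L2 T D U \<longleftrightarrow>
     (\<forall>s t. 0 \<le> s \<longrightarrow> s \<le> t \<longrightarrow> t \<le> T \<longrightarrow>
        (\<forall>f\<in>L2_space D. U t s f \<in> L2_space D) \<and>
        (\<forall>f\<in>L2_space D. \<forall>h\<in>L2_space D. \<forall>a b.
           AE x in lborel. x \<in> D \<longrightarrow>
             U t s (\<lambda>y. a * f y + b * h y) x = a * U t s f x + b * U t s h x) \<and>
        (\<exists>C. \<forall>f\<in>L2_space D. L2_dist D (U t s f) (\<lambda>_. 0) \<le> C * L2_dist D f (\<lambda>_. 0))) \<and>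
     (\<forall>s\<in>{0..T}. \<forall>f\<in>L2_space D. AE x in lborel. x \<in> D \<longrightarrow> U s s f x = f x) \<and>
     (\<forall>s r t. 0 \<le> s \<longrightarrow> s \<le> r \<longrightarrow> r \<le> t \<longrightarrow> t \<le> T \<longrightarrow>
        (\<forall>f\<in>L2_space D. AE x in lborel. x \<in> D \<longrightarrow> U t s f x = U t r (U r s f) x)) \<and>
     (\<forall>f\<in>L2_space D. \<forall>s0 t0. 0 \<le> s0 \<longrightarrow> s0 \<le> t0 \<longrightarrow> t0 \<le> T \<longrightarrow>
        ((\<lambda>(t, s). L2_dist D (U t s f) (U t0 s0 f)) \<longlongrightarrow> 0)
          (at (t0, s0) within {(t, s). 0 \<le> s \<and> s \<le> t \<and> t \<le> T}))"

text \<open>A kernel value written \<open>g(x, t; y, s)\<close> is \<open>g x t y s\<close>.\<close>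

definition kernel_operator ::
  "(real^'d) set \<Rightarrow> (real^'d \<Rightarrow> real \<Rightarrow> real^'d \<Rightarrow> real \<Rightarrow> real) \<Rightarrow>
    real \<Rightarrow> real \<Rightarrow> (real^'d \<Rightarrow> real) \<Rightarrow> real^'d \<Rightarrow> real" where
  "kernel_operator D g t s f x =
     (if t = s then f x else set_lebesgue_integral lborel D (\<lambda>y. g x t y s * f y))"

definition parabolic_Green_function ::
  "real \<Rightarrow> (real^'d) set \<Rightarrow> (real^'d \<Rightarrow> real^'d) \<Rightarrow> (real^'d \<Rightarrow> real \<Rightarrow> real^'d^'d) \<Rightarrow>
    (real^'d \<Rightarrow> real \<Rightarrow> real^'d) \<Rightarrow> (real^'d \<Rightarrow> real \<Rightarrow> real) \<Rightarrow>
    (real^'d \<Rightarrow> real \<Rightarrow> real^'d \<Rightarrow> real \<Rightarrow> real) \<Rightarrow> bool" where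
  "parabolic_Green_function T D n k l V g \<longleftrightarrow>
     (\<forall>s t. 0 \<le> s \<longrightarrow> s < t \<longrightarrow> t \<le> T \<longrightarrow>
        (\<forall>f\<in>L2_space D. \<forall>x\<in>closure D. set_integrable lborel D (\<lambda>y. g x t y s * f y))) \<and>
     evolution_system_L2 T D (kernel_operator D g) \<and>
     (\<forall>f\<in>L2_space D. \<forall>s. 0 \<le> s \<longrightarrow> s < T \<longrightarrow>
        classical_solution T D n k l V s (\<lambda>x t. kernel_operator D g t s f x))"

definition bridge_density ::
  "(real^'d \<Rightarrow> real \<Rightarrow> real^'d \<Rightarrow> real \<Rightarrow> real) \<Rightarrow>
    real^'d \<Rightarrow> real \<Rightarrow> real^'d \<Rightarrow> real \<Rightarrow> real^'d \<Rightarrow> real \<Rightarrow> real" where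
  "bridge_density g x t z r y s = g x t z r * g z r y s / g x t y s"

definition bridge_prob ::
  "(real^'d \<Rightarrow> real \<Rightarrow> real^'d \<Rightarrow> real \<Rightarrow> real) \<Rightarrow>
    real^'d \<Rightarrow> real \<Rightarrow> (real^'d) set \<Rightarrow> real \<Rightarrow> real^'d \<Rightarrow> real \<Rightarrow> real" where
  "bridge_prob g x t E r y s = set_lebesgue_integral lborel E (\<lambda>z. bridge_density g x t z r y s)"

section \<open>Bernstein processes\<close>

definition generated_sigma ::
  "'w measure \<Rightarrow> (real \<Rightarrow> 'w \<Rightarrow> 'b::topological_space) \<Rightarrow> real set \<Rightarrow> 'w measure" where
  "generated_sigma M Z I =
     sigma (space M) {Z \<tau> -` B \<inter> space M | \<tau> B. \<tau> \<in> I \<and> B \<in> sets borel}"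

definition join_sigma :: "'w measure \<Rightarrow> 'w measure \<Rightarrow> 'w measure \<Rightarrow> 'w measure" where
  "join_sigma M F G = sigma (space M) (sets F \<union> sets G)"

definition Bernstein_process ::
  "real \<Rightarrow> (real^'d) set \<Rightarrow> 'w measure \<Rightarrow> (real \<Rightarrow> 'w \<Rightarrow> real^'d) \<Rightarrow> bool" where
  "Bernstein_process T D M Z \<longleftrightarrow>
     prob_space M \<and> complete_measure M \<and>
     (\<forall>\<tau>\<in>{0..T}. Z \<tau> \<in> M \<rightarrow>\<^sub>M restrict_space borel (closure D)) \<and>
     (\<forall>h \<in> borel_measurable (restrict_space borel (closure D)). bounded (h ` closure D) \<longrightarrow>
        (\<forall>s r t. 0 \<le> s \<longrightarrow> s < r \<longrightarrow> r < t \<longrightarrow> t \<le> T \<longrightarrow>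
           (AE \<omega> in M.
              real_cond_exp M
                (join_sigma M (generated_sigma M Z {0..s}) (generated_sigma M Z {t..T}))
                (\<lambda>\<omega>. h (Z r \<omega>)) \<omega> =
              real_cond_exp M (generated_sigma M Z {s, t}) (\<lambda>\<omega>. h (Z r \<omega>)) \<omega>)))"

text \<open>\<open>iterated_integral E n F \<omega>\<close> integrates \<open>F\<close> over the coordinates
  \<open>\<omega> 1 \<in> E 1, \<dots>, \<omega> n \<in> E n\<close>, coordinate \<open>n\<close> innermost, keeping all other
  coordinates fixed.\<close>

primrec iterated_integral ::
  "(nat \<Rightarrow> 'a::euclidean_space set) \<Rightarrow> nat \<Rightarrow> ((nat \<Rightarrow> 'a) \<Rightarrow> real) \<Rightarrow> (nat \<Rightarrow> 'a) \<Rightarrow> real" where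
  "iterated_integral E 0 F \<omega> = F \<omega>"
| "iterated_integral E (Suc n) F \<omega> =
     iterated_integral E n
       (\<lambda>\<omega>. set_lebesgue_integral lborel (E (Suc n)) (\<lambda>z. F (fun_upd \<omega> (Suc n) z))) \<omega>"

text \<open>The properties of the Bernstein process with bridge kernel given by \<open>g\<close> and joint
  endpoint density \<open>\<mu>\<close>: joint law of the endpoints, conditional probabilities, and
  finite-dimensional distributions.\<close>

definition Bernstein_realization ::
  "real \<Rightarrow> (real^'d) set \<Rightarrow> (real^'d \<Rightarrow> real \<Rightarrow> real^'d \<Rightarrow> real \<Rightarrow> real) \<Rightarrow>
    (real^'d \<Rightarrow> real^'d \<Rightarrow> real) \<Rightarrow> 'w measure \<Rightarrow> (real \<Rightarrow> 'w \<Rightarrow> real^'d) \<Rightarrow> bool" where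
  "Bernstein_realization T D g \<mu> M Z \<longleftrightarrow>
     Bernstein_process T D M Z \<and>
     (\<forall>E\<^sub>0 \<in> sets (restrict_space borel (closure D)).
      \<forall>E\<^sub>T \<in> sets (restrict_space borel (closure D)).
        measure M {\<omega> \<in> space M. Z 0 \<omega> \<in> E\<^sub>0 \<and> Z T \<omega> \<in> E\<^sub>T} =
        set_lebesgue_integral lborel (E\<^sub>0 \<times> E\<^sub>T) (\<lambda>(x, y). \<mu> x y)) \<and>
     (\<forall>E \<in> sets (restrict_space borel (closure D)).
      \<forall>s r t. 0 \<le> s \<longrightarrow> s < r \<longrightarrow> r < t \<longrightarrow> t \<le> T \<longrightarrow>
        (AE \<omega> in M.
           real_cond_exp M (generated_sigma M Z {s, t})
             (indicator {\<omega> \<in> space M. Z r \<omega> \<in> E}) \<omega> =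
           bridge_prob g (Z t \<omega>) t E r (Z s \<omega>) s)) \<and>
     (\<forall>n\<ge>1. \<forall>t :: nat \<Rightarrow> real. \<forall>E E\<^sub>0 E\<^sub>T.
        t 0 = 0 \<longrightarrow> (\<forall>i<n. t i < t (Suc i)) \<longrightarrow> t n < T \<longrightarrow>
        E\<^sub>0 \<in> sets (restrict_space borel (closure D)) \<longrightarrow>
        E\<^sub>T \<in> sets (restrict_space borel (closure D)) \<longrightarrow>
        (\<forall>i\<in>{1..n}. E i \<in> sets (restrict_space borel (closure D))) \<longrightarrow>
        measure M {\<omega> \<in> space M. Z 0 \<omega> \<in> E\<^sub>0 \<and> (\<forall>i\<in>{1..n}. Z (t i) \<omega> \<in> E i) \<and> Z T \<omega> \<in> E\<^sub>T} =
        set_lebesgue_integral lborel (E\<^sub>0 \<times> E\<^sub>T)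
          (\<lambda>(x, y). \<mu> x y *
             iterated_integral E n
               (\<lambda>\<xi>. \<Prod>i=1..n. bridge_density g y T (\<xi> i) (t i) (\<xi> (i - 1)) (t (i - 1)))
               (\<lambda>_. x)))"

definition path_law ::
  "real \<Rightarrow> (real^'d) set \<Rightarrow> 'w measure \<Rightarrow> (real \<Rightarrow> 'w \<Rightarrow> real^'d) \<Rightarrow> (real \<Rightarrow> real^'d) measure" where
  "path_law T D M Z =
     distr M (\<Pi>\<^sub>M \<tau>\<in>{0..T}. restrict_space borel (closure D)) (\<lambda>\<omega>. \<lambda>\<tau>\<in>{0..T}. Z \<tau> \<omega>)"

end

theory Submission
  imports Defs
begin

text \<open>
  For a finite set \<open>J\<close> of times containing \<open>0\<close> and \<open>T\<close>, with successive elements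
  \<open>0 = t\<^sub>0 < \<dots> < t\<^sub>m = T\<close>, put on the paths over \<open>J\<close> the density
  \<open>\<mu> (\<omega> 0) (\<omega> T) / g (\<omega> T) T (\<omega> 0) 0 * (\<Prod>i. g (\<omega> t\<^sub>i) t\<^sub>i (\<omega> t\<^sub>i\<^sub>-\<^sub>1) t\<^sub>i\<^sub>-\<^sub>1)\<close>.
  Inserting a new time \<open>r\<close> between neighbours \<open>s < r < t\<close> multiplies it by the bridge density
  \<open>p(\<omega> t, t; \<omega> r, r; \<omega> s, s)\<close>. This single fact gives consistency (by Chapman-Kolmogorov
  the bridge density has integral one), hence a path measure by the Daniell-Kolmogorov theorem; it
  gives the Bernstein property, because the new factor depends only on the two neighbours; and
  inserting times in increasing order, with right neighbour \<open>T\<close>, it gives the product formula for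
  the finite-dimensional distributions. Those determine the law. The pointwise Chapman-Kolmogorov
  equation follows from the evolution property in \<open>L\<^sup>2\<close>, tested on indicators of balls, and
  the continuity of \<open>g\<close>.
\<close>

section \<open>The Chapman-Kolmogorov equation for the Green function\<close>

text \<open>The endpoint density \<open>\<mu>\<close> is arbitrary, so the process need not be
  Markov and in general has no transition function of its own. Hence every finite set of times
  carries both \<open>0\<close> and \<open>T\<close>, and conditioning is always on a left and a
  right neighbour. Dividing \<open>\<mu>\<close> by \<open>g (\<omega> T) T (\<omega> 0) 0\<close>
  makes the weights consistent: that value is the integral of the product of Green functions over
  the intermediate points. Two mismatches shape the details. The evolution property in
  \<open>L\<^sup>2\<close> holds almost everywhere in \<open>D\<close>, with an exceptional set
  depending on the test function, whereas bridge densities are evaluated at every point of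
  \<open>closure D\<close>; continuity removes the null sets, and the frontier of a convex set is
  null. And the definitions speak of Bochner integrals, which are \<open>0\<close> by convention for
  non-integrable functions, whereas Tonelli arguments want nonnegative integrals; compactness
  supplies the bounds for passing between the two. A Bernstein process lives on a complete space, so
  the final measure is a completion, and its uniqueness has to be lifted from the product
  sigma-algebra.\<close>

lemma integrable_indicator_ball: "integrable lborel (indicator (ball y e) :: 'a::euclidean_space \<Rightarrow> real)"
  using emeasure_bounded_finite[OF bounded_ball[of y e]]
  by (intro integrable_real_indicator) auto

text \<open>A positive value persists, by continuity, on a product of two balls; the average over
  the second ball is then positive for every point of the first, which has positive measure. One
  ball leads to the contradiction, so the exceptional null set may depend on the ball. The one-sided
  form, applied to a difference and to its negative, yields pointwise equality.\<close>

lemma zero_if_ball_averages_nonpos: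
  fixes \<Delta> :: "'a::euclidean_space \<Rightarrow> 'a \<Rightarrow> real"
  assumes D: "open D" "bounded D" and cont: "continuous_on (D \<times> D) (\<lambda>(x, y). \<Delta> x y)"
    and avg: "\<And>y e. ball y e \<subseteq> D \<Longrightarrow> AE x in lborel. x \<in> D \<longrightarrow> (LINT z:ball y e|lborel. \<Delta> x z) \<le> 0"
    and int: "\<And>x y e. x \<in> D \<Longrightarrow> ball y e \<subseteq> D \<Longrightarrow> set_integrable lborel (ball y e) (\<Delta> x)"
    and xy: "x \<in> D" "y \<in> D"
  shows "\<Delta> x y \<le> 0"
proof (rule ccontr)
  assume "\<not> \<Delta> x y \<le> 0"
  define \<delta> where "\<delta> = \<Delta> x y / 2"
  have \<delta>: "0 < \<delta>" "\<delta> < \<Delta> x y" using \<open>\<not> \<Delta> x y \<le> 0\<close> by (auto simp: \<delta>_def)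
  have DD: "open (D \<times> D)" using D by (auto intro: open_Times)
  then have "open ((\<lambda>(x, y). \<Delta> x y) -` {\<delta><..} \<inter> (D \<times> D))"
    using cont by (simp add: continuous_on_open_vimage)
  moreover have "(x, y) \<in> (\<lambda>(x, y). \<Delta> x y) -` {\<delta><..} \<inter> (D \<times> D)" using xy \<delta> by auto
  ultimately obtain U V where UV: "open U" "open V" "x \<in> U" "y \<in> V"
    "U \<times> V \<subseteq> (\<lambda>(x, y). \<Delta> x y) -` {\<delta><..} \<inter> (D \<times> D)"
    by (metis mem_Sigma_iff open_prod_elim)
  obtain e where e: "0 < e" "ball y e \<subseteq> V" using UV by (meson open_contains_ball)
  obtain e' where e': "0 < e'" "ball x e' \<subseteq> U" using UV by (meson open_contains_ball)
  have sub: "ball y e \<subseteq> D" "ball x e' \<subseteq> D"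
    and big: "\<And>u z. u \<in> ball x e' \<Longrightarrow> z \<in> ball y e \<Longrightarrow> \<delta> < \<Delta> u z"
  proof -
    have "u \<in> D \<and> z \<in> D \<and> \<delta> < \<Delta> u z" if "u \<in> U" "z \<in> V" for u z
    proof -
      have "(u, z) \<in> (\<lambda>(x, y). \<Delta> x y) -` {\<delta><..} \<inter> (D \<times> D)" using UV(5) that by blast
      then show ?thesis by simp
    qed
    with UV(3,4) e(2) e'(2) show "ball y e \<subseteq> D" "ball x e' \<subseteq> D"
      "\<And>u z. u \<in> ball x e' \<Longrightarrow> z \<in> ball y e \<Longrightarrow> \<delta> < \<Delta> u z" by blast+
  qed
  have vol: "0 < measure lborel (ball y e)" using e by (simp add: content_ball_pos)
  have pos: "0 < (LINT z:ball y e|lborel. \<Delta> u z)" if u: "u \<in> ball x e'" for u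
  proof -
    have "(LINT z:ball y e|lborel. \<delta>) \<le> (LINT z:ball y e|lborel. \<Delta> u z)"
    proof (rule set_integral_mono)
      show "set_integrable lborel (ball y e) (\<lambda>_. \<delta>)"
        unfolding set_integrable_def by (simp add: integrable_indicator_ball)
      show "set_integrable lborel (ball y e) (\<Delta> u)" using u sub by (intro int) auto
    qed (use big[OF u] in \<open>auto intro: less_imp_le\<close>)
    also have "(LINT z:ball y e|lborel. \<delta>) = measure lborel (ball y e) * \<delta>"
      unfolding set_lebesgue_integral_def by simp
    finally show ?thesis using vol \<delta> by (smt (verit) mult_pos_pos)
  qed
  have "AE u in lborel. u \<notin> ball x e'"
    using avg[OF sub(1)]
  proof eventually_elim
    case (elim u)
    then show ?case using pos[of u] sub(2) by force
  qed
  then have "emeasure lborel (ball x e') = 0"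
    using AE_iff_null_sets[of "ball x e'" lborel] by (simp add: null_sets_def)
  then show False using e'(1) content_ball_pos[of e' x] by (simp add: measure_def)
qed

text \<open>The frontier of a convex set is Lebesgue null. This reconciles the evolution system,
  which integrates over \<open>D\<close>, with the process, which lives in
  \<open>closure D\<close>.\<close>

lemma AE_lborel_closure_convex:
  fixes D :: "'a::euclidean_space set"
  assumes "convex D" "open D"
  shows "AE z in lborel. z \<in> closure D \<longleftrightarrow> z \<in> D"
proof -
  have "frontier D \<in> null_sets lborel"
    using negligible_convex_frontier[OF assms(1)] negligible_iff_null_sets
      null_sets_completion_iff[of "frontier D" lborel] frontier_closed[of D] by auto
  then have "AE z in lborel. z \<notin> frontier D" by (rule AE_not_in)
  then show ?thesis
  proof eventually_elim
    case (elim z)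
    then show ?case using assms(2) closure_subset[of D] by (auto simp: frontier_def interior_open)
  qed
qed

text \<open>Fubini turns the evolution property for the indicator of a ball into equality of ball
  averages of \<open>c\<close> and of the composed kernel \<open>G\<close>. Both are continuous up
  to the boundary, so they agree on \<open>D \<times> D\<close> and, by density, on the product of
  the closures. The conclusion is a nonnegative integral, ready for Tonelli without integrability
  conditions.\<close>

lemma Green_function_Chapman_Kolmogorov:
  fixes D :: "(real^'d) set"
  assumes D: "open D" "bounded D" "convex D"
    and Green: "parabolic_Green_function T D n k l V g"
    and pos: "\<And>x y s t. x \<in> closure D \<Longrightarrow> y \<in> closure D \<Longrightarrow> 0 \<le> s \<Longrightarrow> s < t \<Longrightarrow> t \<le> T \<Longrightarrow> 0 < g x t y s"
    and cont: "\<And>s t. 0 \<le> s \<Longrightarrow> s < t \<Longrightarrow> t \<le> T \<Longrightarrow> continuous_on (closure D \<times> closure D) (\<lambda>(x, y). g x t y s)"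
    and str: "0 \<le> s" "s < r" "r < t" "t \<le> T"
    and xy: "x \<in> closure D" "y \<in> closure D"
  shows "(\<integral>\<^sup>+z. ennreal (g x t z r * g z r y s) \<partial>restrict_space lborel (closure D)) = ennreal (g x t y s)"
proof -
  define R where "R = restrict_space lborel D"
  define a where "a x z = g x t z r" for x z
  define b where "b z y = g z r y s" for z y
  define c where "c x y = g x t y s" for x y
  have D_borel: "D \<in> sets borel" using D by auto
  have space_R: "space R = D" by (simp add: R_def space_restrict_space)
  interpret R: finite_measure R
  proof
    have "emeasure R (space R) = emeasure lborel D"
      using D_borel by (simp add: R_def emeasure_restrict_space space_restrict_space)
    then show "emeasure R (space R) \<noteq> \<infinity>" using emeasure_bounded_finite[OF D(2)] by simp
  qed
  interpret RR: pair_sigma_finite R R ..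
  interpret RRf: finite_measure "R \<Otimes>\<^sub>M R" by (rule finite_measure_pair_measure) unfold_locales
  have cl: "D \<subseteq> closure D" by (rule closure_subset)
  have K: "compact (closure D \<times> closure D)"
    using D(2) by (auto intro!: compact_Times)
  have ca: "continuous_on (closure D \<times> closure D) (\<lambda>(x, y). a x y)"
    and cb: "continuous_on (closure D \<times> closure D) (\<lambda>(x, y). b x y)"
    and cc: "continuous_on (closure D \<times> closure D) (\<lambda>(x, y). c x y)"
    unfolding a_def b_def c_def using str by (auto intro!: cont)
  have bound: "\<exists>B. \<forall>x\<in>closure D. \<forall>y\<in>closure D. \<bar>f x y\<bar> \<le> B"
    if "continuous_on (closure D \<times> closure D) (\<lambda>(x, y). f x y)" for f :: "real^'d \<Rightarrow> real^'d \<Rightarrow> real"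
    using compact_imp_bounded[OF compact_continuous_image[OF that K]] unfolding bounded_iff by fastforce
  obtain A where A: "\<And>x y. x \<in> closure D \<Longrightarrow> y \<in> closure D \<Longrightarrow> \<bar>a x y\<bar> \<le> A" using bound[OF ca] by blast
  obtain B where B: "\<And>x y. x \<in> closure D \<Longrightarrow> y \<in> closure D \<Longrightarrow> \<bar>b x y\<bar> \<le> B" using bound[OF cb] by blast
  obtain C where C: "\<And>x y. x \<in> closure D \<Longrightarrow> y \<in> closure D \<Longrightarrow> \<bar>c x y\<bar> \<le> C" using bound[OF cc] by blast
  have AB: "\<bar>a x z * b z y\<bar> \<le> A * B" if "x \<in> closure D" "y \<in> closure D" "z \<in> closure D" for x y z
    using A[OF that(1,3)] B[OF that(3,2)] unfolding abs_mult by (intro mult_mono) auto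
  have meas: "(\<lambda>w. f (u w) (v w)) \<in> borel_measurable N"
    if f: "continuous_on (closure D \<times> closure D) (\<lambda>(x, y). f x y)"
      and uv: "u \<in> N \<rightarrow>\<^sub>M borel" "v \<in> N \<rightarrow>\<^sub>M borel" "\<And>w. w \<in> space N \<Longrightarrow> u w \<in> closure D \<and> v w \<in> closure D"
    for f :: "real^'d \<Rightarrow> real^'d \<Rightarrow> real" and u v and N :: "'z measure"
  proof -
    have "(\<lambda>w. (u w, v w)) \<in> N \<rightarrow>\<^sub>M restrict_space borel (closure D \<times> closure D)"
      using uv by (intro measurable_restrict_space2 borel_measurable_Pair) auto
    from measurable_compose[OF this borel_measurable_continuous_on_restrict[OF f]]
    show ?thesis by simp
  qed
  have idR: "(\<lambda>z. z) \<in> R \<rightarrow>\<^sub>M borel" unfolding R_def by (rule measurable_restrict_space1) simp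
  have fstR: "fst \<in> R \<Otimes>\<^sub>M R \<rightarrow>\<^sub>M borel" and sndR: "snd \<in> R \<Otimes>\<^sub>M R \<rightarrow>\<^sub>M borel"
    using measurable_compose[OF measurable_fst idR] measurable_compose[OF measurable_snd idR] by auto
  have am: "(\<lambda>z. a x z) \<in> borel_measurable R" and bm: "(\<lambda>z. b z x) \<in> borel_measurable R"
    and cm: "(\<lambda>z. c x z) \<in> borel_measurable R" if "x \<in> closure D" for x
    using that cl by (auto intro!: meas[OF ca] meas[OF cb] meas[OF cc] idR simp: space_R)
  have ab_int: "integrable R (\<lambda>z. a x z * b z y)" if "x \<in> closure D" "y \<in> closure D" for x y
    using that am[OF that(1)] bm[OF that(2)] AB[OF that] cl
    by (intro R.integrable_const_bound[where B="A * B"]) (auto intro!: AE_I2 simp: space_R)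
  define G where "G x y = (\<integral>z. a x z * b z y \<partial>R)" for x y
  \<comment> \<open>Continuity in both points jointly: the integrand is bounded by the constant
    \<open>A * B\<close>, which is integrable because \<open>R\<close> is finite, so dominated
    convergence applies.\<close>
  have G_cont: "continuous_on (closure D \<times> closure D) (\<lambda>(x, y). G x y)"
  proof (rule continuous_on_sequentiallyI)
    fix u p assume u: "\<forall>n. u n \<in> closure D \<times> closure D" and p: "p \<in> closure D \<times> closure D" and up: "u \<longlonglongrightarrow> p"
    have "(\<lambda>n. \<integral>z. a (fst (u n)) z * b z (snd (u n)) \<partial>R) \<longlonglongrightarrow> (\<integral>z. a (fst p) z * b z (snd p) \<partial>R)"
    proof (rule integral_dominated_convergence[where w="\<lambda>_. A * B"])
      show "(\<lambda>z. a (fst p) z * b z (snd p)) \<in> borel_measurable R"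
        using p am bm by (intro borel_measurable_times) auto
      show "(\<lambda>z. a (fst (u n)) z * b z (snd (u n))) \<in> borel_measurable R" for n
        using u am bm by (intro borel_measurable_times) (auto simp: mem_Times_iff)
      show "integrable R (\<lambda>_. A * B)" by simp
      show "AE z in R. norm (a (fst (u n)) z * b z (snd (u n))) \<le> A * B" for n
        using u AB cl by (intro AE_I2) (auto simp: space_R mem_Times_iff)
      show "AE z in R. (\<lambda>n. a (fst (u n)) z * b z (snd (u n))) \<longlonglongrightarrow> a (fst p) z * b z (snd p)"
      proof (rule AE_I2)
        fix z assume "z \<in> space R"
        then have z: "z \<in> closure D" using cl by (auto simp: space_R)
        have "(\<lambda>n. (\<lambda>(x, y). a x y) (fst (u n), z)) \<longlonglongrightarrow> (\<lambda>(x, y). a x y) (fst p, z)"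
          using u p z up by (intro continuous_on_tendsto_compose[OF ca] tendsto_intros) (auto simp: mem_Times_iff)
        moreover have "(\<lambda>n. (\<lambda>(x, y). b x y) (z, snd (u n))) \<longlonglongrightarrow> (\<lambda>(x, y). b x y) (z, snd p)"
          using u p z up by (intro continuous_on_tendsto_compose[OF cb] tendsto_intros) (auto simp: mem_Times_iff)
        ultimately show "(\<lambda>n. a (fst (u n)) z * b z (snd (u n))) \<longlonglongrightarrow> a (fst p) z * b z (snd p)"
          by (auto intro: tendsto_mult)
      qed
    qed
    then show "(\<lambda>n. (\<lambda>(x, y). G x y) (u n)) \<longlonglongrightarrow> (\<lambda>(x, y). G x y) p"
      by (simp add: G_def case_prod_beta)
  qed
  obtain H where H: "\<And>x y. x \<in> closure D \<Longrightarrow> y \<in> closure D \<Longrightarrow> \<bar>G x y\<bar> \<le> H" using bound[OF G_cont] by blast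
  have Gm: "(\<lambda>z. G x z) \<in> borel_measurable R" if "x \<in> closure D" for x
    using that cl by (auto intro!: meas[OF G_cont] idR simp: space_R)
  have set_int: "set_lebesgue_integral lborel D f = (\<integral>z. f z \<partial>R)" for f :: "real^'d \<Rightarrow> real"
    unfolding set_lebesgue_integral_def R_def using D_borel by (subst integral_restrict_space) auto
  have ball_int: "(LINT z:ball y e|lborel. f z) = (\<integral>z. indicator (ball y e) z * f z \<partial>R)"
    if "ball y e \<subseteq> D" for f :: "real^'d \<Rightarrow> real" and y e
    using that unfolding set_int[symmetric] set_lebesgue_integral_def
    by (intro Bochner_Integration.integral_cong) (auto simp: indicator_def)
  have ball_meas: "indicator (ball y e) \<in> borel_measurable R" for y :: "real^'d" and e
    by (rule measurable_compose[OF idR borel_measurable_indicator]) simp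
  \<comment> \<open>Here the null set still depends on the ball.\<close>
  have key: "AE x in lborel. x \<in> D \<longrightarrow> (LINT z:ball y e|lborel. c x z) = (LINT z:ball y e|lborel. G x z)"
    if sub: "ball y e \<subseteq> D" for y e
  proof -
    let ?f = "indicator (ball y e) :: real^'d \<Rightarrow> real"
    have f: "?f \<in> L2_space D"
      unfolding L2_space_def set_borel_measurable_def set_integrable_def
    proof (intro CollectI conjI)
      have "(\<lambda>x. indicator D x *\<^sub>R (?f x)\<^sup>2) = ?f" using sub by (auto simp: indicator_def fun_eq_iff)
      then show "integrable lborel (\<lambda>x. indicator D x *\<^sub>R (?f x)\<^sup>2)" by (simp only: integrable_indicator_ball)
      show "(\<lambda>x. indicator D x *\<^sub>R ?f x) \<in> borel_measurable lborel"
        using D_borel by (intro borel_measurable_scaleR borel_measurable_indicator) auto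
    qed
    have ev: "evolution_system_L2 T D (kernel_operator D g)"
      using Green by (simp add: parabolic_Green_function_def)
    have "AE x in lborel. x \<in> D \<longrightarrow>
        kernel_operator D g t s ?f x = kernel_operator D g t r (kernel_operator D g r s ?f) x"
      using ev str f unfolding evolution_system_L2_def by simp
    then show ?thesis
    proof eventually_elim
      case (elim x)
      show ?case
      proof
        assume x: "x \<in> D"
        have xc: "x \<in> closure D" using x cl by auto
        have "(LINT z:ball y e|lborel. c x z) = (\<integral>z. c x z * ?f z \<partial>R)"
          unfolding ball_int[OF sub] by (simp add: mult.commute)
        also have "\<dots> = kernel_operator D g t s ?f x"
          using str by (simp add: kernel_operator_def set_int c_def)
        also have "\<dots> = kernel_operator D g t r (kernel_operator D g r s ?f) x" using elim x by blast
        also have "\<dots> = (\<integral>z. a x z * (\<integral>w. b z w * ?f w \<partial>R) \<partial>R)"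
          using str by (simp add: kernel_operator_def set_int a_def b_def)
        also have "\<dots> = (\<integral>z. (\<integral>w. a x z * b z w * ?f w \<partial>R) \<partial>R)" by (simp add: mult.assoc)
        also have "\<dots> = (\<integral>w. (\<integral>z. a x z * b z w * ?f w \<partial>R) \<partial>R)"
        proof (rule RR.Fubini_integral[symmetric])
          have "(\<lambda>p. a x (fst p)) \<in> borel_measurable (R \<Otimes>\<^sub>M R)" "(\<lambda>p. b (fst p) (snd p)) \<in> borel_measurable (R \<Otimes>\<^sub>M R)"
            using xc cl by (auto intro!: meas[OF ca] meas[OF cb] fstR sndR simp: space_pair_measure space_R)
          moreover have "(\<lambda>p. ?f (snd p)) \<in> borel_measurable (R \<Otimes>\<^sub>M R)"
            by (rule measurable_compose[OF measurable_snd ball_meas])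
          ultimately have m: "(\<lambda>p. a x (fst p) * b (fst p) (snd p) * ?f (snd p)) \<in> borel_measurable (R \<Otimes>\<^sub>M R)"
            by simp
          have "\<bar>a x z * b z w * ?f w\<bar> \<le> A * B" if "z \<in> D" "w \<in> D" for z w
          proof -
            have "\<bar>a x z * b z w\<bar> \<le> A * B" using AB[OF xc, of w z] that cl by auto
            moreover have "\<bar>a x z * b z w * ?f w\<bar> \<le> \<bar>a x z * b z w\<bar>" by (simp add: indicator_def)
            ultimately show ?thesis by linarith
          qed
          then have "integrable (R \<Otimes>\<^sub>M R) (\<lambda>p. a x (fst p) * b (fst p) (snd p) * ?f (snd p))"
            by (intro RRf.integrable_const_bound[where B="A * B"] m AE_I2) (auto simp: space_pair_measure space_R)
          then show "integrable (R \<Otimes>\<^sub>M R) (\<lambda>(w, z). a x w * b w z * ?f z)" by (simp add: case_prod_unfold)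
        qed
        also have "\<dots> = (\<integral>w. ?f w * G x w \<partial>R)" by (simp add: G_def mult.commute)
        also have "\<dots> = (LINT z:ball y e|lborel. G x z)" unfolding ball_int[OF sub] ..
        finally show "(LINT z:ball y e|lborel. c x z) = (LINT z:ball y e|lborel. G x z)" .
      qed
    qed
  qed
  \<comment> \<open>Measurability is known only for the restriction \<open>R\<close> to
    \<open>D\<close>; since the ball lies in \<open>D\<close>, integrability against
    \<open>R\<close> carries over to \<open>lborel\<close>.\<close>
  have si: "set_integrable lborel (ball y e) f"
    if "f \<in> borel_measurable R" "\<And>z. z \<in> D \<Longrightarrow> \<bar>f z\<bar> \<le> F" "ball y e \<subseteq> D" for f :: "real^'d \<Rightarrow> real" and F y e
  proof -
    have "integrable R (\<lambda>z. indicator (ball y e) z * f z)"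
    proof (rule R.integrable_const_bound[where B=F])
      show "(\<lambda>z. indicator (ball y e) z * f z) \<in> borel_measurable R"
        using ball_meas that(1) by (rule borel_measurable_times)
      show "AE z in R. norm (indicator (ball y e) z * f z) \<le> F"
      proof (rule AE_I2)
        fix z assume "z \<in> space R"
        then have "\<bar>f z\<bar> \<le> F" using that(2) by (simp add: space_R)
        then show "norm (indicator (ball y e) z * f z) \<le> F" by (auto simp: indicator_def)
      qed
    qed
    then have "integrable lborel (\<lambda>z. indicator D z *\<^sub>R (indicator (ball y e) z * f z))"
      unfolding R_def using D_borel by (subst (asm) integrable_restrict_space) auto
    moreover have "(\<lambda>z. indicator D z *\<^sub>R (indicator (ball y e) z * f z)) = (\<lambda>z. indicator (ball y e) z *\<^sub>R f z)"
      using that(3) by (auto simp: indicator_def fun_eq_iff)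
    ultimately show ?thesis by (simp add: set_integrable_def)
  qed
  have ci: "set_integrable lborel (ball y e) (c x)" "set_integrable lborel (ball y e) (G x)"
    if "x \<in> D" "ball y e \<subseteq> D" for x y e
  proof -
    have x: "x \<in> closure D" using that(1) cl by auto
    show "set_integrable lborel (ball y e) (c x)"
      by (rule si[OF cm[OF x] _ that(2)], rule C[OF x]) (use cl in auto)
    show "set_integrable lborel (ball y e) (G x)"
      by (rule si[OF Gm[OF x] _ that(2)], rule H[OF x]) (use cl in auto)
  qed
  have DD: "D \<times> D \<subseteq> closure D \<times> closure D" using cl by auto
  have cD: "continuous_on (D \<times> D) (\<lambda>(x, y). c x y)" "continuous_on (D \<times> D) (\<lambda>(x, y). G x y)"
    using continuous_on_subset[OF cc DD] continuous_on_subset[OF G_cont DD] by auto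
  have eqD: "c x y = G x y" if xy: "x \<in> D" "y \<in> D" for x y
  proof (rule antisym)
    have "c x y - G x y \<le> 0"
    proof (rule zero_if_ball_averages_nonpos[OF D(1,2) _ _ _ xy])
      show "continuous_on (D \<times> D) (\<lambda>(x, y). c x y - G x y)"
        using continuous_on_diff[OF cD] by (simp add: case_prod_unfold)
      show "AE x in lborel. x \<in> D \<longrightarrow> (LINT z:ball y e|lborel. c x z - G x z) \<le> 0" if "ball y e \<subseteq> D" for y e
        using key[OF that] by eventually_elim (use ci[OF _ that] in \<open>auto simp: set_integral_diff\<close>)
    qed (auto intro!: set_integral_diff ci)
    then show "c x y \<le> G x y" by simp
    have "G x y - c x y \<le> 0"
    proof (rule zero_if_ball_averages_nonpos[OF D(1,2) _ _ _ xy])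
      show "continuous_on (D \<times> D) (\<lambda>(x, y). G x y - c x y)"
        using continuous_on_diff[OF cD(2,1)] by (simp add: case_prod_unfold)
      show "AE x in lborel. x \<in> D \<longrightarrow> (LINT z:ball y e|lborel. G x z - c x z) \<le> 0" if "ball y e \<subseteq> D" for y e
        using key[OF that] by eventually_elim (use ci[OF _ that] in \<open>auto simp: set_integral_diff\<close>)
    qed (auto intro!: set_integral_diff ci)
    then show "G x y \<le> c x y" by simp
  qed
  \<comment> \<open>A continuous function on a closure is constant if it is constant on the set;
    this reaches the boundary points.\<close>
  have "(\<lambda>(x, y). c x y - G x y) (x, y) = 0"
  proof (rule continuous_constant_on_closure[of "D \<times> D"])
    show "continuous_on (closure (D \<times> D)) (\<lambda>(x, y). c x y - G x y)"
      using continuous_on_diff[OF cc G_cont] by (simp add: case_prod_unfold closure_Times)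
  qed (use eqD xy in \<open>auto simp: closure_Times\<close>)
  then have "ennreal (c x y) = ennreal (G x y)" by simp
  also have "\<dots> = (\<integral>\<^sup>+z. ennreal (a x z * b z y) \<partial>R)"
    unfolding G_def
  proof (rule nn_integral_eq_integral[symmetric, OF ab_int[OF xy]], rule AE_I2)
    fix z assume "z \<in> space R"
    then show "0 \<le> a x z * b z y"
      unfolding a_def b_def using xy cl str by (intro mult_nonneg_nonneg less_imp_le[OF pos]) (auto simp: space_R)
  qed
  also have "\<dots> = (\<integral>\<^sup>+z. ennreal (a x z * b z y) * indicator D z \<partial>lborel)"
    unfolding R_def using D_borel by (subst nn_integral_restrict_space) auto
  \<comment> \<open>The domain of integration grows by the frontier only, a null set.\<close>
  also have "\<dots> = (\<integral>\<^sup>+z. ennreal (a x z * b z y) * indicator (closure D) z \<partial>lborel)"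
    using AE_lborel_closure_convex[OF D(3,1)]
    by (intro nn_integral_cong_AE) (auto simp: indicator_def elim: eventually_mono)
  also have "\<dots> = (\<integral>\<^sup>+z. ennreal (a x z * b z y) \<partial>restrict_space lborel (closure D))"
    by (subst nn_integral_restrict_space) auto
  finally show ?thesis by (simp add: a_def b_def c_def)
qed

section \<open>Path densities on finite sets of times\<close>

text \<open>\<open>Max\<close> is unspecified on the empty set, so the smallest element has no
  meaningful predecessor. This is why products over a grid run over \<open>J - {0}\<close>.\<close>

definition predecessor :: "'t::linorder set \<Rightarrow> 't \<Rightarrow> 't" where
  "predecessor J t = Max {s \<in> J. s < t}"

lemma predecessor_eqI:
  assumes "finite J" "s \<in> J" "s < t" "J \<inter> {s<..<t} = {}"
  shows "predecessor J t = s"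
  unfolding predecessor_def
proof (rule Max_eqI)
  fix y assume "y \<in> {s \<in> J. s < t}"
  then have "y \<in> J" "y < t" by auto
  then show "y \<le> s" using assms(4) by (auto simp: disjoint_iff)
qed (use assms in auto)

lemma predecessor_props:
  assumes "finite J" "s \<in> J" "s < t"
  shows "predecessor J t \<in> J" "predecessor J t < t" "J \<inter> {predecessor J t<..<t} = {}"
proof -
  have *: "finite {s \<in> J. s < t}" "{s \<in> J. s < t} \<noteq> {}"
    using assms by auto
  show "predecessor J t \<in> J" "predecessor J t < t"
    using Max_in[OF *] by (auto simp: predecessor_def)
  show "J \<inter> {predecessor J t<..<t} = {}"
    using Max_ge[OF *(1)] by (auto simp: predecessor_def) (meson leD)
qed

text \<open>If \<open>r\<close> became the predecessor of some \<open>u\<close> other than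
  \<open>t\<close>, then \<open>u\<close> would lie above \<open>r\<close>, hence beyond
  \<open>t\<close>, and \<open>t\<close> itself would be a closer predecessor. The last hypothesis
  on \<open>u\<close> excludes the least element of \<open>J\<close>.\<close>

lemma predecessor_insert_other:
  assumes J: "finite J" and r: "r \<notin> J" and st: "s \<in> J" "t \<in> J" "s < r" "r < t" "J \<inter> {s<..<t} = {}"
    and u: "u \<in> J" "u \<noteq> t" "\<exists>v\<in>J. v < u"
  shows "predecessor (insert r J) u = predecessor J u"
proof (rule predecessor_eqI)
  note p = predecessor_props[OF J]
  obtain v where v: "v \<in> J" "v < u" using u by auto
  show "finite (insert r J)" "predecessor J u \<in> insert r J" "predecessor J u < u"
    using p[OF v] J by auto
  have "r \<notin> {predecessor J u<..<u}"
  proof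
    assume "r \<in> {predecessor J u<..<u}"
    then have r': "predecessor J u < r" "r < u" by auto
    then have "\<not> u < t" using st(3,5) u(1) r'(2) by (auto simp: disjoint_iff)
    then have "t < u" using u(2) by simp
    moreover have "predecessor J u < t" using r' st by order
    ultimately have "t \<in> J \<inter> {predecessor J u<..<u}" using st by simp
    then show False using p(3)[OF v] by auto
  qed
  then show "insert r J \<inter> {predecessor J u<..<u} = {}"
    using p(3)[OF v] by auto
qed

lemma neighbours_exist:
  fixes J :: "'t::linorder set"
  assumes J: "finite J" and r: "r \<notin> J" and ab: "a \<in> J" "a < r" "b \<in> J" "r < b"
  obtains s t where "s \<in> J" "t \<in> J" "s < r" "r < t" "J \<inter> {s<..<t} = {}"
proof
  let ?s = "predecessor J r" and ?t = "Min {u \<in> J. r < u}"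
  note p = predecessor_props[OF J ab(1,2)]
  have *: "finite {u \<in> J. r < u}" "{u \<in> J. r < u} \<noteq> {}" using J ab by auto
  show "?s \<in> J" "?s < r" "?t \<in> J" "r < ?t"
    using p Min_in[OF *] by auto
  have "u \<notin> J" if u: "?s < u" "u < ?t" for u
  proof
    assume uJ: "u \<in> J"
    consider "u < r" | "u = r" | "r < u" by fastforce
    then show False
    proof cases
      case 1 then show ?thesis using p(3) u uJ by auto
    next
      case 2 then show ?thesis using r uJ by simp
    next
      case 3 then show ?thesis using Min_le[OF *(1), of u] u uJ by auto
    qed
  qed
  then show "J \<inter> {?s<..<?t} = {}" by auto
qed

text \<open>Isolates what the path measure is built from, with \<open>C\<close> in the role of
  \<open>closure D\<close>. Continuity is required for fixed times, since each density involves
  finitely many fixed times and only its measurability and boundedness in the space variables are at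
  stake.\<close>

locale bridge_kernel =
  fixes T :: real and C :: "(real^'d) set"
    and g :: "real^'d \<Rightarrow> real \<Rightarrow> real^'d \<Rightarrow> real \<Rightarrow> real"
    and \<mu> :: "real^'d \<Rightarrow> real^'d \<Rightarrow> real"
  assumes T_pos: "0 < T"
    and compact_C: "compact C"
    and g_cont: "0 \<le> s \<Longrightarrow> s < t \<Longrightarrow> t \<le> T \<Longrightarrow> continuous_on (C \<times> C) (\<lambda>(x, y). g x t y s)"
    and g_pos: "0 \<le> s \<Longrightarrow> s < t \<Longrightarrow> t \<le> T \<Longrightarrow> x \<in> C \<Longrightarrow> y \<in> C \<Longrightarrow> 0 < g x t y s"
    and Chapman_Kolmogorov: "0 \<le> s \<Longrightarrow> s < r \<Longrightarrow> r < t \<Longrightarrow> t \<le> T \<Longrightarrow> x \<in> C \<Longrightarrow> y \<in> C \<Longrightarrow>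
      (\<integral>\<^sup>+z. ennreal (g x t z r * g z r y s) \<partial>restrict_space lborel C) = ennreal (g x t y s)"
    and \<mu>_nonneg: "x \<in> C \<Longrightarrow> y \<in> C \<Longrightarrow> 0 \<le> \<mu> x y"
    and \<mu>_measurable:
      "(\<lambda>(x, y). \<mu> x y) \<in> borel_measurable (restrict_space lborel C \<Otimes>\<^sub>M restrict_space lborel C)"
    and \<mu>_integral:
      "(\<integral>\<^sup>+(x, y). ennreal (\<mu> x y) \<partial>(restrict_space lborel C \<Otimes>\<^sub>M restrict_space lborel C)) = 1"
begin

definition R :: "(real^'d) measure" where "R = restrict_space lborel C"

lemma C_borel: "C \<in> sets borel"
  using compact_C by (intro borel_closed compact_imp_closed)

lemma space_R [simp]: "space R = C"
  by (simp add: R_def space_restrict_space)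

lemma sets_R: "sets R = sets (restrict_space borel C)"
  by (simp add: R_def sets_restrict_space)

lemma finite_measure_R: "finite_measure R"
proof
  have "emeasure R (space R) = emeasure lborel C"
    using C_borel by (simp add: R_def emeasure_restrict_space space_restrict_space)
  also have "\<dots> \<noteq> \<infinity>"
    using emeasure_compact_finite[OF compact_C] by simp
  finally show "emeasure R (space R) \<noteq> \<infinity>" .
qed

sublocale R: finite_measure R by (rule finite_measure_R)

sublocale product_sigma_finite "\<lambda>_::real. R"
  by (simp add: product_sigma_finite_def R.sigma_finite_measure_axioms)

lemma g_measurable:
  assumes "0 \<le> s" "s < t" "t \<le> T" and uv: "u \<in> N \<rightarrow>\<^sub>M R" "v \<in> N \<rightarrow>\<^sub>M R"
  shows "(\<lambda>\<omega>. g (u \<omega>) t (v \<omega>) s) \<in> borel_measurable N"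
proof -
  have "(\<lambda>(x, y). g x t y s) \<in> borel_measurable (restrict_space borel (C \<times> C))"
    using assms by (intro borel_measurable_continuous_on_restrict g_cont)
  moreover have "(\<lambda>\<omega>. (u \<omega>, v \<omega>)) \<in> N \<rightarrow>\<^sub>M restrict_space borel (C \<times> C)"
  proof (rule measurable_restrict_space2)
    show "(\<lambda>\<omega>. (u \<omega>, v \<omega>)) \<in> space N \<rightarrow> C \<times> C"
      using uv[THEN measurable_space] by auto
    have "u \<in> N \<rightarrow>\<^sub>M borel" "v \<in> N \<rightarrow>\<^sub>M borel"
      using uv by (auto simp: R_def measurable_restrict_space2_iff)
    then show "(\<lambda>\<omega>. (u \<omega>, v \<omega>)) \<in> N \<rightarrow>\<^sub>M borel" by (rule borel_measurable_Pair)
  qed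
  ultimately have "(\<lambda>\<omega>. (\<lambda>(x, y). g x t y s) (u \<omega>, v \<omega>)) \<in> borel_measurable N"
    by (rule measurable_compose[rotated])
  then show ?thesis by simp
qed

lemma \<mu>_measurable_compose:
  assumes [measurable]: "u \<in> N \<rightarrow>\<^sub>M R" "v \<in> N \<rightarrow>\<^sub>M R"
  shows "(\<lambda>\<omega>. \<mu> (u \<omega>) (v \<omega>)) \<in> borel_measurable N"
proof -
  have [measurable]: "case_prod \<mu> \<in> borel_measurable (R \<Otimes>\<^sub>M R)"
    using \<mu>_measurable by (simp add: R_def)
  have "(\<lambda>\<omega>. case_prod \<mu> (u \<omega>, v \<omega>)) \<in> borel_measurable N" by measurable
  then show ?thesis by simp
qed

section \<open>The bridge density as a probability density in the middle point\<close>

lemma bridge_density_measurable: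
  assumes "0 \<le> s" "s < r" "r < t" "t \<le> T" and "u \<in> N \<rightarrow>\<^sub>M R" "v \<in> N \<rightarrow>\<^sub>M R" "w \<in> N \<rightarrow>\<^sub>M R"
  shows "(\<lambda>\<omega>. bridge_density g (u \<omega>) t (v \<omega>) r (w \<omega>) s) \<in> borel_measurable N"
  unfolding bridge_density_def using assms
  by (intro borel_measurable_divide borel_measurable_times g_measurable) auto

lemma bridge_density_pos:
  assumes "0 \<le> s" "s < r" "r < t" "t \<le> T" "x \<in> C" "y \<in> C" "z \<in> C"
  shows "0 < bridge_density g x t z r y s"
  using assms g_pos[of r t x z] g_pos[of s r z y] g_pos[of s t x y] by (simp add: bridge_density_def)

lemma nn_integral_bridge_density:
  assumes "0 \<le> s" "s < r" "r < t" "t \<le> T" "x \<in> C" "y \<in> C"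
  shows "(\<integral>\<^sup>+z. ennreal (bridge_density g x t z r y s) \<partial>R) = 1"
proof -
  have gp: "0 < g x t y s" using assms by (intro g_pos) auto
  have [measurable]: "(\<lambda>z. g x t z r * g z r y s) \<in> borel_measurable R"
    using assms by (intro borel_measurable_times g_measurable) auto
  have "(\<integral>\<^sup>+z. ennreal (bridge_density g x t z r y s) \<partial>R) =
      (\<integral>\<^sup>+z. ennreal (g x t z r * g z r y s) * ennreal (inverse (g x t y s)) \<partial>R)"
  proof (intro nn_integral_cong)
    fix z assume "z \<in> space R"
    then have "0 < g x t z r" "0 < g z r y s" using assms by (auto intro!: g_pos)
    then show "ennreal (bridge_density g x t z r y s) =
        ennreal (g x t z r * g z r y s) * ennreal (inverse (g x t y s))"
      using gp by (simp add: bridge_density_def divide_inverse ennreal_mult[symmetric])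
  qed
  also have "\<dots> = (\<integral>\<^sup>+z. ennreal (g x t z r * g z r y s) \<partial>R) * ennreal (inverse (g x t y s))"
    by (rule nn_integral_multc) simp
  also have "\<dots> = ennreal (g x t y s) * ennreal (inverse (g x t y s))"
    using assms Chapman_Kolmogorov[of s r t x y] by (simp add: R_def)
  also have "\<dots> = 1" using gp by (simp add: ennreal_mult[symmetric])
  finally show ?thesis .
qed

lemma integral_bridge_density:
  assumes str: "0 \<le> s" "s < r" "r < t" "t \<le> T" "x \<in> C" "y \<in> C"
  shows "(\<integral>z. bridge_density g x t z r y s \<partial>R) = 1"
  using bridge_density_pos[OF str] str
  by (subst integral_eq_nn_integral)
    (auto intro!: AE_I2 bridge_density_measurable simp: nn_integral_bridge_density[OF str] less_imp_le)

text \<open>On the compact set \<open>C \<times> C\<close> the two factors of the numerator attain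
  maxima and the denominator attains a positive minimum. The bound, uniform in the space variables,
  later guarantees that the iterated Bochner integrals are genuine and not \<open>0\<close> by
  convention.\<close>

lemma bridge_density_bounded:
  assumes "0 \<le> s" "s < r" "r < t" "t \<le> T"
  obtains B where "\<And>x y z. x \<in> C \<Longrightarrow> y \<in> C \<Longrightarrow> z \<in> C \<Longrightarrow> bridge_density g x t z r y s \<le> B"
proof (cases "C = {}")
  \<comment> \<open>Extrema exist only on a nonempty set; that \<open>C\<close> is nonempty is
    derived later, from the total mass of \<open>\<mu>\<close>.\<close>
  case True then show ?thesis using that by auto
next
  case False
  have K: "compact (C \<times> C)" "C \<times> C \<noteq> {}" using compact_C False by (auto intro: compact_Times)
  obtain p where p: "p \<in> C \<times> C" "\<And>q. q \<in> C \<times> C \<Longrightarrow> (\<lambda>(x, y). g x t y r) q \<le> (\<lambda>(x, y). g x t y r) p"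
    using continuous_attains_sup[OF K g_cont[of r t]] assms by auto
  obtain p' where p': "p' \<in> C \<times> C" "\<And>q. q \<in> C \<times> C \<Longrightarrow> (\<lambda>(x, y). g x r y s) q \<le> (\<lambda>(x, y). g x r y s) p'"
    using continuous_attains_sup[OF K g_cont[of s r]] assms by auto
  obtain q where q: "q \<in> C \<times> C" "\<And>q'. q' \<in> C \<times> C \<Longrightarrow> (\<lambda>(x, y). g x t y s) q \<le> (\<lambda>(x, y). g x t y s) q'"
    using continuous_attains_inf[OF K g_cont[of s t]] assms by auto
  have qp: "0 < g (fst q) t (snd q) s" using q(1) assms by (intro g_pos) auto
  show ?thesis
  proof
    fix x y z assume xyz: "x \<in> C" "y \<in> C" "z \<in> C"
    have 1: "g x t z r \<le> g (fst p) t (snd p) r" "g z r y s \<le> g (fst p') r (snd p') s"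
      "g (fst q) t (snd q) s \<le> g x t y s"
      using p(2)[of "(x, z)"] p'(2)[of "(z, y)"] q(2)[of "(x, y)"] xyz by (auto simp: case_prod_beta)
    have 2: "0 < g x t z r" "0 < g z r y s" using xyz assms by (auto intro!: g_pos)
    show "bridge_density g x t z r y s \<le>
        g (fst p) t (snd p) r * g (fst p') r (snd p') s / g (fst q) t (snd q) s"
      unfolding bridge_density_def using 1 2 qp by (intro frac_le mult_mono mult_nonneg_nonneg) auto
  qed
qed

text \<open>By Chapman-Kolmogorov the product integrates over the interior coordinates to
  \<open>g (\<omega> T) T (\<omega> 0) 0\<close>. The quotient in front cancels exactly this, so the
  endpoints are left with density \<open>\<mu>\<close>.\<close>

definition path_density :: "real set \<Rightarrow> (real \<Rightarrow> real^'d) \<Rightarrow> real" where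
  "path_density J \<omega> = \<mu> (\<omega> 0) (\<omega> T) / g (\<omega> T) T (\<omega> 0) 0 *
     (\<Prod>\<tau>\<in>J - {0}. g (\<omega> \<tau>) \<tau> (\<omega> (predecessor J \<tau>)) (predecessor J \<tau>))"

text \<open>Both ends of the time interval are compulsory because \<open>\<mu>\<close> couples them;
  as a consequence any further time has a neighbour on each side.\<close>

definition time_grid :: "real set \<Rightarrow> bool" where
  "time_grid J \<longleftrightarrow> finite J \<and> 0 \<in> J \<and> T \<in> J \<and> J \<subseteq> {0..T}"

lemma time_gridD:
  assumes "time_grid J"
  shows "finite J" "0 \<in> J" "T \<in> J" "J \<subseteq> {0..T}"
  using assms by (auto simp: time_grid_def)

lemma time_grid_insert: "time_grid J \<Longrightarrow> r \<in> {0..T} \<Longrightarrow> time_grid (insert r J)"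
  by (auto simp: time_grid_def)

lemma predecessor_grid:
  assumes "time_grid J" "t \<in> J - {0}"
  shows "predecessor J t \<in> J" "0 \<le> predecessor J t" "predecessor J t < t" "t \<le> T"
proof -
  note gr = time_gridD[OF assms(1)]
  have "0 < t" "t \<le> T" using assms gr by (auto simp: less_le)
  with predecessor_props[OF gr(1,2) \<open>0 < t\<close>] gr(4)
  show "predecessor J t \<in> J" "0 \<le> predecessor J t" "predecessor J t < t" "t \<le> T"
    by auto
qed

lemma path_density_cong:
  assumes J: "time_grid J" and "\<And>\<tau>. \<tau> \<in> J \<Longrightarrow> \<omega> \<tau> = \<omega>' \<tau>"
  shows "path_density J \<omega> = path_density J \<omega>'"
proof -
  have "\<omega> 0 = \<omega>' 0" "\<omega> T = \<omega>' T"
    using assms time_gridD[OF J] by auto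
  moreover have "\<omega> \<tau> = \<omega>' \<tau>" "\<omega> (predecessor J \<tau>) = \<omega>' (predecessor J \<tau>)" if "\<tau> \<in> J - {0}" for \<tau>
    using that assms(2) predecessor_grid(1)[OF J that] by auto
  ultimately show ?thesis
    unfolding path_density_def by simp
qed

lemma path_density_nonneg:
  assumes J: "time_grid J" and \<omega>: "\<And>\<tau>. \<tau> \<in> J \<Longrightarrow> \<omega> \<tau> \<in> C"
  shows "0 \<le> path_density J \<omega>"
proof -
  have "0 < g (\<omega> T) T (\<omega> 0) 0" "0 \<le> \<mu> (\<omega> 0) (\<omega> T)"
    using \<omega> time_gridD[OF J] T_pos by (auto intro!: g_pos \<mu>_nonneg)
  moreover have "0 < (\<Prod>\<tau>\<in>J - {0}. g (\<omega> \<tau>) \<tau> (\<omega> (predecessor J \<tau>)) (predecessor J \<tau>))"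
  proof (intro prod_pos ballI)
    fix \<tau> assume \<tau>: "\<tau> \<in> J - {0}"
    show "0 < g (\<omega> \<tau>) \<tau> (\<omega> (predecessor J \<tau>)) (predecessor J \<tau>)"
      using predecessor_grid[OF J \<tau>] \<tau> \<omega> by (intro g_pos) auto
  qed
  ultimately show ?thesis by (simp add: path_density_def)
qed

lemma path_density_measurable:
  assumes J: "time_grid J" and "J \<subseteq> K"
  shows "path_density J \<in> borel_measurable (PiM K (\<lambda>_. R))"
proof -
  have 1: "(\<lambda>\<omega>. \<omega> \<tau>) \<in> PiM K (\<lambda>_. R) \<rightarrow>\<^sub>M R" if "\<tau> \<in> J" for \<tau>
    using that assms by (intro measurable_component_singleton) auto
  note gr = time_gridD[OF J]
  have "(\<lambda>\<omega>. g (\<omega> \<tau>) \<tau> (\<omega> (predecessor J \<tau>)) (predecessor J \<tau>)) \<in> borel_measurable (PiM K (\<lambda>_. R))"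
    if "\<tau> \<in> J - {0}" for \<tau>
    using that predecessor_grid[OF J that] by (intro g_measurable 1) auto
  moreover have "(\<lambda>\<omega>. \<mu> (\<omega> 0) (\<omega> T)) \<in> borel_measurable (PiM K (\<lambda>_. R))"
    by (intro \<mu>_measurable_compose 1 gr)
  moreover have "(\<lambda>\<omega>. g (\<omega> T) T (\<omega> 0) 0) \<in> borel_measurable (PiM K (\<lambda>_. R))"
    using T_pos by (intro g_measurable 1 gr) auto
  ultimately show ?thesis
    unfolding path_density_def
    by (intro borel_measurable_times borel_measurable_divide borel_measurable_prod)
qed

text \<open>Only the factor at \<open>t\<close> sees its predecessor change, from \<open>s\<close>
  to \<open>r\<close>, and one factor at \<open>r\<close> is new. The two new factors divided by the
  old factor from \<open>s\<close> to \<open>t\<close> are the bridge density; positivity of the old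
  factor permits the division.\<close>

lemma path_density_insert:
  assumes J: "time_grid J" and r: "r \<notin> J"
    and st: "s \<in> J" "t \<in> J" "s < r" "r < t" "J \<inter> {s<..<t} = {}"
    and \<omega>: "\<And>\<tau>. \<tau> \<in> J \<Longrightarrow> \<omega> \<tau> \<in> C"
  shows "path_density (insert r J) \<omega> = path_density J \<omega> * bridge_density g (\<omega> t) t (\<omega> r) r (\<omega> s) s"
proof -
  note gr = time_gridD[OF J]
  let ?f = "\<lambda>K \<tau>. g (\<omega> \<tau>) \<tau> (\<omega> (predecessor K \<tau>)) (predecessor K \<tau>)"
  have pos: "0 \<le> s" "t \<le> T" "t \<noteq> 0" "r \<noteq> 0" using st gr by auto
  have g0: "g (\<omega> t) t (\<omega> s) s > 0" using st pos \<omega> by (intro g_pos) auto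
  have "predecessor J t = s" "predecessor (insert r J) t = r" "predecessor (insert r J) r = s"
    using st gr by (auto intro!: predecessor_eqI)
  then have e: "?f J t = g (\<omega> t) t (\<omega> s) s" "?f (insert r J) t = g (\<omega> t) t (\<omega> r) r"
    "?f (insert r J) r = g (\<omega> r) r (\<omega> s) s" by auto
  have rest: "?f (insert r J) \<tau> = ?f J \<tau>" if "\<tau> \<in> J - {0} - {t}" for \<tau>
  proof -
    have "0 < \<tau>" using that gr by (force simp: less_le)
    then have "predecessor (insert r J) \<tau> = predecessor J \<tau>"
      using that gr st r by (intro predecessor_insert_other[OF gr(1) r st]) auto
    then show ?thesis by simp
  qed
  have "prod (?f (insert r J)) (insert r J - {0}) = ?f (insert r J) r * prod (?f (insert r J)) (J - {0})"
    using gr r pos by (simp add: insert_Diff_if)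
  also have "prod (?f (insert r J)) (J - {0}) = ?f (insert r J) t * prod (?f (insert r J)) (J - {0} - {t})"
    using gr st pos by (intro prod.remove) auto
  also have "prod (?f (insert r J)) (J - {0} - {t}) = prod (?f J) (J - {0} - {t})"
    using rest by (rule prod.cong[OF refl])
  finally have 1: "prod (?f (insert r J)) (insert r J - {0}) =
      g (\<omega> r) r (\<omega> s) s * (g (\<omega> t) t (\<omega> r) r * prod (?f J) (J - {0} - {t}))"
    unfolding e .
  have 2: "prod (?f J) (J - {0}) = g (\<omega> t) t (\<omega> s) s * prod (?f J) (J - {0} - {t})"
    unfolding e(1)[symmetric] using gr st pos by (intro prod.remove) auto
  show ?thesis
    unfolding path_density_def bridge_density_def 1 2 using g0 by simp
qed

section \<open>Laws on grids and their consistency\<close>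

definition grid_law :: "real set \<Rightarrow> (real \<Rightarrow> real^'d) measure" where
  "grid_law J = density (PiM J (\<lambda>_. R)) (\<lambda>\<omega>. ennreal (path_density J \<omega>))"

lemma sets_grid_law [measurable_cong, simp]: "sets (grid_law J) = sets (PiM J (\<lambda>_. R))"
  by (simp add: grid_law_def)

lemma space_grid_law [simp]: "space (grid_law J) = (\<Pi>\<^sub>E \<tau>\<in>J. C)"
  by (simp add: grid_law_def space_PiM)

lemma nn_integral_grid_law:
  assumes "time_grid J" "F \<in> borel_measurable (PiM J (\<lambda>_. R))"
  shows "(\<integral>\<^sup>+\<omega>. F \<omega> \<partial>grid_law J) = (\<integral>\<^sup>+\<omega>. ennreal (path_density J \<omega>) * F \<omega> \<partial>PiM J (\<lambda>_. R))"
  unfolding grid_law_def using assms path_density_measurable[of J J]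
  by (intro nn_integral_density) auto

text \<open>The integrated form of \<open>path_density_insert\<close>: given all other coordinates,
  coordinate \<open>r\<close> is distributed by the bridge density between its neighbours.
  Consistency takes \<open>F\<close> independent of coordinate \<open>r\<close>; the conditional
  laws take \<open>F\<close> with a factor in that coordinate.\<close>

lemma nn_integral_grid_law_insert:
  assumes J: "time_grid J" and r: "r \<notin> J"
    and st: "s \<in> J" "t \<in> J" "s < r" "r < t" "J \<inter> {s<..<t} = {}"
    and F: "F \<in> borel_measurable (PiM (insert r J) (\<lambda>_. R))"
  shows "(\<integral>\<^sup>+\<omega>. F \<omega> \<partial>grid_law (insert r J)) =
    (\<integral>\<^sup>+\<omega>. (\<integral>\<^sup>+z. ennreal (bridge_density g (\<omega> t) t z r (\<omega> s) s) * F (fun_upd \<omega> r z) \<partial>R) \<partial>grid_law J)"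
proof -
  note gr = time_gridD[OF J]
  have pos: "0 \<le> s" "t \<le> T" "r \<in> {0..T}" using st gr by auto
  note J' = time_grid_insert[OF J pos(3)]
  have [measurable]: "path_density (insert r J) \<in> borel_measurable (PiM (insert r J) (\<lambda>_. R))"
    "path_density J \<in> borel_measurable (PiM J (\<lambda>_. R))"
    by (auto intro!: path_density_measurable J J')
  have upd[measurable]: "(\<lambda>(\<omega>, z). fun_upd \<omega> r z) \<in> PiM J (\<lambda>_. R) \<Otimes>\<^sub>M R \<rightarrow>\<^sub>M PiM (insert r J) (\<lambda>_. R)"
    by (rule measurable_add_dim)
  have [measurable]: "F \<in> borel_measurable (PiM (insert r J) (\<lambda>_. R))" by (rule F)
  have [measurable]: "(\<lambda>(\<omega>, z). bridge_density g (\<omega> t) t z r (\<omega> s) s) \<in> borel_measurable (PiM J (\<lambda>_. R) \<Otimes>\<^sub>M R)"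
    unfolding case_prod_beta using st pos
    by (intro bridge_density_measurable) auto
  have "(\<integral>\<^sup>+\<omega>. F \<omega> \<partial>grid_law (insert r J)) =
      (\<integral>\<^sup>+\<omega>. (\<integral>\<^sup>+z. ennreal (path_density (insert r J) (fun_upd \<omega> r z)) * F (fun_upd \<omega> r z) \<partial>R) \<partial>PiM J (\<lambda>_. R))"
    using J' gr r by (subst nn_integral_grid_law) (auto intro!: product_nn_integral_insert)
  also have "\<dots> = (\<integral>\<^sup>+\<omega>. (\<integral>\<^sup>+z. ennreal (path_density J \<omega>) *
      (ennreal (bridge_density g (\<omega> t) t z r (\<omega> s) s) * F (fun_upd \<omega> r z)) \<partial>R) \<partial>PiM J (\<lambda>_. R))"
  proof (intro nn_integral_cong)
    fix \<omega> z assume \<omega>: "\<omega> \<in> space (PiM J (\<lambda>_. R))" and z: "z \<in> space R"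
    have C: "\<omega> \<tau> \<in> C" if "\<tau> \<in> J" for \<tau> using \<omega> that by (auto simp: space_PiM)
    have "path_density (insert r J) (fun_upd \<omega> r z) =
        path_density J (fun_upd \<omega> r z) * bridge_density g (\<omega> t) t z r (\<omega> s) s"
      using path_density_insert[OF J r st, of "fun_upd \<omega> r z"] C st r by (metis fun_upd_apply)
    also have "path_density J (fun_upd \<omega> r z) = path_density J \<omega>"
      using r by (intro path_density_cong[OF J]) auto
    finally show "ennreal (path_density (insert r J) (fun_upd \<omega> r z)) * F (fun_upd \<omega> r z) =
        ennreal (path_density J \<omega>) * (ennreal (bridge_density g (\<omega> t) t z r (\<omega> s) s) * F (fun_upd \<omega> r z))"
      using path_density_nonneg[OF J, of \<omega>] C by (simp del: fun_upd_apply add: ennreal_mult' mult.assoc)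
  qed
  also have "\<dots> = (\<integral>\<^sup>+\<omega>. ennreal (path_density J \<omega>) *
      (\<integral>\<^sup>+z. ennreal (bridge_density g (\<omega> t) t z r (\<omega> s) s) * F (fun_upd \<omega> r z) \<partial>R) \<partial>PiM J (\<lambda>_. R))"
    by (intro nn_integral_cong nn_integral_cmult) measurable
  also have "\<dots> = (\<integral>\<^sup>+\<omega>. (\<integral>\<^sup>+z. ennreal (bridge_density g (\<omega> t) t z r (\<omega> s) s) * F (fun_upd \<omega> r z) \<partial>R) \<partial>grid_law J)"
    by (rule nn_integral_grid_law[OF J, symmetric]) measurable
  finally show ?thesis .
qed

lemma restrict_measurable: "J \<subseteq> K \<Longrightarrow> (\<lambda>\<omega>. restrict \<omega> J) \<in> PiM K (\<lambda>_. R) \<rightarrow>\<^sub>M PiM J (\<lambda>_. R)"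
  by (rule measurable_restrict_subset)

lemma distr_grid_law_insert:
  assumes J: "time_grid J" and r: "r \<in> {0..T}" "r \<notin> J"
  shows "distr (grid_law (insert r J)) (PiM J (\<lambda>_. R)) (\<lambda>\<omega>. restrict \<omega> J) = grid_law J"
proof (rule measure_eqI)
  note gr = time_gridD[OF J]
  have "0 < r" "r < T" using r gr by (auto simp: less_le)
  then obtain s t where st: "s \<in> J" "t \<in> J" "s < r" "r < t" "J \<inter> {s<..<t} = {}"
    using neighbours_exist[OF gr(1) r(2) gr(2) _ gr(3)] by blast
  have pos: "0 \<le> s" "t \<le> T" using st gr by auto
  have res[measurable]: "(\<lambda>\<omega>. restrict \<omega> J) \<in> PiM (insert r J) (\<lambda>_. R) \<rightarrow>\<^sub>M PiM J (\<lambda>_. R)"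
    by (rule restrict_measurable) auto
  fix A assume "A \<in> sets (distr (grid_law (insert r J)) (PiM J (\<lambda>_. R)) (\<lambda>\<omega>. restrict \<omega> J))"
  then have A[measurable]: "A \<in> sets (PiM J (\<lambda>_. R))" by simp
  have "emeasure (distr (grid_law (insert r J)) (PiM J (\<lambda>_. R)) (\<lambda>\<omega>. restrict \<omega> J)) A =
      (\<integral>\<^sup>+\<omega>. indicator A \<omega> \<partial>distr (grid_law (insert r J)) (PiM J (\<lambda>_. R)) (\<lambda>\<omega>. restrict \<omega> J))"
    by simp
  also have "\<dots> = (\<integral>\<^sup>+\<omega>. indicator A (restrict \<omega> J) \<partial>grid_law (insert r J))"
    by (rule nn_integral_distr) measurable
  also have "\<dots> = (\<integral>\<^sup>+\<omega>. (\<integral>\<^sup>+z. ennreal (bridge_density g (\<omega> t) t z r (\<omega> s) s) *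
      indicator A (restrict (fun_upd \<omega> r z) J) \<partial>R) \<partial>grid_law J)"
    by (rule nn_integral_grid_law_insert[OF J r(2) st]) measurable
  \<comment> \<open>The restriction forgets the new coordinate, so the inner integral reduces to the
    total mass of the bridge density.\<close>
  also have "\<dots> = (\<integral>\<^sup>+\<omega>. indicator A \<omega> \<partial>grid_law J)"
  proof (intro nn_integral_cong)
    fix \<omega> assume "\<omega> \<in> space (grid_law J)"
    then have \<omega>: "\<omega> \<in> extensional J" "\<And>\<tau>. \<tau> \<in> J \<Longrightarrow> \<omega> \<tau> \<in> C" by (auto simp: PiE_iff)
    have "restrict (fun_upd \<omega> r z) J = \<omega>" for z
      using \<omega>(1) r(2) by (auto simp: fun_eq_iff extensional_def)
    moreover have [measurable]: "(\<lambda>z. bridge_density g (\<omega> t) t z r (\<omega> s) s) \<in> borel_measurable R"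
      using st pos \<omega>(2) by (intro bridge_density_measurable) auto
    ultimately show "(\<integral>\<^sup>+z. ennreal (bridge_density g (\<omega> t) t z r (\<omega> s) s) *
      indicator A (restrict (fun_upd \<omega> r z) J) \<partial>R) = indicator A \<omega>"
      using nn_integral_bridge_density[of s r t "\<omega> t" "\<omega> s"] st pos \<omega>(2)
      by (simp add: nn_integral_multc)
  qed
  also have "\<dots> = emeasure (grid_law J) A" by simp
  finally show "emeasure (distr (grid_law (insert r J)) (PiM J (\<lambda>_. R)) (\<lambda>\<omega>. restrict \<omega> J)) A =
    emeasure (grid_law J) A" .
qed simp

lemma distr_grid_law_Un:
  assumes J: "time_grid J"
  shows "finite L \<Longrightarrow> L \<subseteq> {0..T} - J \<Longrightarrow>
    distr (grid_law (J \<union> L)) (PiM J (\<lambda>_. R)) (\<lambda>\<omega>. restrict \<omega> J) = grid_law J"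
proof (induction L rule: finite_induct)
  case empty
  have "distr (grid_law J) (PiM J (\<lambda>_. R)) (\<lambda>\<omega>. restrict \<omega> J) = distr (grid_law J) (PiM J (\<lambda>_. R)) (\<lambda>\<omega>. \<omega>)"
    by (intro distr_cong) (auto simp: PiE_iff extensional_restrict)
  also have "\<dots> = grid_law J" by (rule distr_id2) simp
  finally show ?case by (simp only: Un_empty_right)
next
  case (insert r L)
  have JL: "time_grid (J \<union> L)" using J insert by (auto simp: time_grid_def)
  have "distr (grid_law (J \<union> insert r L)) (PiM J (\<lambda>_. R)) (\<lambda>\<omega>. restrict \<omega> J) =
    distr (grid_law (insert r (J \<union> L))) (PiM J (\<lambda>_. R)) ((\<lambda>\<omega>. restrict \<omega> J) \<circ> (\<lambda>\<omega>. restrict \<omega> (J \<union> L)))"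
    by (intro distr_cong) (auto simp: fun_eq_iff)
  also have "\<dots> = distr (distr (grid_law (insert r (J \<union> L))) (PiM (J \<union> L) (\<lambda>_. R)) (\<lambda>\<omega>. restrict \<omega> (J \<union> L)))
      (PiM J (\<lambda>_. R)) (\<lambda>\<omega>. restrict \<omega> J)"
    by (intro distr_distr[symmetric]) (auto simp: measurable_cong_sets[OF sets_grid_law refl] intro!: restrict_measurable)
  also have "\<dots> = distr (grid_law (J \<union> L)) (PiM J (\<lambda>_. R)) (\<lambda>\<omega>. restrict \<omega> J)"
    using insert by (subst distr_grid_law_insert[OF JL]) auto
  also have "\<dots> = grid_law J" using insert by (intro insert.IH) auto
  finally show ?case by (simp only: Un_insert_right)
qed

lemma distr_grid_law:
  assumes "time_grid J" "time_grid K" "J \<subseteq> K"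
  shows "distr (grid_law K) (PiM J (\<lambda>_. R)) (\<lambda>\<omega>. restrict \<omega> J) = grid_law J"
proof -
  have "J \<union> (K - J) = K" using assms by auto
  then show ?thesis
    using distr_grid_law_Un[OF assms(1), of "K - J"] assms time_gridD[OF assms(2)] by auto
qed

section \<open>The grid of the two endpoints and total mass\<close>

lemma time_grid_endpoints: "time_grid {0, T}"
  using T_pos by (auto simp: time_grid_def)

text \<open>The single factor of the product is the Green function from \<open>0\<close> to
  \<open>T\<close>, which the normalising denominator cancels.\<close>

lemma path_density_endpoints:
  assumes "\<omega> 0 \<in> C" "\<omega> T \<in> C"
  shows "path_density {0, T} \<omega> = \<mu> (\<omega> 0) (\<omega> T)"
proof -
  have "predecessor {0, T} T = 0" using T_pos by (intro predecessor_eqI) auto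
  moreover have "{0, T} - {0} = {T}" using T_pos by auto
  moreover have "0 < g (\<omega> T) T (\<omega> 0) 0" using assms T_pos by (intro g_pos) auto
  ultimately show ?thesis by (simp add: path_density_def)
qed

lemma nn_integral_grid_law_endpoints:
  assumes [measurable]: "case_prod f \<in> borel_measurable (R \<Otimes>\<^sub>M R)"
  shows "(\<integral>\<^sup>+\<omega>. f (\<omega> 0) (\<omega> T) \<partial>grid_law {0, T}) =
    (\<integral>\<^sup>+(x, y). ennreal (\<mu> x y) * f x y \<partial>(R \<Otimes>\<^sub>M R))"
proof -
  have [measurable]: "case_prod \<mu> \<in> borel_measurable (R \<Otimes>\<^sub>M R)"
    using \<mu>_measurable by (simp add: R_def)
  have [measurable]: "(\<lambda>\<omega>. f (\<omega> 0) (\<omega> T)) \<in> borel_measurable (PiM {0, T} (\<lambda>_. R))"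
  proof -
    have "(\<lambda>\<omega>. case_prod f (\<omega> 0, \<omega> T)) \<in> borel_measurable (PiM {0, T} (\<lambda>_. R))" by measurable
    then show ?thesis by simp
  qed
  have "(\<integral>\<^sup>+\<omega>. f (\<omega> 0) (\<omega> T) \<partial>grid_law {0, T}) =
      (\<integral>\<^sup>+\<omega>. ennreal (path_density {0, T} \<omega>) * f (\<omega> 0) (\<omega> T) \<partial>PiM {0, T} (\<lambda>_. R))"
    by (rule nn_integral_grid_law[OF time_grid_endpoints]) measurable
  also have "\<dots> = (\<integral>\<^sup>+\<omega>. ennreal (\<mu> (\<omega> 0) (\<omega> T)) * f (\<omega> 0) (\<omega> T) \<partial>PiM {0, T} (\<lambda>_. R))"
    by (intro nn_integral_cong) (auto simp: space_PiM path_density_endpoints PiE_iff)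
  also have "\<dots> = (\<integral>\<^sup>+z. ennreal (\<mu> (fst z) (snd z)) * f (fst z) (snd z) \<partial>(R \<Otimes>\<^sub>M R))"
    using T_pos by (intro product_nn_integral_pair) auto
  finally show ?thesis by (simp add: case_prod_unfold)
qed

text \<open>On the endpoint grid the total mass is the integral of \<open>\<mu>\<close>. A larger
  grid projects onto that law, and a measure whose image under a measurable map is a probability is
  itself one.\<close>

lemma prob_space_grid_law:
  assumes J: "time_grid J"
  shows "prob_space (grid_law J)"
proof -
  have "prob_space (grid_law {0, T})"
  proof
    have "emeasure (grid_law {0, T}) (space (grid_law {0, T})) = (\<integral>\<^sup>+\<omega>. 1 \<partial>grid_law {0, T})" by simp
    also have "\<dots> = 1"
      using nn_integral_grid_law_endpoints[of "\<lambda>_ _. 1"] \<mu>_integral by (simp add: R_def)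
    finally show "emeasure (grid_law {0, T}) (space (grid_law {0, T})) = 1" .
  qed
  then have "prob_space (distr (grid_law J) (PiM {0, T} (\<lambda>_. R)) (\<lambda>\<omega>. restrict \<omega> {0, T}))"
    using distr_grid_law[OF time_grid_endpoints J] time_gridD[OF J] by simp
  then show ?thesis
    using time_gridD[OF J]
    by (intro prob_space_distrD[of "\<lambda>\<omega>. restrict \<omega> {0, T}" "grid_law J" "PiM {0, T} (\<lambda>_. R)"])
      (auto simp: measurable_cong_sets[OF sets_grid_law refl] intro!: restrict_measurable)
qed

text \<open>A probability measure cannot live on an empty space. A point of \<open>C\<close> is
  needed as the value of the retraction outside \<open>C\<close>.\<close>

lemma C_nonempty: "C \<noteq> {}"
proof
  assume "C = {}"
  then have "(\<Pi>\<^sub>E \<tau>\<in>{0, T}. C) = {}" by (auto simp: PiE_eq_empty_iff)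
  then show False
    using prob_space.not_empty[OF prob_space_grid_law[OF time_grid_endpoints]] by simp
qed

text \<open>The library's Daniell-Kolmogorov theorem is stated for the Borel sets of a whole Polish
  space, so the laws on \<open>C\<close> are first transported there, and the limit is then retracted to
  paths in \<open>C\<close>.\<close>

definition marginal :: "real set \<Rightarrow> (real \<Rightarrow> real^'d) measure" where
  "marginal J = distr (grid_law (J \<union> {0, T})) (PiM J (\<lambda>_. borel)) (\<lambda>\<omega>. restrict \<omega> J)"

lemma restrict_measurable_borel:
  assumes "J \<subseteq> K"
  shows "(\<lambda>\<omega>. restrict \<omega> J) \<in> PiM K (\<lambda>_. R) \<rightarrow>\<^sub>M PiM J (\<lambda>_. borel)"
proof (rule measurable_restrict)
  fix \<tau> assume "\<tau> \<in> J"
  then have "(\<lambda>\<omega>. \<omega> \<tau>) \<in> PiM K (\<lambda>_. R) \<rightarrow>\<^sub>M R" using assms by (intro measurable_component_singleton) auto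
  then show "(\<lambda>\<omega>. \<omega> \<tau>) \<in> PiM K (\<lambda>_. R) \<rightarrow>\<^sub>M borel"
    by (auto simp: R_def measurable_restrict_space2_iff)
qed

lemma time_grid_Un: "finite J \<Longrightarrow> J \<subseteq> {0..T} \<Longrightarrow> time_grid (J \<union> {0, T})"
  using T_pos by (auto simp: time_grid_def)

text \<open>The projective limit asks for all finite sets of times, also those without
  \<open>0\<close> or \<open>T\<close>. Endpoints are added and then forgotten; for
  \<open>J \<subseteq> H\<close> both marginals are images of the law on the common grid
  \<open>H \<union> {0, T}\<close>, where consistency of the grid laws applies.\<close>

lemma marginal_projective: "polish_projective {0..T} marginal"
  unfolding polish_projective_def projective_family_def
proof (intro conjI allI impI)
  fix J H :: "real set" assume JH: "J \<subseteq> H" "finite H" "H \<subseteq> {0..T}"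
  let ?J = "J \<union> {0, T}" and ?H = "H \<union> {0, T}"
  have grids: "time_grid ?J" "time_grid ?H" using JH by (intro time_grid_Un; auto intro: finite_subset)+
  have "marginal J = distr (distr (grid_law ?H) (PiM ?J (\<lambda>_. R)) (\<lambda>\<omega>. restrict \<omega> ?J))
      (PiM J (\<lambda>_. borel)) (\<lambda>\<omega>. restrict \<omega> J)"
    unfolding marginal_def using grids JH by (subst distr_grid_law) auto
  also have "\<dots> = distr (grid_law ?H) (PiM J (\<lambda>_. borel)) ((\<lambda>\<omega>. restrict \<omega> J) \<circ> (\<lambda>\<omega>. restrict \<omega> ?J))"
    using JH by (intro distr_distr)
      (auto simp: measurable_cong_sets[OF sets_grid_law refl] intro!: restrict_measurable restrict_measurable_borel)
  also have "\<dots> = distr (grid_law ?H) (PiM J (\<lambda>_. borel)) ((\<lambda>\<omega>. restrict \<omega> J) \<circ> (\<lambda>\<omega>. restrict \<omega> H))"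
    using JH by (intro distr_cong) (auto simp: fun_eq_iff)
  also have "\<dots> = distr (marginal H) (PiM J (\<lambda>_. borel)) (\<lambda>\<omega>. restrict \<omega> J)"
    unfolding marginal_def using JH
    by (intro distr_distr[symmetric])
      (auto simp: measurable_cong_sets[OF sets_grid_law refl]
        intro!: measurable_restrict_subset restrict_measurable_borel)
  finally show "marginal J = distr (marginal H) (PiM J (\<lambda>_. borel)) (\<lambda>\<omega>. restrict \<omega> J)" .
next
  fix J :: "real set" assume J: "finite J" "J \<subseteq> {0..T}"
  show "prob_space (marginal J)"
    unfolding marginal_def using J
    by (intro prob_space.prob_space_distr prob_space_grid_law time_grid_Un)
      (auto simp: measurable_cong_sets[OF sets_grid_law refl] intro!: restrict_measurable_borel)
qed

lemma path_measure_exists: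
  obtains N where "prob_space N" "sets N = sets (PiM {0..T} (\<lambda>_. R))"
    "\<And>J. time_grid J \<Longrightarrow> distr N (PiM J (\<lambda>_. R)) (\<lambda>\<omega>. restrict \<omega> J) = grid_law J"
proof -
  interpret L: polish_projective "{0..T}" marginal by (rule marginal_projective)
  obtain c where c: "c \<in> C" using C_nonempty by auto
  \<comment> \<open>The set of all paths that stay in \<open>C\<close> is not measurable in an
    uncountable product, so the limit cannot simply be restricted to it. It is pushed forward
    instead, coordinate by coordinate, along a Borel map that fixes \<open>C\<close> and therefore
    does not alter the laws on grids.\<close>
  define f where "f x = (if x \<in> C then x else c)" for x
  have f[measurable]: "f \<in> borel \<rightarrow>\<^sub>M R"
    unfolding R_def f_def using C_borel c
    by (intro measurable_restrict_space2) (auto simp: measurable_lborel1 intro!: measurable_If)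
  define F where "F J \<omega> = (\<lambda>\<tau>\<in>J. f (\<omega> \<tau>))" for J :: "real set" and \<omega>
  have F: "F J \<in> PiM K (\<lambda>_. borel) \<rightarrow>\<^sub>M PiM J (\<lambda>_. R)" if "J \<subseteq> K" for J K
    unfolding F_def using that
    by (intro measurable_restrict measurable_compose[OF _ f] measurable_component_singleton) auto
  define N where "N = distr L.lim (PiM {0..T} (\<lambda>_. R)) (F {0..T})"
  have limF: "F {0..T} \<in> L.lim \<rightarrow>\<^sub>M PiM {0..T} (\<lambda>_. R)"
    using F by (simp add: measurable_cong_sets[OF L.sets_lim refl])
  show ?thesis
  proof
    show "prob_space N" unfolding N_def by (intro L.P.prob_space_distr limF)
    show "sets N = sets (PiM {0..T} (\<lambda>_. R))" by (simp add: N_def)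
    fix J assume J: "time_grid J"
    note gr = time_gridD[OF J]
    have J0: "J \<union> {0, T} = J" using gr by auto
    have lim_res: "distr L.lim (PiM J (\<lambda>_. borel)) (\<lambda>\<omega>. restrict \<omega> J) = marginal J"
    proof (rule measure_eqI)
      fix A assume "A \<in> sets (distr L.lim (PiM J (\<lambda>_. borel)) (\<lambda>\<omega>. restrict \<omega> J))"
      then show "emeasure (distr L.lim (PiM J (\<lambda>_. borel)) (\<lambda>\<omega>. restrict \<omega> J)) A = emeasure (marginal J) A"
        using gr by (subst emeasure_distr_restrict[OF gr(4)]) (auto simp: L.emeasure_lim_emb)
    qed (simp add: marginal_def)
    have "distr N (PiM J (\<lambda>_. R)) (\<lambda>\<omega>. restrict \<omega> J) =
        distr L.lim (PiM J (\<lambda>_. R)) ((\<lambda>\<omega>. restrict \<omega> J) \<circ> F {0..T})"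
      unfolding N_def using gr by (intro distr_distr restrict_measurable limF) auto
    \<comment> \<open>The retraction acts on each coordinate separately and hence commutes with
      restriction to \<open>J\<close>, which reduces the claim to the finite marginal.\<close>
    also have "\<dots> = distr L.lim (PiM J (\<lambda>_. R)) (F J \<circ> (\<lambda>\<omega>. restrict \<omega> J))"
      using gr by (intro distr_cong) (auto simp: F_def fun_eq_iff)
    also have "\<dots> = distr (marginal J) (PiM J (\<lambda>_. R)) (F J)"
      unfolding lim_res[symmetric] using gr F[of J J]
      by (intro distr_distr[symmetric])
        (auto simp: measurable_cong_sets[OF L.sets_lim refl] intro!: measurable_restrict_subset)
    also have "\<dots> = distr (grid_law J) (PiM J (\<lambda>_. R)) (F J \<circ> (\<lambda>\<omega>. restrict \<omega> J))"
      unfolding marginal_def J0 using F[of J J]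
      by (intro distr_distr)
        (auto simp: measurable_cong_sets[OF sets_grid_law refl] intro!: restrict_measurable_borel)
    also have "\<dots> = distr (grid_law J) (PiM J (\<lambda>_. R)) (\<lambda>\<omega>. \<omega>)"
      by (intro distr_cong) (auto simp: F_def f_def fun_eq_iff PiE_iff extensional_def)
    also have "\<dots> = grid_law J" by (rule distr_id2) simp
    finally show "distr N (PiM J (\<lambda>_. R)) (\<lambda>\<omega>. restrict \<omega> J) = grid_law J" .
  qed
qed

end

section \<open>Conditional expectations of the process\<close>

lemma sets_generated_sigma:
  "sets (generated_sigma M Z I) =
    sigma_sets (space M) {Z \<tau> -` B \<inter> space M | \<tau> B. \<tau> \<in> I \<and> B \<in> sets borel}"
  unfolding generated_sigma_def by (rule sets_measure_of) auto

lemma space_generated_sigma [simp]: "space (generated_sigma M Z I) = space M"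
  by (simp add: generated_sigma_def space_measure_of_conv)

lemma space_join_sigma [simp]: "space (join_sigma M F G) = space M"
  by (simp add: join_sigma_def space_measure_of_conv)

lemma generated_sigma_mono: "I \<subseteq> K \<Longrightarrow> sets (generated_sigma M Z I) \<subseteq> sets (generated_sigma M Z K)"
  unfolding sets_generated_sigma by (rule sigma_sets_mono') auto

text \<open>The past up to \<open>s\<close> joined with the future from \<open>t\<close> is
  generated by the times in \<open>{0..s} \<union> {t..T}\<close>. Both conditionings in the
  Bernstein property thereby become instances of \<open>generated_sigma\<close>.\<close>

lemma sets_join_generated_sigma:
  "sets (join_sigma M (generated_sigma M Z I) (generated_sigma M Z K)) = sets (generated_sigma M Z (I \<union> K))"
proof -
  have "sets (generated_sigma M Z I) \<union> sets (generated_sigma M Z K) \<subseteq> Pow (space M)"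
    using sets.space_closed[of "generated_sigma M Z I"] sets.space_closed[of "generated_sigma M Z K"] by auto
  then have "sets (join_sigma M (generated_sigma M Z I) (generated_sigma M Z K)) =
      sigma_sets (space M) (sets (generated_sigma M Z I) \<union> sets (generated_sigma M Z K))"
    unfolding join_sigma_def by (rule sets_measure_of)
  also have "\<dots> = sets (generated_sigma M Z (I \<union> K))"
  proof
    have "sets (generated_sigma M Z I) \<union> sets (generated_sigma M Z K) \<subseteq> sets (generated_sigma M Z (I \<union> K))"
      using generated_sigma_mono[of I "I \<union> K" M Z] generated_sigma_mono[of K "I \<union> K" M Z] by auto
    then show "sigma_sets (space M) (sets (generated_sigma M Z I) \<union> sets (generated_sigma M Z K))
        \<subseteq> sets (generated_sigma M Z (I \<union> K))"
      using sets.sigma_sets_subset[of _ "generated_sigma M Z (I \<union> K)"] by simp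
    have "{Z \<tau> -` B \<inter> space M | \<tau> B. \<tau> \<in> I \<union> K \<and> B \<in> sets borel} \<subseteq>
        sets (generated_sigma M Z I) \<union> sets (generated_sigma M Z K)"
      unfolding sets_generated_sigma by (auto intro!: sigma_sets.Basic)
    then show "sets (generated_sigma M Z (I \<union> K)) \<subseteq>
        sigma_sets (space M) (sets (generated_sigma M Z I) \<union> sets (generated_sigma M Z K))"
      unfolding sets_generated_sigma[of M Z "I \<union> K"] by (rule sigma_sets_mono')
  qed
  finally show ?thesis .
qed

lemma measurable_generated_sigma:
  assumes "\<tau> \<in> I" "Z \<tau> \<in> space M \<rightarrow> C"
  shows "Z \<tau> \<in> generated_sigma M Z I \<rightarrow>\<^sub>M restrict_space borel C"
proof (rule measurable_restrict_space2)
  show "Z \<tau> \<in> generated_sigma M Z I \<rightarrow>\<^sub>M borel"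
    by (rule measurableI) (use assms(1) in \<open>auto simp: sets_generated_sigma intro!: sigma_sets.Basic\<close>)
qed (use assms in auto)

text \<open>The probability space is left abstract and the process is known through its grid laws
  alone. This lets all conditional statements be proved for the completed path space without
  mentioning coordinates.\<close>

locale bridge_process = bridge_kernel T C g \<mu> + prob_space M
  for T :: real and C :: "(real^'d) set" and g \<mu> and M :: "'w measure" +
  fixes Z :: "real \<Rightarrow> 'w \<Rightarrow> real^'d"
  assumes Z_measurable: "\<tau> \<in> {0..T} \<Longrightarrow> Z \<tau> \<in> M \<rightarrow>\<^sub>M R"
    and distr_grid: "time_grid J \<Longrightarrow> distr M (PiM J (\<lambda>_. R)) (\<lambda>\<omega>. \<lambda>\<tau>\<in>J. Z \<tau> \<omega>) = grid_law J"
begin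

lemma Z_in_C: "\<tau> \<in> {0..T} \<Longrightarrow> \<omega> \<in> space M \<Longrightarrow> Z \<tau> \<omega> \<in> C"
  using Z_measurable[of \<tau>] by (auto dest: measurable_space)

lemma paths_measurable:
  "I \<subseteq> {0..T} \<Longrightarrow> (\<lambda>\<omega>. \<lambda>\<tau>\<in>I. Z \<tau> \<omega>) \<in> M \<rightarrow>\<^sub>M PiM I (\<lambda>_. R)"
  by (intro measurable_restrict Z_measurable) auto

lemma nn_integral_grid:
  assumes J: "time_grid J" and F: "F \<in> borel_measurable (PiM J (\<lambda>_. R))"
  shows "(\<integral>\<^sup>+\<omega>. F (\<lambda>\<tau>\<in>J. Z \<tau> \<omega>) \<partial>M) = (\<integral>\<^sup>+\<omega>. F \<omega> \<partial>grid_law J)"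
  unfolding distr_grid[OF J, symmetric]
  using F by (intro nn_integral_distr[symmetric] paths_measurable time_gridD[OF J]) simp

text \<open>Represents an event of an uncountable family of times as the preimage of a set in the
  product sigma-algebra, where measures can be compared on finite-dimensional cylinders.\<close>

lemma generated_sigma_paths:
  assumes I: "I \<subseteq> {0..T}" and A: "A \<in> sets (generated_sigma M Z I)"
  obtains S where "S \<in> sets (PiM I (\<lambda>_. R))" "A = (\<lambda>\<omega>. \<lambda>\<tau>\<in>I. Z \<tau> \<omega>) -` S \<inter> space M"
proof -
  let ?X = "\<lambda>\<omega>. \<lambda>\<tau>\<in>I. Z \<tau> \<omega>" and ?V = "vimage_algebra (space M) (\<lambda>\<omega>. \<lambda>\<tau>\<in>I. Z \<tau> \<omega>) (PiM I (\<lambda>_. R))"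
  have X: "?X \<in> space M \<rightarrow> space (PiM I (\<lambda>_. R))"
    using measurable_space[OF paths_measurable[OF I]] by auto
  have "{Z \<tau> -` B \<inter> space M | \<tau> B. \<tau> \<in> I \<and> B \<in> sets borel} \<subseteq> sets ?V"
  proof safe
    fix \<tau> B assume \<tau>: "\<tau> \<in> I" and B: "B \<in> sets (borel :: (real^'d) measure)"
    \<comment> \<open>The measurable sets of \<open>R\<close> are subsets of \<open>C\<close>;
      intersecting loses nothing because the process takes its values there.\<close>
    have "B \<inter> C \<in> sets R" using B C_borel by (auto simp: sets_R sets_restrict_space)
    then have S: "(\<lambda>\<omega>. \<omega> \<tau>) -` (B \<inter> C) \<inter> space (PiM I (\<lambda>_. R)) \<in> sets (PiM I (\<lambda>_. R))"
      using \<tau> by (intro measurable_sets[OF measurable_component_singleton]) auto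
    have "Z \<tau> -` B \<inter> space M = ?X -` ((\<lambda>\<omega>. \<omega> \<tau>) -` (B \<inter> C) \<inter> space (PiM I (\<lambda>_. R))) \<inter> space M"
      using \<tau> I Z_in_C X by (auto simp: Pi_iff)
    then show "Z \<tau> -` B \<inter> space M \<in> sets ?V"
      using in_vimage_algebra[OF S, of ?X "space M"] by simp
  qed
  then have "sets (generated_sigma M Z I) \<subseteq> sets ?V"
    unfolding sets_generated_sigma using sets.sigma_sets_subset[of _ ?V] by simp
  then have "A \<in> sets ?V" using A by auto
  then show ?thesis using that by (auto simp: sets_vimage_algebra2[OF X])
qed

lemma subalgebra_generated_sigma:
  assumes "I \<subseteq> {0..T}"
  shows "subalgebra M (generated_sigma M Z I)"
  unfolding subalgebra_def
proof safe
  fix A assume "A \<in> sets (generated_sigma M Z I)"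
  then obtain S where "S \<in> sets (PiM I (\<lambda>_. R))" "A = (\<lambda>\<omega>. \<lambda>\<tau>\<in>I. Z \<tau> \<omega>) -` S \<inter> space M"
    using generated_sigma_paths[OF assms] by blast
  then show "A \<in> sets M" using measurable_sets[OF paths_measurable[OF assms]] by auto
qed auto

text \<open>No time of \<open>J\<close> lies strictly between \<open>s\<close> and \<open>t\<close>,
  so on a grid containing \<open>s\<close>, \<open>t\<close> and \<open>J\<close> these two are the
  neighbours of \<open>r\<close>. Inserting \<open>r\<close> produces the bridge density, and the
  indicators, blind to coordinate \<open>r\<close>, leave the inner integral.\<close>

lemma nn_integral_bridge_cylinder:
  assumes str: "0 \<le> s" "s < r" "r < t" "t \<le> T"
    and J: "finite J" "J \<subseteq> {0..s} \<union> {t..T}" and A: "\<And>\<tau>. \<tau> \<in> J \<Longrightarrow> A \<tau> \<in> sets R"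
    and h [measurable]: "h \<in> borel_measurable R"
  shows "(\<integral>\<^sup>+\<omega>. h (Z r \<omega>) * (\<Prod>\<tau>\<in>J. indicator (A \<tau>) (Z \<tau> \<omega>)) \<partial>M) =
    (\<integral>\<^sup>+\<omega>. (\<integral>\<^sup>+z. ennreal (bridge_density g (Z t \<omega>) t z r (Z s \<omega>) s) * h z \<partial>R) *
      (\<Prod>\<tau>\<in>J. indicator (A \<tau>) (Z \<tau> \<omega>)) \<partial>M)"
proof -
  define G where "G = J \<union> {0, s, t, T}"
  have G: "time_grid G" and r: "r \<notin> G" "r \<in> {0..T}" and st: "s \<in> G" "t \<in> G" "G \<inter> {s<..<t} = {}"
    using str J by (auto simp: time_grid_def G_def)
  note gr = time_gridD[OF G]
  have JG: "J \<subseteq> G" by (auto simp: G_def)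
  have comp[measurable]: "(\<lambda>\<omega>. \<omega> \<tau>) \<in> PiM K (\<lambda>_. R) \<rightarrow>\<^sub>M R" if "\<tau> \<in> K" for \<tau> K
    using that by (rule measurable_component_singleton)
  have ind: "(\<lambda>\<omega>. \<Prod>\<tau>\<in>J. indicator (A \<tau>) (\<omega> \<tau>) :: ennreal) \<in> borel_measurable (PiM K (\<lambda>_. R))"
    if "J \<subseteq> K" for K
    using that A by (intro borel_measurable_prod_ennreal measurable_compose[OF comp borel_measurable_indicator]) auto
  have bd[measurable]: "(\<lambda>(\<omega>, z). bridge_density g (\<omega> t) t z r (\<omega> s) s) \<in> borel_measurable (PiM G (\<lambda>_. R) \<Otimes>\<^sub>M R)"
    unfolding case_prod_beta using str st by (intro bridge_density_measurable) auto
  have inner: "(\<lambda>\<omega>. \<integral>\<^sup>+z. ennreal (bridge_density g (\<omega> t) t z r (\<omega> s) s) * h z \<partial>R)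
      \<in> borel_measurable (PiM G (\<lambda>_. R))"
    by measurable
  let ?F = "\<lambda>\<omega>. h (\<omega> r) * (\<Prod>\<tau>\<in>J. indicator (A \<tau>) (\<omega> \<tau>))"
  have Fm: "?F \<in> borel_measurable (PiM (insert r G) (\<lambda>_. R))"
    using JG by (intro borel_measurable_times_ennreal ind measurable_compose[OF comp h]) auto
  have "(\<integral>\<^sup>+\<omega>. h (Z r \<omega>) * (\<Prod>\<tau>\<in>J. indicator (A \<tau>) (Z \<tau> \<omega>)) \<partial>M) =
      (\<integral>\<^sup>+\<omega>. ?F (\<lambda>\<tau>\<in>insert r G. Z \<tau> \<omega>) \<partial>M)"
    using JG by (intro nn_integral_cong arg_cong2[where f="(*)"] prod.cong) auto
  also have "\<dots> = (\<integral>\<^sup>+\<omega>. ?F \<omega> \<partial>grid_law (insert r G))"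
    by (rule nn_integral_grid[OF time_grid_insert[OF G r(2)] Fm])
  also have "\<dots> = (\<integral>\<^sup>+\<omega>. (\<integral>\<^sup>+z. ennreal (bridge_density g (\<omega> t) t z r (\<omega> s) s) * ?F (fun_upd \<omega> r z) \<partial>R) \<partial>grid_law G)"
    by (rule nn_integral_grid_law_insert[OF G r(1) st(1,2) str(2,3) st(3) Fm])
  also have "\<dots> = (\<integral>\<^sup>+\<omega>. (\<integral>\<^sup>+z. ennreal (bridge_density g (\<omega> t) t z r (\<omega> s) s) * h z \<partial>R) *
      (\<Prod>\<tau>\<in>J. indicator (A \<tau>) (\<omega> \<tau>)) \<partial>grid_law G)"
  proof (intro nn_integral_cong)
    fix \<omega> assume "\<omega> \<in> space (grid_law G)"
    then have \<omega>: "\<And>\<tau>. \<tau> \<in> G \<Longrightarrow> \<omega> \<tau> \<in> C" by (auto simp: PiE_iff)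
    have m[measurable]: "(\<lambda>z. bridge_density g (\<omega> t) t z r (\<omega> s) s) \<in> borel_measurable R"
      using str st \<omega> by (intro bridge_density_measurable) auto
    have "(\<Prod>\<tau>\<in>J. indicator (A \<tau>) ((fun_upd \<omega> r z) \<tau>)) = (\<Prod>\<tau>\<in>J. indicator (A \<tau>) (\<omega> \<tau>) :: ennreal)" for z
      using r JG by (intro prod.cong) auto
    then have "(\<integral>\<^sup>+z. ennreal (bridge_density g (\<omega> t) t z r (\<omega> s) s) * ?F (fun_upd \<omega> r z) \<partial>R) =
        (\<integral>\<^sup>+z. (ennreal (bridge_density g (\<omega> t) t z r (\<omega> s) s) * h z) * (\<Prod>\<tau>\<in>J. indicator (A \<tau>) (\<omega> \<tau>)) \<partial>R)"
      by (simp add: mult.assoc)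
    also have "\<dots> = (\<integral>\<^sup>+z. ennreal (bridge_density g (\<omega> t) t z r (\<omega> s) s) * h z \<partial>R) *
        (\<Prod>\<tau>\<in>J. indicator (A \<tau>) (\<omega> \<tau>))"
      by (rule nn_integral_multc) measurable
    finally show "(\<integral>\<^sup>+z. ennreal (bridge_density g (\<omega> t) t z r (\<omega> s) s) * ?F (fun_upd \<omega> r z) \<partial>R) =
      (\<integral>\<^sup>+z. ennreal (bridge_density g (\<omega> t) t z r (\<omega> s) s) * h z \<partial>R) * (\<Prod>\<tau>\<in>J. indicator (A \<tau>) (\<omega> \<tau>))" .
  qed
  also have "\<dots> = (\<integral>\<^sup>+\<omega>. (\<lambda>\<omega>. (\<integral>\<^sup>+z. ennreal (bridge_density g (\<omega> t) t z r (\<omega> s) s) * h z \<partial>R) *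
      (\<Prod>\<tau>\<in>J. indicator (A \<tau>) (\<omega> \<tau>))) (\<lambda>\<tau>\<in>G. Z \<tau> \<omega>) \<partial>M)"
    by (intro nn_integral_grid[OF G, symmetric] borel_measurable_times_ennreal inner ind JG)
  also have "\<dots> = (\<integral>\<^sup>+\<omega>. (\<integral>\<^sup>+z. ennreal (bridge_density g (Z t \<omega>) t z r (Z s \<omega>) s) * h z \<partial>R) *
      (\<Prod>\<tau>\<in>J. indicator (A \<tau>) (Z \<tau> \<omega>)) \<partial>M)"
    using st JG by (intro nn_integral_cong arg_cong2[where f="(*)"] prod.cong) auto
  finally show ?thesis .
qed

text \<open>Both sides, as functions of the event, are images of weighted measures on the paths over
  past and future times. They agree on cylinders by the preceding lemma, and cylinders form an
  intersection-stable generator.\<close>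

lemma nn_integral_bridge:
  assumes str: "0 \<le> s" "s < r" "r < t" "t \<le> T"
    and A: "A \<in> sets (generated_sigma M Z ({0..s} \<union> {t..T}))"
    and h [measurable]: "h \<in> borel_measurable R" and hB: "\<And>z. z \<in> C \<Longrightarrow> h z \<le> ennreal B"
  shows "(\<integral>\<^sup>+\<omega>. h (Z r \<omega>) * indicator A \<omega> \<partial>M) =
    (\<integral>\<^sup>+\<omega>. (\<integral>\<^sup>+z. ennreal (bridge_density g (Z t \<omega>) t z r (Z s \<omega>) s) * h z \<partial>R) * indicator A \<omega> \<partial>M)"
proof -
  let ?I = "{0..s} \<union> {t..T}"
  let ?X = "\<lambda>\<omega>. \<lambda>\<tau>\<in>?I. Z \<tau> \<omega>"
  let ?K = "\<lambda>\<omega>. \<integral>\<^sup>+z. ennreal (bridge_density g (Z t \<omega>) t z r (Z s \<omega>) s) * h z \<partial>R"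
  have I: "?I \<subseteq> {0..T}" using str by auto
  have X[measurable]: "?X \<in> M \<rightarrow>\<^sub>M PiM ?I (\<lambda>_. R)" by (rule paths_measurable[OF I])
  have Zm[measurable]: "Z r \<in> M \<rightarrow>\<^sub>M R" "Z s \<in> M \<rightarrow>\<^sub>M R" "Z t \<in> M \<rightarrow>\<^sub>M R"
    using str by (auto intro!: Z_measurable)
  have [measurable]: "(\<lambda>(\<omega>, z). bridge_density g (Z t \<omega>) t z r (Z s \<omega>) s) \<in> borel_measurable (M \<Otimes>\<^sub>M R)"
    unfolding case_prod_beta using str by (intro bridge_density_measurable) auto
  have Km[measurable]: "?K \<in> borel_measurable M" by measurable
  define \<nu> where "\<nu> f = distr (density M f) (PiM ?I (\<lambda>_. R)) ?X" for f :: "'w \<Rightarrow> ennreal"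
  have \<nu>: "emeasure (\<nu> f) S = (\<integral>\<^sup>+\<omega>. f \<omega> * indicator (?X -` S \<inter> space M) \<omega> \<partial>M)"
    if "f \<in> borel_measurable M" "S \<in> sets (PiM ?I (\<lambda>_. R))" for f S
    unfolding \<nu>_def using that measurable_sets[OF X that(2)]
    by (subst emeasure_distr) (auto simp: emeasure_density)
  have hZ: "(\<lambda>\<omega>. h (Z r \<omega>)) \<in> borel_measurable M" by measurable
  have "\<nu> (\<lambda>\<omega>. h (Z r \<omega>)) = \<nu> ?K"
  proof (rule measure_eqI_PiM_infinite)
    show "sets (\<nu> (\<lambda>\<omega>. h (Z r \<omega>))) = sets (PiM ?I (\<lambda>_. R))" "sets (\<nu> ?K) = sets (PiM ?I (\<lambda>_. R))"
      by (simp_all add: \<nu>_def)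
    \<comment> \<open>Agreement on a generator determines a measure only under finiteness; this is
      where the bound on \<open>h\<close> enters.\<close>
    have "(\<integral>\<^sup>+\<omega>. h (Z r \<omega>) \<partial>M) \<le> (\<integral>\<^sup>+\<omega>. ennreal B \<partial>M)"
      using str by (intro nn_integral_mono hB Z_in_C) auto
    then have fin: "(\<integral>\<^sup>+\<omega>. h (Z r \<omega>) \<partial>M) < \<infinity>"
      by (simp add: emeasure_space_1 order_le_less_trans)
    have "emeasure (\<nu> (\<lambda>\<omega>. h (Z r \<omega>))) (space (\<nu> (\<lambda>\<omega>. h (Z r \<omega>)))) \<le> (\<integral>\<^sup>+\<omega>. h (Z r \<omega>) \<partial>M)"
      unfolding \<nu>_def by (subst \<nu>[OF hZ, unfolded \<nu>_def])
        (auto intro!: nn_integral_mono simp: indicator_def)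
    then show "finite_measure (\<nu> (\<lambda>\<omega>. h (Z r \<omega>)))"
      using fin by (intro finite_measureI) auto
    fix A J assume J: "finite J" "J \<subseteq> ?I" and A: "\<And>\<tau>. \<tau> \<in> J \<Longrightarrow> A \<tau> \<in> sets R"
    let ?S = "prod_emb ?I (\<lambda>_. R) J (Pi\<^sub>E J A)"
    have S: "?S \<in> sets (PiM ?I (\<lambda>_. R))"
      using J A by (intro sets_PiM_I) auto
    have ind: "indicator (?X -` ?S \<inter> space M) \<omega> = (\<Prod>\<tau>\<in>J. indicator (A \<tau>) (Z \<tau> \<omega>) :: ennreal)"
      if "\<omega> \<in> space M" for \<omega>
    proof -
      have "?X \<omega> \<in> ?S \<longleftrightarrow> (\<forall>\<tau>\<in>J. Z \<tau> \<omega> \<in> A \<tau>)"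
        using measurable_space[OF X that] J(2) by (auto simp: prod_emb_def space_PiM PiE_iff)
      moreover have "(\<Prod>\<tau>\<in>J. indicator (A \<tau>) (Z \<tau> \<omega>) :: ennreal) = (if \<forall>\<tau>\<in>J. Z \<tau> \<omega> \<in> A \<tau> then 1 else 0)"
        using J(1) by (auto simp: indicator_def intro!: prod.neutral)
      ultimately show ?thesis using that by (simp add: indicator_def)
    qed
    have "emeasure (\<nu> (\<lambda>\<omega>. h (Z r \<omega>))) ?S = (\<integral>\<^sup>+\<omega>. h (Z r \<omega>) * (\<Prod>\<tau>\<in>J. indicator (A \<tau>) (Z \<tau> \<omega>)) \<partial>M)"
      unfolding \<nu>[OF hZ S] by (intro nn_integral_cong) (simp only: ind)
    also have "\<dots> = (\<integral>\<^sup>+\<omega>. ?K \<omega> * (\<Prod>\<tau>\<in>J. indicator (A \<tau>) (Z \<tau> \<omega>)) \<partial>M)"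
      by (rule nn_integral_bridge_cylinder[OF str J A h])
    also have "\<dots> = emeasure (\<nu> ?K) ?S"
      unfolding \<nu>[OF Km S] by (intro nn_integral_cong) (simp only: ind)
    finally show "emeasure (\<nu> (\<lambda>\<omega>. h (Z r \<omega>))) ?S = emeasure (\<nu> ?K) ?S" .
  qed
  moreover obtain S where "S \<in> sets (PiM ?I (\<lambda>_. R))" "A = ?X -` S \<inter> space M"
    using generated_sigma_paths[OF I A] .
  ultimately show ?thesis
    using \<nu>[OF hZ, of S] \<nu>[OF Km, of S] by simp
qed

text \<open>The candidate for the conditional expectation of \<open>h (Z r)\<close>. The argument
  order follows the bridge density: \<open>x\<close> is the position at the later time
  \<open>t\<close>, and \<open>y\<close> the position at the earlier time \<open>s\<close>.\<close>

definition bridge_average ::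
  "(real^'d \<Rightarrow> real) \<Rightarrow> real \<Rightarrow> real \<Rightarrow> real \<Rightarrow> real^'d \<Rightarrow> real^'d \<Rightarrow> real" where
  "bridge_average h t r s x y = (\<integral>z. bridge_density g x t z r y s * h z \<partial>R)"

lemma integrable_bridge_density:
  assumes "0 \<le> s" "s < r" "r < t" "t \<le> T" "x \<in> C" "y \<in> C"
  shows "integrable R (\<lambda>z. bridge_density g x t z r y s)"
  using nn_integral_bridge_density[OF assms] bridge_density_pos[OF assms] assms
  by (intro integrableI_nonneg bridge_density_measurable) (auto intro!: AE_I2 less_imp_le)

lemma integrable_bridge_density_mult:
  assumes str: "0 \<le> s" "s < r" "r < t" "t \<le> T" "x \<in> C" "y \<in> C"
    and h: "h \<in> borel_measurable R" "\<And>z. z \<in> C \<Longrightarrow> \<bar>h z\<bar> \<le> B"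
  shows "integrable R (\<lambda>z. bridge_density g x t z r y s * h z)"
proof -
  have 1: "(\<lambda>z. bridge_density g x t z r y s) \<in> borel_measurable R"
    using str by (intro bridge_density_measurable) auto
  have 2: "integrable R (\<lambda>z. B * bridge_density g x t z r y s)"
    by (intro integrable_mult_right integrable_bridge_density str)
  show ?thesis
  proof (rule Bochner_Integration.integrable_bound[OF 2])
    show "AE z in R. norm (bridge_density g x t z r y s * h z) \<le> norm (B * bridge_density g x t z r y s)"
    proof (rule AE_I2)
      fix z assume z: "z \<in> space R"
      then have "0 < bridge_density g x t z r y s" "\<bar>h z\<bar> \<le> \<bar>B\<bar>"
        using bridge_density_pos[OF str] h(2)[of z] by auto
      then show "norm (bridge_density g x t z r y s * h z) \<le> norm (B * bridge_density g x t z r y s)"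
        by (simp add: abs_mult mult.commute mult_left_mono)
    qed
  qed (intro borel_measurable_times 1 h)
qed

text \<open>Links the Bochner form, which \<open>real_cond_exp\<close> requires, to the nonnegative
  form in which the cylinder computation was made. The bounds hold because a probability average
  stays between the bounds of the function.\<close>

lemma bridge_average_nonneg_eq:
  assumes str: "0 \<le> s" "s < r" "r < t" "t \<le> T" "x \<in> C" "y \<in> C"
    and h: "h \<in> borel_measurable R" "\<And>z. z \<in> C \<Longrightarrow> 0 \<le> h z" "\<And>z. z \<in> C \<Longrightarrow> h z \<le> B"
  shows "ennreal (bridge_average h t r s x y) = (\<integral>\<^sup>+z. ennreal (bridge_density g x t z r y s) * ennreal (h z) \<partial>R)"
    and "0 \<le> bridge_average h t r s x y" and "bridge_average h t r s x y \<le> B"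
proof -
  have int: "integrable R (\<lambda>z. bridge_density g x t z r y s * h z)"
    using h by (intro integrable_bridge_density_mult[OF str, of h B]) auto
  have nn: "0 \<le> bridge_density g x t z r y s * h z" "bridge_density g x t z r y s * h z \<le> bridge_density g x t z r y s * B"
    if "z \<in> C" for z
    using bridge_density_pos[OF str that] h(2,3)[OF that] by (auto intro: mult_left_mono)
  show "0 \<le> bridge_average h t r s x y"
    unfolding bridge_average_def using nn by (intro Bochner_Integration.integral_nonneg) simp
  show "ennreal (bridge_average h t r s x y) = (\<integral>\<^sup>+z. ennreal (bridge_density g x t z r y s) * ennreal (h z) \<partial>R)"
    unfolding bridge_average_def using nn bridge_density_pos[OF str] h
    by (subst nn_integral_eq_integral[OF int, symmetric])
      (auto intro!: AE_I2 nn_integral_cong simp: ennreal_mult less_imp_le)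
  have "bridge_average h t r s x y \<le> (\<integral>z. bridge_density g x t z r y s * B \<partial>R)"
    unfolding bridge_average_def using nn
    by (intro integral_mono int integrable_mult_left integrable_bridge_density str) auto
  then show "bridge_average h t r s x y \<le> B" by (simp add: integral_bridge_density[OF str])
qed

end

text \<open>Endpoint integrals in the statement are taken with respect to Lebesgue measure on the
  product space, whereas the grid laws use a product of two restricted measures. The two agree on
  rectangles, which determines them by sigma-finiteness.\<close>

lemma pair_restrict_space_lborel:
  fixes A :: "'a::euclidean_space set" and B :: "'b::euclidean_space set"
  assumes A: "A \<in> sets borel" and B: "B \<in> sets borel"
  shows "restrict_space lborel A \<Otimes>\<^sub>M restrict_space lborel B = restrict_space lborel (A \<times> B)"
    (is "?A \<Otimes>\<^sub>M ?B = ?AB")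
proof (rule pair_measure_eqI)
  show "sigma_finite_measure ?A" "sigma_finite_measure ?B"
    using A B by (auto intro!: sigma_finite_measure_restrict_space lborel.sigma_finite_measure_axioms)
  have AB: "A \<times> B \<in> sets lborel"
    using A B by (simp add: borel_prod[symmetric])
  show "sets (?A \<Otimes>\<^sub>M ?B) = sets ?AB"
  proof
    have "{X \<times> Y | X Y. X \<in> sets ?A \<and> Y \<in> sets ?B} \<subseteq> sets ?AB"
      using A B by (auto simp: sets_restrict_space_iff AB borel_prod[symmetric])
    from sets.sigma_sets_subset[OF this]
    show "sets (?A \<Otimes>\<^sub>M ?B) \<subseteq> sets ?AB"
      by (simp add: sets_pair_measure space_restrict_space)
    have "(\<lambda>x. (fst x, snd x)) \<in> ?A \<Otimes>\<^sub>M ?B \<rightarrow>\<^sub>M borel"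
      using measurable_fst[of ?A ?B] measurable_snd[of ?A ?B]
      by (intro borel_measurable_Pair) (auto simp: measurable_restrict_space2_iff)
    then have id: "(\<lambda>x. x) \<in> ?A \<Otimes>\<^sub>M ?B \<rightarrow>\<^sub>M borel" by simp
    show "sets ?AB \<subseteq> sets (?A \<Otimes>\<^sub>M ?B)"
    proof
      fix X assume "X \<in> sets ?AB"
      then obtain S where "S \<in> sets borel" "X = (A \<times> B) \<inter> S" by (auto simp: sets_restrict_space)
      then show "X \<in> sets (?A \<Otimes>\<^sub>M ?B)"
        using measurable_sets[OF id] by (simp add: space_pair_measure space_restrict_space Int_commute)
    qed
  qed
  fix X Y assume "X \<in> sets ?A" "Y \<in> sets ?B"
  then have XY: "X \<in> sets borel" "X \<subseteq> A" "Y \<in> sets borel" "Y \<subseteq> B"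
    using A B by (auto simp: sets_restrict_space_iff)
  then have "emeasure ?AB (X \<times> Y) = emeasure (lborel \<Otimes>\<^sub>M lborel) (X \<times> Y)"
    unfolding lborel_prod using AB by (intro emeasure_restrict_space) auto
  also have "\<dots> = emeasure ?A X * emeasure ?B Y"
    using XY A B by (simp add: lborel.emeasure_pair_measure_Times emeasure_restrict_space)
  finally show "emeasure ?A X * emeasure ?B Y = emeasure ?AB (X \<times> Y)" by simp
qed

section \<open>Set integrals over subsets of \<open>C\<close> as integrals against
  \<open>R\<close>\<close>

context bridge_kernel
begin

lemma R_pair: "R \<Otimes>\<^sub>M R = restrict_space lborel (C \<times> C)"
  unfolding R_def using C_borel by (intro pair_restrict_space_lborel)

lemma sets_R_iff: "A \<in> sets R \<longleftrightarrow> A \<subseteq> C \<and> A \<in> sets borel"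
  using C_borel by (simp add: R_def sets_restrict_space_iff)

lemma set_lebesgue_integral_R:
  fixes f :: "_ \<Rightarrow> real"
  assumes "A \<in> sets R"
  shows "set_lebesgue_integral lborel A f = (\<integral>z. indicator A z * f z \<partial>R)"
  using assms C_borel unfolding set_lebesgue_integral_def R_def
  by (subst integral_restrict_space)
    (auto simp: sets_restrict_space_iff indicator_def intro!: Bochner_Integration.integral_cong)

lemma set_lebesgue_integral_R_pair:
  fixes f :: "(real^'d) \<times> (real^'d) \<Rightarrow> real"
  assumes A: "A \<in> sets R" "B \<in> sets R" and f [measurable]: "f \<in> borel_measurable (R \<Otimes>\<^sub>M R)"
    and nonneg: "\<And>x y. x \<in> C \<Longrightarrow> y \<in> C \<Longrightarrow> 0 \<le> f (x, y)"
  shows "set_lebesgue_integral lborel (A \<times> B) f =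
    enn2real (\<integral>\<^sup>+(x, y). indicator A x * indicator B y * ennreal (f (x, y)) \<partial>(R \<Otimes>\<^sub>M R))"
proof -
  have [measurable]: "A \<times> B \<in> sets (R \<Otimes>\<^sub>M R)" using A by auto
  have CC: "C \<times> C \<in> sets (lborel :: ((real^'d) \<times> (real^'d)) measure)"
    using C_borel by (simp add: borel_prod[symmetric])
  have "set_lebesgue_integral lborel (A \<times> B) f = (\<integral>z. indicator (A \<times> B) z * f z \<partial>(R \<Otimes>\<^sub>M R))"
    unfolding R_pair set_lebesgue_integral_def using CC A
    by (subst integral_restrict_space)
      (auto simp: sets_R_iff indicator_def subset_iff intro!: Bochner_Integration.integral_cong)
  also have "\<dots> = enn2real (\<integral>\<^sup>+z. ennreal (indicator (A \<times> B) z * f z) \<partial>(R \<Otimes>\<^sub>M R))"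
    by (rule integral_eq_nn_integral) (auto intro!: AE_I2 simp: space_pair_measure nonneg)
  also have "(\<integral>\<^sup>+z. ennreal (indicator (A \<times> B) z * f z) \<partial>(R \<Otimes>\<^sub>M R)) =
      (\<integral>\<^sup>+(x, y). indicator A x * indicator B y * ennreal (f (x, y)) \<partial>(R \<Otimes>\<^sub>M R))"
    by (intro nn_integral_cong) (auto simp: indicator_def)
  finally show ?thesis .
qed

end

section \<open>Conditioning on past and future\<close>

context bridge_process
begin

lemma bridge_average_measurable:
  assumes str: "0 \<le> s" "s < r" "r < t" "t \<le> T"
    and h[measurable]: "h \<in> borel_measurable R" and uv: "u \<in> N \<rightarrow>\<^sub>M R" "v \<in> N \<rightarrow>\<^sub>M R"
  shows "(\<lambda>\<omega>. bridge_average h t r s (u \<omega>) (v \<omega>)) \<in> borel_measurable N"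
proof -
  have [measurable]: "(\<lambda>(\<omega>, z). bridge_density g (u \<omega>) t z r (v \<omega>) s) \<in> borel_measurable (N \<Otimes>\<^sub>M R)"
    unfolding case_prod_beta using str uv by (intro bridge_density_measurable) auto
  show ?thesis unfolding bridge_average_def by measurable
qed

text \<open>The shift \<open>h + B\<close> lies between \<open>0\<close> and \<open>2 * B\<close>,
  so the nonnegative case applies; since the bridge density has mass one, the shift passes through
  the average unchanged.\<close>

lemma bridge_average_bounded:
  assumes str: "0 \<le> s" "s < r" "r < t" "t \<le> T" "x \<in> C" "y \<in> C"
    and h: "h \<in> borel_measurable R" "\<And>z. z \<in> C \<Longrightarrow> \<bar>h z\<bar> \<le> B"
  shows "\<bar>bridge_average h t r s x y\<bar> \<le> B"
    and "bridge_average (\<lambda>z. h z + B) t r s x y = bridge_average h t r s x y + B"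
proof -
  have "bridge_average (\<lambda>z. h z + B) t r s x y =
      (\<integral>z. bridge_density g x t z r y s * h z + bridge_density g x t z r y s * B \<partial>R)"
    by (simp add: bridge_average_def algebra_simps)
  also have "\<dots> = bridge_average h t r s x y + B"
    unfolding bridge_average_def
    by (subst Bochner_Integration.integral_add)
      (auto intro!: integrable_bridge_density_mult[OF str h] integrable_bridge_density[OF str]
        simp: integral_bridge_density[OF str])
  finally show *: "bridge_average (\<lambda>z. h z + B) t r s x y = bridge_average h t r s x y + B" .
  have "0 \<le> h z + B" "h z + B \<le> 2 * B" if "z \<in> C" for z using h(2)[OF that] by auto
  then show "\<bar>bridge_average h t r s x y\<bar> \<le> B"
    using bridge_average_nonneg_eq(2,3)[OF str, of "\<lambda>z. h z + B" "2 * B"] h(1) * by auto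
qed

lemma set_integral_bridge_nonneg:
  assumes str: "0 \<le> s" "s < r" "r < t" "t \<le> T"
    and A: "A \<in> sets (generated_sigma M Z ({0..s} \<union> {t..T}))"
    and h [measurable]: "h \<in> borel_measurable R" and hB: "\<And>z. z \<in> C \<Longrightarrow> 0 \<le> h z" "\<And>z. z \<in> C \<Longrightarrow> h z \<le> B"
  shows "(\<integral>\<omega>\<in>A. h (Z r \<omega>) \<partial>M) = (\<integral>\<omega>\<in>A. bridge_average h t r s (Z t \<omega>) (Z s \<omega>) \<partial>M)"
proof -
  have I: "{0..s} \<union> {t..T} \<subseteq> {0..T}" using str by auto
  have [measurable]: "A \<in> sets M" using A subalgebra_generated_sigma[OF I] by (auto simp: subalgebra_def)
  have Zm[measurable]: "Z r \<in> M \<rightarrow>\<^sub>M R" "Z s \<in> M \<rightarrow>\<^sub>M R" "Z t \<in> M \<rightarrow>\<^sub>M R"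
    using str by (auto intro!: Z_measurable)
  have ZC: "Z r \<omega> \<in> C" "Z s \<omega> \<in> C" "Z t \<omega> \<in> C" if "\<omega> \<in> space M" for \<omega>
    using str that by (auto intro!: Z_in_C)
  have [measurable]: "(\<lambda>\<omega>. bridge_average h t r s (Z t \<omega>) (Z s \<omega>)) \<in> borel_measurable M"
    using str by (intro bridge_average_measurable) auto
  note av = bridge_average_nonneg_eq[OF str _ _ h hB]
  have "(\<integral>\<omega>\<in>A. h (Z r \<omega>) \<partial>M) = enn2real (\<integral>\<^sup>+\<omega>. ennreal (h (Z r \<omega>)) * indicator A \<omega> \<partial>M)"
    unfolding set_lebesgue_integral_def using ZC hB
    by (subst integral_eq_nn_integral)
      (auto intro!: AE_I2 arg_cong[where f=enn2real] nn_integral_cong simp: indicator_def)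
  also have "(\<integral>\<^sup>+\<omega>. ennreal (h (Z r \<omega>)) * indicator A \<omega> \<partial>M) =
      (\<integral>\<^sup>+\<omega>. (\<integral>\<^sup>+z. ennreal (bridge_density g (Z t \<omega>) t z r (Z s \<omega>) s) * ennreal (h z) \<partial>R) * indicator A \<omega> \<partial>M)"
    using hB by (intro nn_integral_bridge[OF str A, of "\<lambda>z. ennreal (h z)" B]) (auto intro: ennreal_leI)
  also have "\<dots> = (\<integral>\<^sup>+\<omega>. ennreal (bridge_average h t r s (Z t \<omega>) (Z s \<omega>)) * indicator A \<omega> \<partial>M)"
    using ZC av(1) by (intro nn_integral_cong) auto
  also have "enn2real \<dots> = (\<integral>\<omega>\<in>A. bridge_average h t r s (Z t \<omega>) (Z s \<omega>) \<partial>M)"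
    unfolding set_lebesgue_integral_def using ZC av(2)
    by (subst integral_eq_nn_integral)
      (auto intro!: AE_I2 arg_cong[where f=enn2real] nn_integral_cong simp: indicator_def)
  finally show ?thesis .
qed

text \<open>The bridge average is measurable for the smallest admissible \<open>F\<close>, generated
  by \<open>Z s\<close> and \<open>Z t\<close>, and has the right integrals over events of the
  largest, past joined with future. It is therefore a version of the conditional expectation for
  every \<open>F\<close> in between. The Bernstein property compares the two extreme
  choices.\<close>

lemma real_cond_exp_bridge:
  assumes str: "0 \<le> s" "s < r" "r < t" "t \<le> T"
    and F: "space F = space M" "sets (generated_sigma M Z {s, t}) \<subseteq> sets F"
      "sets F \<subseteq> sets (generated_sigma M Z ({0..s} \<union> {t..T}))"
    and h [measurable]: "h \<in> borel_measurable R" and hB: "\<And>z. z \<in> C \<Longrightarrow> \<bar>h z\<bar> \<le> B"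
  shows "AE \<omega> in M. real_cond_exp M F (\<lambda>\<omega>. h (Z r \<omega>)) \<omega> = bridge_average h t r s (Z t \<omega>) (Z s \<omega>)"
proof -
  have I: "{0..s} \<union> {t..T} \<subseteq> {0..T}" using str by auto
  have sub: "subalgebra M F"
    using subalgebra_generated_sigma[OF I] F by (auto simp: subalgebra_def)
  interpret F: finite_measure_subalgebra M F
    by standard (rule sub)
  have Zm[measurable]: "Z r \<in> M \<rightarrow>\<^sub>M R" "Z s \<in> M \<rightarrow>\<^sub>M R" "Z t \<in> M \<rightarrow>\<^sub>M R"
    using str by (auto intro!: Z_measurable)
  have ZC: "Z r \<omega> \<in> C" "Z s \<omega> \<in> C" "Z t \<omega> \<in> C" if "\<omega> \<in> space M" for \<omega>
    using str that by (auto intro!: Z_in_C)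
  have avM[measurable]: "(\<lambda>\<omega>. bridge_average h t r s (Z t \<omega>) (Z s \<omega>)) \<in> borel_measurable M"
    using str by (intro bridge_average_measurable) auto
  note av = bridge_average_bounded[OF str _ _ h hB]
  have int: "integrable M (\<lambda>\<omega>. h (Z r \<omega>))"
    using ZC hB by (intro integrable_const_bound[where B=B]) (auto intro!: AE_I2)
  have int': "integrable M (\<lambda>\<omega>. bridge_average h t r s (Z t \<omega>) (Z s \<omega>))"
    using ZC av(1) by (intro integrable_const_bound[where B=B]) (auto intro!: AE_I2)
  show ?thesis
  proof (rule F.real_cond_exp_charact[OF _ int int'])
    have Zst: "Z \<tau> \<in> F \<rightarrow>\<^sub>M R" if "\<tau> \<in> {s, t}" for \<tau>
    proof -
      have "Z \<tau> \<in> generated_sigma M Z {s, t} \<rightarrow>\<^sub>M restrict_space borel C"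
        using that ZC by (intro measurable_generated_sigma) auto
      then have "Z \<tau> \<in> generated_sigma M Z {s, t} \<rightarrow>\<^sub>M R"
        by (simp add: measurable_cong_sets[OF refl sets_R])
      then show ?thesis
        using F(1,2) by (auto simp: measurable_def)
    qed
    show "(\<lambda>\<omega>. bridge_average h t r s (Z t \<omega>) (Z s \<omega>)) \<in> borel_measurable F"
      using str Zst by (intro bridge_average_measurable) auto
    fix A assume "A \<in> sets F"
    then have A: "A \<in> sets (generated_sigma M Z ({0..s} \<union> {t..T}))" and AM: "A \<in> sets M"
      using F sub by (auto simp: subalgebra_def)
    have intA: "set_integrable M A f" if "integrable M f" for f :: "'w \<Rightarrow> real"
      unfolding set_integrable_def using AM that by (rule integrable_mult_indicator)
    \<comment> \<open>The integral identity is available for nonnegative functions; adding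
      \<open>B\<close> reduces a signed \<open>h\<close> to that case, and the constant is cancelled
      afterwards.\<close>
    have "(\<integral>\<omega>\<in>A. h (Z r \<omega>) + B \<partial>M) =
        (\<integral>\<omega>\<in>A. bridge_average (\<lambda>z. h z + B) t r s (Z t \<omega>) (Z s \<omega>) \<partial>M)"
    proof (rule set_integral_bridge_nonneg[OF str A, where B="2 * B"])
      show "0 \<le> h z + B" "h z + B \<le> 2 * B" if "z \<in> C" for z using hB[OF that] by auto
    qed measurable
    also have "\<dots> = (\<integral>\<omega>\<in>A. bridge_average h t r s (Z t \<omega>) (Z s \<omega>) + B \<partial>M)"
      using AM ZC av(2) sets.sets_into_space[OF AM] by (intro set_lebesgue_integral_cong) auto
    finally show "(\<integral>\<omega>\<in>A. h (Z r \<omega>) \<partial>M) = (\<integral>\<omega>\<in>A. bridge_average h t r s (Z t \<omega>) (Z s \<omega>) \<partial>M)"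
      by (simp add: set_integral_add(2) intA int int')
  qed
qed

end

section \<open>Iterated integrals as integrals over product spaces\<close>

context bridge_kernel
begin

text \<open>\<open>iterated_integral\<close> indexes coordinates by position, the grid laws by time;
  the injective map \<open>t\<close> translates between them. Positions outside
  \<open>{1..n}\<close> keep their value from \<open>\<omega>\<close>. The induction peels off the
  innermost coordinate, and the bound \<open>B\<close> keeps each inner Bochner integral equal to
  its nonnegative counterpart.\<close>

lemma iterated_integral_nn_integral:
  assumes "inj_on t {1..n}" and "\<And>i. i \<in> {1..n} \<Longrightarrow> E i \<in> sets R"
    and "(\<lambda>\<xi>. F (\<lambda>i. if i \<in> {1..n} then \<xi> (t i) else \<omega> i)) \<in> borel_measurable (PiM (t ` {1..n}) (\<lambda>_. R))"
    and "\<And>\<xi>. (\<And>i. i \<in> {1..n} \<Longrightarrow> \<xi> i \<in> C) \<Longrightarrow> (\<And>i. i \<notin> {1..n} \<Longrightarrow> \<xi> i = \<omega> i) \<Longrightarrow> 0 \<le> F \<xi> \<and> F \<xi> \<le> B"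
    and "0 \<le> B"
  shows "ennreal (iterated_integral E n F \<omega>) =
      (\<integral>\<^sup>+\<xi>. (\<Prod>i\<in>{1..n}. indicator (E i) (\<xi> (t i))) *
        ennreal (F (\<lambda>i. if i \<in> {1..n} then \<xi> (t i) else \<omega> i)) \<partial>PiM (t ` {1..n}) (\<lambda>_::real. R)) \<and>
    0 \<le> iterated_integral E n F \<omega>"
  using assms
proof (induction n arbitrary: F B)
  case 0
  then show ?case by (simp add: PiM_empty nn_integral_count_space_finite)
next
  case (Suc n)
  let ?e = "\<lambda>\<xi> i. if i \<in> {1..n} then \<xi> (t i) else \<omega> i"
  let ?e' = "\<lambda>\<xi> i. if i \<in> {1..Suc n} then \<xi> (t i) else \<omega> i"
  let ?I = "t ` {1..n}" and ?E = "E (Suc n)"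
  let ?F = "\<lambda>\<xi>. LINT z:?E|lborel. F (fun_upd \<xi> (Suc n) z)"
  have inj: "inj_on t {1..n}" using Suc.prems(1) by (rule inj_on_subset) auto
  have E: "\<And>i. i \<in> {1..n} \<Longrightarrow> E i \<in> sets R" and E'[measurable]: "?E \<in> sets R"
    using Suc.prems(2) by auto
  have tn: "t (Suc n) \<notin> ?I"
    using Suc.prems(1) by (auto dest: inj_onD)
  have I': "t ` {1..Suc n} = insert (t (Suc n)) ?I" by (simp add: atLeastAtMostSuc_conv)
  have tne: "t i \<noteq> t (Suc n)" if "i \<in> {1..n}" for i using tn that by (metis imageI)
  have e': "?e' (fun_upd \<xi> (t (Suc n)) z) = fun_upd (?e \<xi>) (Suc n) z" for \<xi> z
    using tne by (auto simp: fun_eq_iff le_Suc_eq)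
  have Fm[measurable]: "(\<lambda>\<xi>. F (?e' \<xi>)) \<in> borel_measurable (PiM (insert (t (Suc n)) ?I) (\<lambda>_. R))"
    using Suc.prems(3) unfolding I' .
  have upd: "(\<lambda>(\<xi>, z). fun_upd \<xi> (t (Suc n)) z) \<in> PiM ?I (\<lambda>_. R) \<Otimes>\<^sub>M R \<rightarrow>\<^sub>M PiM (insert (t (Suc n)) ?I) (\<lambda>_. R)"
    by (rule measurable_add_dim)
  have Fm2[measurable]: "(\<lambda>(\<xi>, z). F (fun_upd (?e \<xi>) (Suc n) z)) \<in> borel_measurable (PiM ?I (\<lambda>_. R) \<Otimes>\<^sub>M R)"
    using measurable_compose[OF upd Fm] by (simp only: case_prod_unfold e')
  have FR: "?F \<xi> = (\<integral>z. indicator ?E z * F (fun_upd \<xi> (Suc n) z) \<partial>R)" for \<xi>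
    by (rule set_lebesgue_integral_R[OF E'])
  have Fb: "0 \<le> F (fun_upd \<xi> (Suc n) z) \<and> F (fun_upd \<xi> (Suc n) z) \<le> B"
    if "\<And>i. i \<in> {1..n} \<Longrightarrow> \<xi> i \<in> C" "\<And>i. i \<notin> {1..n} \<Longrightarrow> \<xi> i = \<omega> i" "z \<in> C" for \<xi> z
    using that by (intro Suc.prems(4)) (auto simp: le_Suc_eq)
  have IH: "ennreal (iterated_integral E n ?F \<omega>) =
      (\<integral>\<^sup>+\<xi>. (\<Prod>i\<in>{1..n}. indicator (E i) (\<xi> (t i))) * ennreal (?F (?e \<xi>)) \<partial>PiM ?I (\<lambda>_. R)) \<and>
    0 \<le> iterated_integral E n ?F \<omega>"
  proof (rule Suc.IH[OF inj E])
    show "(\<lambda>\<xi>. ?F (?e \<xi>)) \<in> borel_measurable (PiM ?I (\<lambda>_. R))"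
      unfolding FR by measurable
    \<comment> \<open>Integrating out one coordinate multiplies the bound by the volume of
      \<open>C\<close>, which is finite; hence the induction has to leave \<open>B\<close>
      arbitrary.\<close>
    show "0 \<le> B * measure R C" using Suc.prems(5) by simp
    fix \<xi> assume \<xi>: "\<And>i. i \<in> {1..n} \<Longrightarrow> \<xi> i \<in> C" "\<And>i. i \<notin> {1..n} \<Longrightarrow> \<xi> i = \<omega> i"
    have b: "0 \<le> indicator ?E z * F (fun_upd \<xi> (Suc n) z)" "indicator ?E z * F (fun_upd \<xi> (Suc n) z) \<le> B"
      if "z \<in> C" for z
      using Fb[OF \<xi> that] Suc.prems(5) by (auto simp: indicator_def)
    have "0 \<le> ?F \<xi>" unfolding FR using b by (intro Bochner_Integration.integral_nonneg) simp
    moreover have "?F \<xi> \<le> B * measure R C"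
    proof (cases "integrable R (\<lambda>z. indicator ?E z * F (fun_upd \<xi> (Suc n) z))")
      case True
      then have "?F \<xi> \<le> (\<integral>z. B \<partial>R)"
        unfolding FR using b by (intro integral_mono) auto
      then show ?thesis by (simp add: mult.commute)
    next
      \<comment> \<open>The integral is then \<open>0\<close> by convention and the bound is
        trivial, so measurability in the last coordinate need not be established for this arbitrary
        \<open>\<xi>\<close>.\<close>
      case False
      then show ?thesis unfolding FR using Suc.prems(5) by (simp add: not_integrable_integral_eq)
    qed
    ultimately show "0 \<le> ?F \<xi> \<and> ?F \<xi> \<le> B * measure R C" by simp
  qed
  have inner: "ennreal (?F (?e \<xi>)) = (\<integral>\<^sup>+z. indicator ?E z * ennreal (F (fun_upd (?e \<xi>) (Suc n) z)) \<partial>R)"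
    if "\<xi> \<in> space (PiM ?I (\<lambda>_. R))" for \<xi>
  proof -
    have b: "0 \<le> F (fun_upd (?e \<xi>) (Suc n) z) \<and> F (fun_upd (?e \<xi>) (Suc n) z) \<le> B" if "z \<in> C" for z
      using \<open>\<xi> \<in> _\<close> that by (intro Fb) (auto simp: space_PiM PiE_iff)
    have [measurable]: "(\<lambda>z. F (fun_upd (?e \<xi>) (Suc n) z)) \<in> borel_measurable R"
      using measurable_Pair2[OF Fm2 that] by simp
    have b': "0 \<le> indicator ?E z * F (fun_upd (?e \<xi>) (Suc n) z)"
      "indicator ?E z * F (fun_upd (?e \<xi>) (Suc n) z) \<le> B" if "z \<in> C" for z
      using b[OF that] Suc.prems(5) by (auto simp: indicator_def)
    have m: "(\<lambda>z. indicator ?E z * F (fun_upd (?e \<xi>) (Suc n) z)) \<in> borel_measurable R"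
      by measurable
    have "integrable R (\<lambda>z. indicator ?E z * F (fun_upd (?e \<xi>) (Suc n) z))"
      using b' by (intro R.integrable_const_bound[where B=B] AE_I2 m) (simp del: fun_upd_apply)
    then have "ennreal (?F (?e \<xi>)) = (\<integral>\<^sup>+z. ennreal (indicator ?E z * F (fun_upd (?e \<xi>) (Suc n) z)) \<partial>R)"
      unfolding FR using b' by (intro nn_integral_eq_integral[symmetric] AE_I2) simp_all
    also have "\<dots> = (\<integral>\<^sup>+z. indicator ?E z * ennreal (F (fun_upd (?e \<xi>) (Suc n) z)) \<partial>R)"
      by (intro nn_integral_cong) (simp add: indicator_def)
    finally show ?thesis .
  qed
  have comp: "(\<lambda>\<omega>. \<omega> \<tau>) \<in> PiM K (\<lambda>_. R) \<rightarrow>\<^sub>M R" if "\<tau> \<in> K" for \<tau> K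
    using that by (rule measurable_component_singleton)
  have prodm: "(\<lambda>\<xi>. (\<Prod>i\<in>{1..Suc n}. indicator (E i) (\<xi> (t i))) :: ennreal) \<in> borel_measurable (PiM (insert (t (Suc n)) ?I) (\<lambda>_. R))"
  proof (intro borel_measurable_prod_ennreal measurable_compose[OF comp borel_measurable_indicator])
    show "t i \<in> insert (t (Suc n)) ?I" if "i \<in> {1..Suc n}" for i
      using that I' by blast
  qed (rule Suc.prems(2))
  have "ennreal (iterated_integral E (Suc n) F \<omega>) =
      (\<integral>\<^sup>+\<xi>. (\<Prod>i\<in>{1..n}. indicator (E i) (\<xi> (t i))) * ennreal (?F (?e \<xi>)) \<partial>PiM ?I (\<lambda>_. R))"
    using IH by simp
  also have "\<dots> = (\<integral>\<^sup>+\<xi>. (\<integral>\<^sup>+z. (\<Prod>i\<in>{1..Suc n}. indicator (E i) (fun_upd \<xi> (t (Suc n)) z (t i))) *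
      ennreal (F (?e' (fun_upd \<xi> (t (Suc n)) z))) \<partial>R) \<partial>PiM ?I (\<lambda>_. R))"
  proof (intro nn_integral_cong)
    fix \<xi> assume \<xi>: "\<xi> \<in> space (PiM ?I (\<lambda>_. R))"
    have [measurable]: "(\<lambda>z. F (fun_upd (?e \<xi>) (Suc n) z)) \<in> borel_measurable R"
      using measurable_Pair2[OF Fm2 \<xi>] by simp
    have "(\<Prod>i\<in>{1..Suc n}. indicator (E i) (fun_upd \<xi> (t (Suc n)) z (t i))) =
        indicator ?E z * (\<Prod>i\<in>{1..n}. indicator (E i) (\<xi> (t i)) :: ennreal)" for z
      using tne by (auto simp: mult.commute intro!: arg_cong2[where f="(*)"] prod.cong)
    then have "(\<integral>\<^sup>+z. (\<Prod>i\<in>{1..Suc n}. indicator (E i) (fun_upd \<xi> (t (Suc n)) z (t i))) *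
        ennreal (F (?e' (fun_upd \<xi> (t (Suc n)) z))) \<partial>R) =
      (\<integral>\<^sup>+z. (\<Prod>i\<in>{1..n}. indicator (E i) (\<xi> (t i))) * (indicator ?E z * ennreal (F (fun_upd (?e \<xi>) (Suc n) z))) \<partial>R)"
      unfolding e' by (simp add: mult_ac)
    also have "\<dots> = (\<Prod>i\<in>{1..n}. indicator (E i) (\<xi> (t i))) * ennreal (?F (?e \<xi>))"
      unfolding inner[OF \<xi>] by (rule nn_integral_cmult) measurable
    finally show "(\<Prod>i\<in>{1..n}. indicator (E i) (\<xi> (t i))) * ennreal (?F (?e \<xi>)) =
      (\<integral>\<^sup>+z. (\<Prod>i\<in>{1..Suc n}. indicator (E i) (fun_upd \<xi> (t (Suc n)) z (t i))) *
        ennreal (F (?e' (fun_upd \<xi> (t (Suc n)) z))) \<partial>R)" by simp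
  qed
  also have "\<dots> = (\<integral>\<^sup>+\<xi>. (\<Prod>i\<in>{1..Suc n}. indicator (E i) (\<xi> (t i))) * ennreal (F (?e' \<xi>))
      \<partial>PiM (insert (t (Suc n)) ?I) (\<lambda>_. R))"
    using tn
    by (intro product_nn_integral_insert[symmetric] borel_measurable_times_ennreal prodm
        measurable_compose[OF Fm measurable_ennreal]) auto
  finally show ?case using IH unfolding I' by simp
qed

end

section \<open>Finite-dimensional distributions\<close>

lemma chain_less:
  fixes t :: "nat \<Rightarrow> real"
  assumes "\<And>i. i < n \<Longrightarrow> t i < t (Suc i)" "i < j" "j \<le> n"
  shows "t i < t j"
  using assms(2,3)
proof (induction j)
  case (Suc j)
  then show ?case
    using assms(1)[of j] by (cases "i = j") (auto intro: order.strict_trans)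
qed simp

lemma chain_le:
  fixes t :: "nat \<Rightarrow> real"
  assumes "\<And>i. i < n \<Longrightarrow> t i < t (Suc i)" "i \<le> j" "j \<le> n"
  shows "t i \<le> t j"
  using chain_less[where t=t and n=n, OF assms(1), of i j] assms by (cases "i = j") auto

context bridge_kernel
begin

lemma path_density_chain:
  assumes "t 0 = 0" "\<And>i. i < n \<Longrightarrow> t i < t (Suc i)" "t n < T"
    and "\<And>\<tau>. \<tau> \<in> insert T (t ` {..n}) \<Longrightarrow> \<omega> \<tau> \<in> C"
  shows "path_density (insert T (t ` {..n})) \<omega> = \<mu> (\<omega> 0) (\<omega> T) *
    (\<Prod>i=1..n. bridge_density g (\<omega> T) T (\<omega> (t i)) (t i) (\<omega> (t (i - 1))) (t (i - 1)))"
  using assms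
proof (induction n)
  case 0
  then show ?case using path_density_endpoints[of \<omega>] by (simp add: insert_commute)
next
  case (Suc n)
  let ?J = "insert T (t ` {..n})" and ?r = "t (Suc n)"
  have le: "t i \<le> t n" "0 \<le> t i" if "i \<le> n" for i
    using chain_le[where t=t and n="Suc n", OF Suc.prems(2), of i n] chain_le[where t=t and n="Suc n", OF Suc.prems(2), of 0 i] that Suc.prems(1) by auto
  have nr: "t n < ?r" "?r < T" using Suc.prems by auto
  have J: "time_grid ?J"
    using le nr Suc.prems(1) T_pos by (force simp: time_grid_def)
  have "path_density (insert T (t ` {..Suc n})) \<omega> = path_density (insert ?r ?J) \<omega>"
    by (simp add: atMost_Suc insert_commute)
  also have "\<dots> = path_density ?J \<omega> * bridge_density g (\<omega> T) T (\<omega> ?r) ?r (\<omega> (t n)) (t n)"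
  proof (rule path_density_insert[OF J])
    show "?r \<notin> ?J" "?J \<inter> {t n<..<T} = {}" using le nr by force+
  qed (use nr Suc.prems in auto)
  also have "path_density ?J \<omega> = \<mu> (\<omega> 0) (\<omega> T) *
    (\<Prod>i=1..n. bridge_density g (\<omega> T) T (\<omega> (t i)) (t i) (\<omega> (t (i - 1))) (t (i - 1)))"
    using Suc.prems(1,2,4) order.strict_trans[OF nr] by (intro Suc.IH) auto
  finally show ?case by (simp add: mult.assoc)
qed

end

context bridge_process
begin

text \<open>The event has probability equal to an integral of the path density over the grid.
  Tonelli separates the endpoints from the interior times; for fixed endpoints the interior integral
  \<open>H\<close> is the iterated integral of bridge densities. All of this happens with
  nonnegative integrals, and only the last steps return to Bochner integrals. The case
  \<open>n = 0\<close> is included and serves for the endpoint law.\<close>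

lemma finite_dimensional_distribution:
  assumes t: "t 0 = 0" "\<And>i. i < n \<Longrightarrow> t i < t (Suc i)" "t n < T"
    and E0[measurable]: "E\<^sub>0 \<in> sets R" and ET[measurable]: "E\<^sub>T \<in> sets R" and E: "\<And>i. i \<in> {1..n} \<Longrightarrow> E i \<in> sets R"
  shows "measure M {\<omega> \<in> space M. Z 0 \<omega> \<in> E\<^sub>0 \<and> (\<forall>i\<in>{1..n}. Z (t i) \<omega> \<in> E i) \<and> Z T \<omega> \<in> E\<^sub>T} =
    set_lebesgue_integral lborel (E\<^sub>0 \<times> E\<^sub>T)
      (\<lambda>(x, y). \<mu> x y *
         iterated_integral E n
           (\<lambda>\<xi>. \<Prod>i=1..n. bridge_density g y T (\<xi> i) (t i) (\<xi> (i - 1)) (t (i - 1)))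
           (\<lambda>_. x))"
proof -
  let ?I = "t ` {1..n}" and ?J = "insert T (t ` {..n})"
  \<comment> \<open>This is the integrand in the shape expected by
    \<open>iterated_integral_nn_integral\<close>. For \<open>i = 1\<close> the position
    \<open>i - 1\<close> is \<open>0\<close>, outside \<open>{1..n}\<close>, and the else branch
    supplies the starting point \<open>x\<close>.\<close>
  define P where "P x y \<eta> = (\<Prod>i=1..n. bridge_density g y T
      (if i \<in> {1..n} then \<eta> (t i) else x) (t i) (if i - 1 \<in> {1..n} then \<eta> (t (i - 1)) else x) (t (i - 1)))"
    for x y and \<eta> :: "real \<Rightarrow> real^'d"
  define ind where "ind \<eta> = (\<Prod>i=1..n. indicator (E i) (\<eta> (t i)) :: ennreal)" for \<eta> :: "real \<Rightarrow> real^'d"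
  define H where "H x y = (\<integral>\<^sup>+\<eta>. ind \<eta> * ennreal (P x y \<eta>) \<partial>PiM ?I (\<lambda>_. R))" for x y
  define It where "It x y = iterated_integral E n
      (\<lambda>\<xi>. \<Prod>i=1..n. bridge_density g y T (\<xi> i) (t i) (\<xi> (i - 1)) (t (i - 1))) (\<lambda>_. x)" for x y
  have lt: "t i < t j" if "i < j" "j \<le> n" for i j using chain_less[where t=t and n=n, OF t(2) that] .
  have inj: "inj_on t {1..n}"
    by (rule inj_onI) (metis atLeastAtMost_iff lt less_irrefl linorder_neqE_nat)
  have pos: "0 < t i" "t i < T" "0 \<le> t (i - 1)" "t (i - 1) < t i" if "i \<in> {1..n}" for i
  proof -
    show "0 < t i" using lt[of 0 i] that t(1) by auto
    show "t i < T" using chain_le[where t=t and n=n, OF t(2), of i n] that t(3) by auto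
    show "0 \<le> t (i - 1)" using chain_le[where t=t and n=n, OF t(2), of 0 "i - 1"] that t(1) by auto
    show "t (i - 1) < t i" using lt[of "i - 1" i] that by auto
  qed
  have JI: "?J = {0, T} \<union> ?I"
  proof -
    have "{..n} = insert 0 {1..n}" by auto
    then show ?thesis using t(1) by auto
  qed
  have disj: "{0, T} \<inter> ?I = {}" using pos by force
  have J: "time_grid ?J" unfolding JI time_grid_def using pos(1,2)[THEN less_imp_le] T_pos by auto
  have comp: "(\<lambda>\<omega>. \<omega> \<tau>) \<in> PiM K (\<lambda>_. R) \<rightarrow>\<^sub>M R" if "\<tau> \<in> K" for \<tau> K
    using that by (rule measurable_component_singleton)
  have ind_m: "ind \<in> borel_measurable (PiM K (\<lambda>_. R))" if "?I \<subseteq> K" for K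
    unfolding ind_def using that E
    by (intro borel_measurable_prod_ennreal measurable_compose[OF comp borel_measurable_indicator]) auto
  have P_m: "(\<lambda>a. P (u a) (v a) (w a)) \<in> borel_measurable N"
    if "u \<in> N \<rightarrow>\<^sub>M R" "v \<in> N \<rightarrow>\<^sub>M R" "w \<in> N \<rightarrow>\<^sub>M PiM ?I (\<lambda>_. R)" for u v w and N :: "'x measure"
  proof -
    have c: "(\<lambda>a. if i \<in> {1..n} then w a (t i) else u a) \<in> N \<rightarrow>\<^sub>M R" for i
    proof (cases "i \<in> {1..n}")
      case True
      then have "(\<lambda>a. w a (t i)) \<in> N \<rightarrow>\<^sub>M R" by (intro measurable_compose[OF that(3) comp]) auto
      with True show ?thesis by simp
    next
      case False
      with that(1) show ?thesis by (simp only: if_False)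
    qed
    show ?thesis
      unfolding P_def using pos
      by (intro borel_measurable_prod bridge_density_measurable c that) auto
  qed
  have P_nonneg: "0 \<le> P x y \<eta>" if "x \<in> C" "y \<in> C" "\<And>\<tau>. \<tau> \<in> ?I \<Longrightarrow> \<eta> \<tau> \<in> C" for x y \<eta>
    unfolding P_def using pos that by (intro prod_nonneg ballI less_imp_le[OF bridge_density_pos]) auto
  have It: "ennreal (It x y) = H x y \<and> 0 \<le> It x y" if xy: "x \<in> C" "y \<in> C" for x y
  proof -
    have "\<exists>B. \<forall>x\<in>C. \<forall>y\<in>C. \<forall>z\<in>C. bridge_density g x T z (t i) y (t (i - 1)) \<le> B" if i: "i \<in> {1..n}" for i
    proof -
      obtain B where "\<And>x y z. x \<in> C \<Longrightarrow> y \<in> C \<Longrightarrow> z \<in> C \<Longrightarrow> bridge_density g x T z (t i) y (t (i - 1)) \<le> B"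
        using bridge_density_bounded[OF pos(3,4,2)[OF i] order_refl] by blast
      then show ?thesis by blast
    qed
    then have "\<forall>i\<in>{1..n}. \<exists>B. \<forall>x\<in>C. \<forall>y\<in>C. \<forall>z\<in>C. bridge_density g x T z (t i) y (t (i - 1)) \<le> B" by blast
    from bchoice[OF this] obtain B where B: "\<And>i x y z. i \<in> {1..n} \<Longrightarrow> x \<in> C \<Longrightarrow> y \<in> C \<Longrightarrow> z \<in> C \<Longrightarrow>
        bridge_density g x T z (t i) y (t (i - 1)) \<le> B i" by blast
    have p0: "0 \<le> bridge_density g x T z (t i) y (t (i - 1))"
      if "i \<in> {1..n}" "x \<in> C" "y \<in> C" "z \<in> C" for i x y z
      using pos[OF that(1)] that by (intro less_imp_le[OF bridge_density_pos]) auto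
    have B0: "0 \<le> B i" if "i \<in> {1..n}" for i
      using B[OF that xy xy(1)] p0[OF that xy xy(1)] by linarith
    show ?thesis
      unfolding It_def H_def ind_def P_def
    proof (rule iterated_integral_nn_integral[OF inj E, where B="\<Prod>i=1..n. B i"])
      show "0 \<le> (\<Prod>i=1..n. B i)" using B0 by (intro prod_nonneg) auto
      show "(\<lambda>\<xi>. \<Prod>i=1..n. bridge_density g y T (if i \<in> {1..n} then \<xi> (t i) else x) (t i)
          (if i - 1 \<in> {1..n} then \<xi> (t (i - 1)) else x) (t (i - 1))) \<in> borel_measurable (PiM ?I (\<lambda>_. R))"
        unfolding P_def[symmetric] using xy by (intro P_m) auto
      fix \<xi> :: "nat \<Rightarrow> real^'d"
      assume \<xi>: "\<And>i. i \<in> {1..n} \<Longrightarrow> \<xi> i \<in> C" "\<And>i. i \<notin> {1..n} \<Longrightarrow> \<xi> i = x"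
      have \<xi>C: "\<xi> i \<in> C" for i using \<xi> xy by (cases "i \<in> {1..n}") auto
      have q: "0 \<le> bridge_density g y T (\<xi> i) (t i) (\<xi> (i - 1)) (t (i - 1))"
        "bridge_density g y T (\<xi> i) (t i) (\<xi> (i - 1)) (t (i - 1)) \<le> B i" if "i \<in> {1..n}" for i
        using p0[OF that xy(2) \<xi>C \<xi>C] B[OF that xy(2) \<xi>C \<xi>C] by blast+
      show "0 \<le> (\<Prod>i=1..n. bridge_density g y T (\<xi> i) (t i) (\<xi> (i - 1)) (t (i - 1))) \<and>
        (\<Prod>i=1..n. bridge_density g y T (\<xi> i) (t i) (\<xi> (i - 1)) (t (i - 1))) \<le> (\<Prod>i=1..n. B i)"
        by (intro conjI prod_nonneg prod_mono q)
    qed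
  qed
  have H_m[measurable]: "case_prod H \<in> borel_measurable (R \<Otimes>\<^sub>M R)"
  proof -
    have "(\<lambda>a. P (fst (fst a)) (snd (fst a)) (snd a)) \<in> borel_measurable ((R \<Otimes>\<^sub>M R) \<Otimes>\<^sub>M PiM ?I (\<lambda>_. R))"
      by (intro P_m) auto
    moreover have "(\<lambda>a. ind (snd a)) \<in> borel_measurable ((R \<Otimes>\<^sub>M R) \<Otimes>\<^sub>M PiM ?I (\<lambda>_. R))"
      by (intro measurable_compose[OF measurable_snd ind_m]) auto
    ultimately have [measurable]: "(\<lambda>(z, \<eta>). ind \<eta> * ennreal (P (fst z) (snd z) \<eta>))
        \<in> borel_measurable ((R \<Otimes>\<^sub>M R) \<Otimes>\<^sub>M PiM ?I (\<lambda>_. R))"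
      unfolding case_prod_beta by measurable
    \<comment> \<open>Sigma-finiteness is what makes \<open>H\<close>, an integral depending on
      parameters, measurable.\<close>
    interpret I: sigma_finite_measure "PiM ?I (\<lambda>_. R)" by (rule product_sigma_finite.sigma_finite[OF product_sigma_finite_axioms]) simp
    show ?thesis unfolding H_def case_prod_unfold by measurable
  qed
  have \<mu>_m[measurable]: "case_prod \<mu> \<in> borel_measurable (R \<Otimes>\<^sub>M R)"
    using \<mu>_measurable by (simp add: R_def)
  let ?F = "\<lambda>\<omega>. indicator E\<^sub>0 (\<omega> 0) * indicator E\<^sub>T (\<omega> T) * ind \<omega>"
  have F_m: "?F \<in> borel_measurable (PiM ?J (\<lambda>_. R))"
    using JI by (intro borel_measurable_times_ennreal ind_m measurable_compose[OF comp borel_measurable_indicator]) auto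
  have pd_m: "path_density ?J \<in> borel_measurable (PiM ?J (\<lambda>_. R))"
    by (rule path_density_measurable[OF J order_refl])
  let ?S = "{\<omega> \<in> space M. Z 0 \<omega> \<in> E\<^sub>0 \<and> (\<forall>i\<in>{1..n}. Z (t i) \<omega> \<in> E i) \<and> Z T \<omega> \<in> E\<^sub>T}"
  have S: "?S \<in> sets M"
  proof -
    have "{\<omega> \<in> space M. Z \<tau> \<omega> \<in> A} \<in> sets M" if "\<tau> \<in> {0..T}" "A \<in> sets R" for \<tau> A
      using measurable_sets[OF Z_measurable[OF that(1)] that(2)] by (simp add: vimage_def Int_def conj_commute)
    moreover have "\<And>i. i \<in> {1..n} \<Longrightarrow> t i \<in> {0..T}" using pos(1,2)[THEN less_imp_le] by auto
    ultimately show ?thesis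
      using T_pos E E0 ET by (intro sets.sets_Collect_conj sets.sets_Collect_finite_All) auto
  qed
  have "emeasure M ?S = (\<integral>\<^sup>+\<omega>. indicator ?S \<omega> \<partial>M)" using S by simp
  also have "\<dots> = (\<integral>\<^sup>+\<omega>. ?F (\<lambda>\<tau>\<in>?J. Z \<tau> \<omega>) \<partial>M)"
  proof (intro nn_integral_cong)
    fix \<omega> assume \<omega>: "\<omega> \<in> space M"
    have "ind (\<lambda>\<tau>\<in>?J. Z \<tau> \<omega>) = (if \<forall>i\<in>{1..n}. Z (t i) \<omega> \<in> E i then 1 else 0)"
      by (auto simp: ind_def indicator_def intro!: prod.neutral)
    moreover have "0 \<in> ?J" using JI by auto
    ultimately show "indicator ?S \<omega> = ?F (\<lambda>\<tau>\<in>?J. Z \<tau> \<omega>)" using \<omega> by (auto simp: indicator_def)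
  qed
  also have "\<dots> = (\<integral>\<^sup>+\<omega>. ?F \<omega> \<partial>grid_law ?J)" by (rule nn_integral_grid[OF J F_m])
  also have "\<dots> = (\<integral>\<^sup>+\<omega>. ennreal (path_density ?J \<omega>) * ?F \<omega> \<partial>PiM ({0, T} \<union> ?I) (\<lambda>_. R))"
    using nn_integral_grid_law[OF J F_m] unfolding JI .
  \<comment> \<open>Tonelli for the splitting of the grid into endpoints, carried by
    \<open>\<omega>\<close>, and interior times, carried by \<open>\<eta>\<close>.\<close>
  also have "\<dots> = (\<integral>\<^sup>+\<omega>. (\<integral>\<^sup>+\<eta>. ennreal (path_density ?J (merge {0, T} ?I (\<omega>, \<eta>))) *
      ?F (merge {0, T} ?I (\<omega>, \<eta>)) \<partial>PiM ?I (\<lambda>_. R)) \<partial>PiM {0, T} (\<lambda>_. R))"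
    using disj borel_measurable_times_ennreal[OF measurable_compose[OF pd_m measurable_ennreal] F_m]
    unfolding JI by (intro product_nn_integral_fold) auto
  also have "\<dots> = (\<integral>\<^sup>+\<omega>. indicator E\<^sub>0 (\<omega> 0) * indicator E\<^sub>T (\<omega> T) * ennreal (\<mu> (\<omega> 0) (\<omega> T)) * H (\<omega> 0) (\<omega> T)
      \<partial>PiM {0, T} (\<lambda>_. R))"
  proof (intro nn_integral_cong)
    fix \<omega> assume "\<omega> \<in> space (PiM {0, T} (\<lambda>_. R))"
    then have \<omega>: "\<omega> 0 \<in> C" "\<omega> T \<in> C" by (auto simp: space_PiM PiE_iff)
    have "(\<integral>\<^sup>+\<eta>. ennreal (path_density ?J (merge {0, T} ?I (\<omega>, \<eta>))) *
        ?F (merge {0, T} ?I (\<omega>, \<eta>)) \<partial>PiM ?I (\<lambda>_. R)) =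
      (\<integral>\<^sup>+\<eta>. (indicator E\<^sub>0 (\<omega> 0) * indicator E\<^sub>T (\<omega> T) * ennreal (\<mu> (\<omega> 0) (\<omega> T))) *
        (ind \<eta> * ennreal (P (\<omega> 0) (\<omega> T) \<eta>)) \<partial>PiM ?I (\<lambda>_. R))"
    proof (intro nn_integral_cong)
      fix \<eta> assume "\<eta> \<in> space (PiM ?I (\<lambda>_. R))"
      then have \<eta>: "\<And>\<tau>. \<tau> \<in> ?I \<Longrightarrow> \<eta> \<tau> \<in> C" by (auto simp: space_PiM PiE_iff)
      define m where "m = merge {0, T} ?I (\<omega>, \<eta>)"
      have m: "m 0 = \<omega> 0" "m T = \<omega> T" "\<And>i. i \<in> {1..n} \<Longrightarrow> m (t i) = \<eta> (t i)"
        using disj by (auto simp: m_def merge_def)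
      have mC: "m \<tau> \<in> C" if "\<tau> \<in> ?J" for \<tau>
        using that \<omega> \<eta> m unfolding JI by auto
      \<comment> \<open>Position \<open>0\<close> corresponds to time \<open>t 0 = 0\<close>, an
        endpoint, so its value comes from \<open>\<omega>\<close> and not from
        \<open>\<eta>\<close>.\<close>
      have e: "m (t i) = (if i \<in> {1..n} then \<eta> (t i) else \<omega> 0)" if "i \<le> n" for i
        using m(1,3) t(1) that by (cases "i = 0") auto
      have "P (\<omega> 0) (\<omega> T) \<eta> =
          (\<Prod>i=1..n. bridge_density g (m T) T (m (t i)) (t i) (m (t (i - 1))) (t (i - 1)))"
        unfolding P_def m(2)
      proof (rule prod.cong[OF refl])
        fix i assume "i \<in> {1..n}"
        then have "i \<le> n" "i - 1 \<le> n" by auto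
        from e[OF this(1)] e[OF this(2)]
        show "bridge_density g (\<omega> T) T (if i \<in> {1..n} then \<eta> (t i) else \<omega> 0) (t i)
            (if i - 1 \<in> {1..n} then \<eta> (t (i - 1)) else \<omega> 0) (t (i - 1)) =
          bridge_density g (\<omega> T) T (m (t i)) (t i) (m (t (i - 1))) (t (i - 1))"
          by (simp only:)
      qed
      then have pd: "path_density ?J m = \<mu> (\<omega> 0) (\<omega> T) * P (\<omega> 0) (\<omega> T) \<eta>"
        using path_density_chain[of t n m, OF t mC] unfolding m(1,2) by (simp only:)
      have em: "ennreal (\<mu> (\<omega> 0) (\<omega> T) * P (\<omega> 0) (\<omega> T) \<eta>) =
          ennreal (\<mu> (\<omega> 0) (\<omega> T)) * ennreal (P (\<omega> 0) (\<omega> T) \<eta>)"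
        using \<mu>_nonneg[OF \<omega>] P_nonneg[OF \<omega>, of \<eta>] \<eta> by (intro ennreal_mult) blast+
      have "ind m = ind \<eta>" unfolding ind_def using m(3) by (intro prod.cong) auto
      then show "ennreal (path_density ?J (merge {0, T} ?I (\<omega>, \<eta>))) * ?F (merge {0, T} ?I (\<omega>, \<eta>)) =
          (indicator E\<^sub>0 (\<omega> 0) * indicator E\<^sub>T (\<omega> T) * ennreal (\<mu> (\<omega> 0) (\<omega> T))) *
          (ind \<eta> * ennreal (P (\<omega> 0) (\<omega> T) \<eta>))"
        unfolding m_def[symmetric] pd m(1,2) em
        by (simp only: mult_ac)
    qed
    also have "\<dots> = indicator E\<^sub>0 (\<omega> 0) * indicator E\<^sub>T (\<omega> T) * ennreal (\<mu> (\<omega> 0) (\<omega> T)) * H (\<omega> 0) (\<omega> T)"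
    proof -
      have "(\<lambda>\<eta>. P (\<omega> 0) (\<omega> T) \<eta>) \<in> borel_measurable (PiM ?I (\<lambda>_. R))"
        using \<omega> by (intro P_m) auto
      from borel_measurable_times_ennreal[OF ind_m[OF order_refl] measurable_compose[OF this measurable_ennreal]]
      show ?thesis unfolding H_def by (rule nn_integral_cmult)
    qed
    finally show "(\<integral>\<^sup>+\<eta>. ennreal (path_density ?J (merge {0, T} ?I (\<omega>, \<eta>))) *
        ?F (merge {0, T} ?I (\<omega>, \<eta>)) \<partial>PiM ?I (\<lambda>_. R)) =
      indicator E\<^sub>0 (\<omega> 0) * indicator E\<^sub>T (\<omega> T) * ennreal (\<mu> (\<omega> 0) (\<omega> T)) * H (\<omega> 0) (\<omega> T)" .
  qed
  also have "\<dots> = (\<integral>\<^sup>+z. indicator E\<^sub>0 (fst z) * indicator E\<^sub>T (snd z) * ennreal (\<mu> (fst z) (snd z)) * H (fst z) (snd z)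
      \<partial>(R \<Otimes>\<^sub>M R))"
    using T_pos by (intro product_nn_integral_pair[where f="\<lambda>x y. indicator E\<^sub>0 x * indicator E\<^sub>T y * ennreal (\<mu> x y) * H x y"]) auto
  also have "\<dots> = (\<integral>\<^sup>+(x, y). indicator E\<^sub>0 x * indicator E\<^sub>T y * ennreal ((\<lambda>(x, y). \<mu> x y * It x y) (x, y)) \<partial>(R \<Otimes>\<^sub>M R))"
  proof (intro nn_integral_cong)
    fix z assume "z \<in> space (R \<Otimes>\<^sub>M R)"
    then show "indicator E\<^sub>0 (fst z) * indicator E\<^sub>T (snd z) * ennreal (\<mu> (fst z) (snd z)) * H (fst z) (snd z) =
        (case z of (x, y) \<Rightarrow> indicator E\<^sub>0 x * indicator E\<^sub>T y * ennreal ((\<lambda>(x, y). \<mu> x y * It x y) (x, y)))"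
      using It[of "fst z" "snd z"] \<mu>_nonneg[of "fst z" "snd z"]
      by (auto simp: space_pair_measure ennreal_mult mult_ac)
  qed
  finally have "measure M ?S = enn2real \<dots>" by (simp add: measure_def)
  also have "\<dots> = set_lebesgue_integral lborel (E\<^sub>0 \<times> E\<^sub>T) (\<lambda>(x, y). \<mu> x y * It x y)"
  proof (rule set_lebesgue_integral_R_pair[OF E0 ET, symmetric])
    \<comment> \<open>Measurability of the iterated integral in the endpoints is not evident from
      its recursive definition; it is inherited from \<open>H\<close>, with which it agrees on
      \<open>C \<times> C\<close>.\<close>
    have "(\<lambda>z. case_prod \<mu> z * enn2real (case_prod H z)) \<in> borel_measurable (R \<Otimes>\<^sub>M R)" by measurable
    then show "(\<lambda>(x, y). \<mu> x y * It x y) \<in> borel_measurable (R \<Otimes>\<^sub>M R)"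
    proof (rule measurable_cong[THEN iffD1, rotated])
      fix z assume "z \<in> space (R \<Otimes>\<^sub>M R)"
      then show "case_prod \<mu> z * enn2real (case_prod H z) = (case z of (x, y) \<Rightarrow> \<mu> x y * It x y)"
        using It[of "fst z" "snd z"] by (auto simp: space_pair_measure) (metis enn2real_ennreal)
    qed
  qed (use It \<mu>_nonneg in auto)
  finally show ?thesis unfolding It_def .
qed

text \<open>The case of no interior times: the empty product integrated over no coordinates is
  \<open>1\<close>, and only \<open>\<mu>\<close> remains.\<close>

lemma endpoint_distribution:
  assumes E0: "E\<^sub>0 \<in> sets R" and ET: "E\<^sub>T \<in> sets R"
  shows "measure M {\<omega> \<in> space M. Z 0 \<omega> \<in> E\<^sub>0 \<and> Z T \<omega> \<in> E\<^sub>T} =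
    set_lebesgue_integral lborel (E\<^sub>0 \<times> E\<^sub>T) (\<lambda>(x, y). \<mu> x y)"
  using finite_dimensional_distribution[of "\<lambda>_. 0" 0 E\<^sub>0 E\<^sub>T] assms T_pos by simp

lemma Bernstein_realization:
  assumes complete: "complete_measure M" and C: "C = closure D"
  shows "Bernstein_realization T D g \<mu> M Z"
proof -
  have sR: "sets (restrict_space borel (closure D)) = sets R" using C sets_R by simp
  have Zm: "Z \<tau> \<in> M \<rightarrow>\<^sub>M restrict_space borel (closure D)" if "\<tau> \<in> {0..T}" for \<tau>
    using Z_measurable[OF that] measurable_cong_sets[OF refl sR, of M] by simp
  have Bernstein: "AE \<omega> in M.
      real_cond_exp M (join_sigma M (generated_sigma M Z {0..s}) (generated_sigma M Z {t..T})) (\<lambda>\<omega>. h (Z r \<omega>)) \<omega> =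
      real_cond_exp M (generated_sigma M Z {s, t}) (\<lambda>\<omega>. h (Z r \<omega>)) \<omega>"
    if h: "h \<in> borel_measurable (restrict_space borel (closure D))" "bounded (h ` closure D)"
      and str: "0 \<le> s" "s < r" "r < t" "t \<le> T" for h :: "real^'d \<Rightarrow> real" and s r t
  proof -
    have hR: "h \<in> borel_measurable R" using h(1) by (simp only: measurable_cong_sets[OF sR refl])
    obtain B where B: "\<And>z. z \<in> C \<Longrightarrow> \<bar>h z\<bar> \<le> B"
      using h(2) C unfolding bounded_iff by auto
    have sub: "sets (generated_sigma M Z {s, t}) \<subseteq> sets (generated_sigma M Z ({0..s} \<union> {t..T}))"
      using str by (intro generated_sigma_mono) auto
    have "AE \<omega> in M. real_cond_exp M (join_sigma M (generated_sigma M Z {0..s}) (generated_sigma M Z {t..T}))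
        (\<lambda>\<omega>. h (Z r \<omega>)) \<omega> = bridge_average h t r s (Z t \<omega>) (Z s \<omega>)"
      using sub by (intro real_cond_exp_bridge[OF str _ _ _ hR B]) (simp_all add: sets_join_generated_sigma)
    moreover have "AE \<omega> in M. real_cond_exp M (generated_sigma M Z {s, t})
        (\<lambda>\<omega>. h (Z r \<omega>)) \<omega> = bridge_average h t r s (Z t \<omega>) (Z s \<omega>)"
      using sub by (intro real_cond_exp_bridge[OF str _ _ _ hR B]) simp_all
    ultimately show ?thesis by eventually_elim simp
  qed
  have bridge: "AE \<omega> in M. real_cond_exp M (generated_sigma M Z {s, t}) (indicator {\<omega> \<in> space M. Z r \<omega> \<in> E}) \<omega> =
      bridge_prob g (Z t \<omega>) t E r (Z s \<omega>) s"
    if E: "E \<in> sets R" and str: "0 \<le> s" "s < r" "r < t" "t \<le> T" for E s r t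
  proof -
    have sub: "sets (generated_sigma M Z {s, t}) \<subseteq> sets (generated_sigma M Z ({0..s} \<union> {t..T}))"
      using str by (intro generated_sigma_mono) auto
    have I: "{s, t} \<subseteq> {0..T}" using str by auto
    interpret F: finite_measure_subalgebra M "generated_sigma M Z {s, t}"
      by standard (rule subalgebra_generated_sigma[OF I])
    have [measurable]: "Z r \<in> M \<rightarrow>\<^sub>M R" "E \<in> sets R" using str E by (auto intro!: Z_measurable)
    have [measurable]: "{\<omega> \<in> space M. Z r \<omega> \<in> E} \<in> sets M" by measurable
    \<comment> \<open>A conditional probability is the conditional expectation of an indicator,
      whose bridge average is the kernel \<open>P\<close> of the statement.\<close>
    have eq: "bridge_average (indicator E) t r s x y = bridge_prob g x t E r y s" for x y
      unfolding bridge_average_def bridge_prob_def set_lebesgue_integral_R[OF E] by (simp add: mult.commute)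
    have "AE \<omega> in M. real_cond_exp M (generated_sigma M Z {s, t}) (indicator {\<omega> \<in> space M. Z r \<omega> \<in> E}) \<omega> =
        real_cond_exp M (generated_sigma M Z {s, t}) (\<lambda>\<omega>. indicator E (Z r \<omega>)) \<omega>"
      by (intro F.real_cond_exp_cong) (auto intro!: AE_I2 simp: indicator_def)
    moreover have "AE \<omega> in M. real_cond_exp M (generated_sigma M Z {s, t})
        (\<lambda>\<omega>. indicator E (Z r \<omega>)) \<omega> = bridge_average (indicator E) t r s (Z t \<omega>) (Z s \<omega>)"
      using sub by (intro real_cond_exp_bridge[OF str, where B=1]) (auto simp: indicator_def)
    ultimately show ?thesis by eventually_elim (simp add: eq)
  qed
  show ?thesis
    unfolding Bernstein_realization_def Bernstein_process_def sR
    using prob_space_axioms complete Zm Bernstein bridge endpoint_distribution finite_dimensional_distribution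
    by (intro conjI ballI allI impI) auto
qed

end

section \<open>Uniqueness and the theorem\<close>

lemma enumerate_grid:
  fixes K :: "real set"
  assumes "finite K" "0 \<in> K" "K \<subseteq> {0..<T}"
  obtains t n where "t 0 = 0" "\<forall>i<n. t i < t (Suc i)" "t n < T" "t ` {..n} = K" "card K = Suc n"
proof -
  define xs where "xs = sorted_list_of_set K"
  have xs: "set xs = K" "sorted_wrt (<) xs" "length xs = card K"
    using assms by (auto simp: xs_def)
  have "card K \<noteq> 0" using assms by auto
  then obtain n where n: "card K = Suc n" by (cases "card K") auto
  have lt: "xs ! i < xs ! j" if "i < j" "j \<le> n" for i j
    using sorted_wrt_nth_less[OF xs(2), of i j] that xs(3) n by simp
  have img: "(!) xs ` {..n} = K"
    using xs n by (force simp: set_conv_nth image_iff less_Suc_eq_le)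
  obtain i where i: "i \<le> n" "xs ! i = 0" using img assms(2) by auto
  have "xs ! 0 \<in> K" "xs ! n \<in> K" using img by auto
  then have "0 \<le> xs ! 0" "xs ! n < T" using assms(3) by auto
  moreover have "xs ! 0 = 0"
    using lt[of 0 i] i \<open>0 \<le> xs ! 0\<close> by (cases "i = 0") auto
  ultimately show ?thesis
    using that[of "(!) xs" n] lt img n by auto
qed

text \<open>A probability on paths is determined by its finite-dimensional cylinders, and the
  product formula prescribes their probabilities by a right-hand side free of the process. The two
  processes may therefore live on unrelated spaces.\<close>

lemma path_law_unique:
  fixes D :: "(real^'d) set" and M :: "'w measure" and M' :: "'v measure"
  assumes T: "0 < T"
    and Z: "Bernstein_realization T D g \<mu> M Z" and Z': "Bernstein_realization T D g \<mu> M' Z'"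
  shows "path_law T D M Z = path_law T D M' Z'"
proof -
  let ?R = "restrict_space borel (closure D)"
  let ?P = "\<lambda>Z \<omega>. \<lambda>\<tau>\<in>{0..T}. Z \<tau> \<omega>"
  have prob: "prob_space M" "prob_space M'"
    and meas: "\<And>\<tau>. \<tau> \<in> {0..T} \<Longrightarrow> Z \<tau> \<in> M \<rightarrow>\<^sub>M ?R" "\<And>\<tau>. \<tau> \<in> {0..T} \<Longrightarrow> Z' \<tau> \<in> M' \<rightarrow>\<^sub>M ?R"
    using Z Z' by (auto simp: Bernstein_realization_def Bernstein_process_def)
  interpret M: prob_space M by (rule prob)
  interpret M': prob_space M' by (rule prob)
  have pm: "?P Z \<in> M \<rightarrow>\<^sub>M PiM {0..T} (\<lambda>_. ?R)" "?P Z' \<in> M' \<rightarrow>\<^sub>M PiM {0..T} (\<lambda>_. ?R)"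
    using meas by (auto intro!: measurable_restrict)
  show ?thesis
    unfolding path_law_def
  proof (rule measure_eqI_PiM_infinite)
    show "finite_measure (distr M (PiM {0..T} (\<lambda>_. ?R)) (?P Z))"
      using M.prob_space_distr[OF pm(1)] by (simp add: prob_space_def)
    fix A and J :: "real set"
    assume J: "finite J" "J \<subseteq> {0..T}" and A: "\<And>\<tau>. \<tau> \<in> J \<Longrightarrow> A \<tau> \<in> sets ?R"
    \<comment> \<open>the time \<open>T / 2\<close> is added because the formula is only assumed for \<open>n \<ge> 1\<close>\<close>
    define K where "K = insert 0 (insert (T / 2) (J - {T}))"
    have "J - {T} \<subseteq> {0..<T}" using J by (auto simp: less_le)
    then have "finite K" "0 \<in> K" "K \<subseteq> {0..<T}" using J T by (auto simp: K_def)
    from enumerate_grid[OF this] obtain t n where t: "t 0 = 0" "\<forall>i<n. t i < t (Suc i)" "t n < T" and K: "t ` {..n} = K" "card K = Suc n"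
      by blast
    have "card {0, T / 2} \<le> card K" using J by (intro card_mono) (auto simp: K_def)
    then have n: "1 \<le> n" using K T by simp
    \<comment> \<open>The grid contains times not constrained by the cylinder, at least possibly
      \<open>0\<close>, \<open>T\<close> and the auxiliary one; these receive the whole state
      space.\<close>
    define B where "B \<tau> = (if \<tau> \<in> J then A \<tau> else closure D)" for \<tau>
    have B: "B \<tau> \<in> sets ?R" for \<tau>
      using A sets.top[of ?R] by (auto simp: B_def space_restrict_space)
    have tJ: "J \<subseteq> insert T (t ` {..n})" "insert T (t ` {..n}) \<subseteq> {0..T}"
      using J T K by (auto simp: K_def)
    have n01: "{..n} = insert 0 {1..n}" by auto
    let ?S = "prod_emb {0..T} (\<lambda>_. ?R) J (Pi\<^sub>E J A)"
    have S: "?S \<in> sets (PiM {0..T} (\<lambda>_. ?R))" using J A by (intro sets_PiM_I) auto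
    have cyl: "?P W -` ?S \<inter> space N = {\<omega> \<in> space N. W 0 \<omega> \<in> B 0 \<and> (\<forall>i\<in>{1..n}. W (t i) \<omega> \<in> B (t i)) \<and> W T \<omega> \<in> B T}"
      if W: "\<And>\<tau>. \<tau> \<in> {0..T} \<Longrightarrow> W \<tau> \<in> N \<rightarrow>\<^sub>M ?R" for W and N :: "'x measure"
    proof -
      have "?P W \<omega> \<in> ?S \<longleftrightarrow> (\<forall>\<tau>\<in>insert T (t ` {..n}). W \<tau> \<omega> \<in> B \<tau>)" if "\<omega> \<in> space N" for \<omega>
      proof -
        have c: "W \<tau> \<omega> \<in> closure D" if "\<tau> \<in> {0..T}" for \<tau>
          using measurable_space[OF W[OF that] \<open>\<omega> \<in> space N\<close>] by (simp add: space_restrict_space)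
        have "?P W \<omega> \<in> ?S \<longleftrightarrow> (\<forall>\<tau>\<in>J. W \<tau> \<omega> \<in> A \<tau>)"
          using c J(2) by (auto simp: prod_emb_def space_restrict_space PiE_iff)
        also have "\<dots> \<longleftrightarrow> (\<forall>\<tau>\<in>insert T (t ` {..n}). W \<tau> \<omega> \<in> B \<tau>)"
          using tJ c unfolding B_def by (smt (verit) subset_iff)
        finally show ?thesis .
      qed
      then show ?thesis using t(1) unfolding n01 by auto
    qed
    have "measure M {\<omega> \<in> space M. Z 0 \<omega> \<in> B 0 \<and> (\<forall>i\<in>{1..n}. Z (t i) \<omega> \<in> B (t i)) \<and> Z T \<omega> \<in> B T} =
        measure M' {\<omega> \<in> space M'. Z' 0 \<omega> \<in> B 0 \<and> (\<forall>i\<in>{1..n}. Z' (t i) \<omega> \<in> B (t i)) \<and> Z' T \<omega> \<in> B T}"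
    proof -
      have fdd: "measure N {\<omega> \<in> space N. W 0 \<omega> \<in> B 0 \<and> (\<forall>i\<in>{1..n}. W (t i) \<omega> \<in> B (t i)) \<and> W T \<omega> \<in> B T} =
        set_lebesgue_integral lborel (B 0 \<times> B T)
          (\<lambda>(x, y). \<mu> x y *
             iterated_integral (\<lambda>i. B (t i)) n
               (\<lambda>\<xi>. \<Prod>i=1..n. bridge_density g y T (\<xi> i) (t i) (\<xi> (i - 1)) (t (i - 1)))
               (\<lambda>_. x))"
        if W: "Bernstein_realization T D g \<mu> N W" for N :: "'x measure" and W
      proof -
        have "\<forall>n\<ge>1. \<forall>t :: nat \<Rightarrow> real. \<forall>E E\<^sub>0 E\<^sub>T.
          t 0 = 0 \<longrightarrow> (\<forall>i<n. t i < t (Suc i)) \<longrightarrow> t n < T \<longrightarrow> E\<^sub>0 \<in> sets ?R \<longrightarrow> E\<^sub>T \<in> sets ?R \<longrightarrow>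
          (\<forall>i\<in>{1..n}. E i \<in> sets ?R) \<longrightarrow>
          measure N {\<omega> \<in> space N. W 0 \<omega> \<in> E\<^sub>0 \<and> (\<forall>i\<in>{1..n}. W (t i) \<omega> \<in> E i) \<and> W T \<omega> \<in> E\<^sub>T} =
          set_lebesgue_integral lborel (E\<^sub>0 \<times> E\<^sub>T)
          (\<lambda>(x, y). \<mu> x y *
             iterated_integral E n
               (\<lambda>\<xi>. \<Prod>i=1..n. bridge_density g y T (\<xi> i) (t i) (\<xi> (i - 1)) (t (i - 1)))
               (\<lambda>_. x))"
          using W unfolding Bernstein_realization_def by (elim conjE)
        from this[rule_format, OF n t(1) t(2)[rule_format] t(3) B[of 0] B[of T], of "\<lambda>i. B (t i)"]
        show ?thesis using B by blast
      qed
      show ?thesis using fdd[OF Z] fdd[OF Z'] by simp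
    qed
    then show "emeasure (distr M (PiM {0..T} (\<lambda>_. ?R)) (?P Z)) ?S = emeasure (distr M' (PiM {0..T} (\<lambda>_. ?R)) (?P Z')) ?S"
      by (simp only: emeasure_distr[OF pm(1) S] emeasure_distr[OF pm(2) S] cyl[OF meas(1)] cyl[OF meas(2)]
        M.emeasure_eq_measure M'.emeasure_eq_measure)
  qed simp_all
qed

text \<open>Each set of the completion is a set of \<open>N\<close> together with part of a null set
  of \<open>N\<close>. The latter is null for \<open>M'\<close> as well, because the two measures
  agree on \<open>N\<close>.\<close>

lemma completion_measure_eqI:
  assumes sets: "sets M' = sets (completion N)"
    and eq: "\<And>A. A \<in> sets N \<Longrightarrow> emeasure M' A = emeasure N A"
  shows "M' = completion N"
proof (rule measure_eqI[OF sets])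
  fix A assume "A \<in> sets M'"
  then obtain S E E' where A: "A = S \<union> E" "E \<subseteq> E'" "E' \<in> null_sets N" "S \<in> sets N"
    unfolding sets by (rule sets_completionE)
  have S: "S \<in> sets M'" "E' \<in> sets M'" "E \<in> sets M'"
    using A null_sets_completion[OF A(3,2)] by (auto simp: sets)
  have "E' \<in> null_sets M'" using A(3) S(2) eq[of E'] by (auto simp: null_sets_def)
  then have "E \<in> null_sets M'" using S(3) A(2) by (rule null_sets_subset)
  then have "emeasure M' A = emeasure N S"
    using eq[OF A(4)] S(1) unfolding A(1) by (simp add: emeasure_Un_null_set)
  also have "\<dots> = emeasure (completion N) S" using A(4) by simp
  also have "\<dots> = emeasure (completion N) A"
    unfolding A(1) using A null_sets_completion_iff2[of E N]
    by (intro emeasure_Un_null_set[symmetric]) auto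
  finally show "emeasure M' A = emeasure (completion N) A" .
qed

theorem theorem1:
  fixes T \<alpha> :: real
    and D :: "(real^'d) set"
    and n :: "real^'d \<Rightarrow> real^'d"
    and k :: "real^'d \<Rightarrow> real \<Rightarrow> real^'d^'d"
    and l :: "real^'d \<Rightarrow> real \<Rightarrow> real^'d"
    and V :: "real^'d \<Rightarrow> real \<Rightarrow> real"
    and \<phi> \<psi> :: "real^'d \<Rightarrow> real"
    and g :: "real^'d \<Rightarrow> real \<Rightarrow> real^'d \<Rightarrow> real \<Rightarrow> real"
    and \<mu> :: "real^'d \<Rightarrow> real^'d \<Rightarrow> real"
  assumes "0 < T" and "0 < \<alpha>" "\<alpha> < 1"
    and "bounded D" "open D" "convex D" "boundary_holder_2 \<alpha> D"
    and "unit_outer_normal \<alpha> D n"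
    and "hyp_K \<alpha> T D n k" and "hyp_L \<alpha> T D l" and "hyp_V \<alpha> T D V"
    and "hyp_IF \<alpha> T D n k \<phi> \<psi>"
    and "\<forall>x\<in>closure D. 0 < \<phi> x"
    and "parabolic_Green_function T D n k l V g"
    and "\<forall>x\<in>closure D. \<forall>y\<in>closure D. \<forall>s t. 0 \<le> s \<longrightarrow> s < t \<longrightarrow> t \<le> T \<longrightarrow> 0 < g x t y s"
    and "continuous_on {(x, t, y, s). x \<in> closure D \<and> y \<in> closure D \<and> 0 \<le> s \<and> s < t \<and> t \<le> T}
           (\<lambda>(x, t, y, s). g x t y s)"
    and "\<forall>x\<in>closure D. \<forall>y\<in>closure D. 0 \<le> \<mu> x y"
    and "set_integrable lborel (closure D \<times> closure D) (\<lambda>(x, y). \<mu> x y)"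
    and "set_lebesgue_integral lborel (closure D \<times> closure D) (\<lambda>(x, y). \<mu> x y) = 1"
  shows "\<exists>(M :: (real \<Rightarrow> real^'d) measure) (Z :: real \<Rightarrow> (real \<Rightarrow> real^'d) \<Rightarrow> real^'d).
           Bernstein_realization T D g \<mu> M Z \<and>
           (\<forall>M'. sets M' = sets M \<longrightarrow> Bernstein_realization T D g \<mu> M' Z \<longrightarrow> M' = M) \<and>
           (\<forall>(M' :: 'w measure) Z'. Bernstein_realization T D g \<mu> M' Z' \<longrightarrow>
              path_law T D M' Z' = path_law T D M Z)"
proof -
  let ?C = "closure D" and ?RC = "restrict_space lborel (closure D)"
  have C: "compact ?C" using assms by simp
  have cont: "continuous_on (?C \<times> ?C) (\<lambda>(x, y). g x t y s)" if "0 \<le> s" "s < t" "t \<le> T" for s t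
  proof -
    have "continuous_on (?C \<times> ?C) ((\<lambda>(x, t, y, s). g x t y s) \<circ> (\<lambda>p. (fst p, t, snd p, s)))"
    proof (rule continuous_on_compose)
      show "continuous_on (?C \<times> ?C) (\<lambda>p. (fst p, t, snd p, s))" by (intro continuous_intros)
      show "continuous_on ((\<lambda>p. (fst p, t, snd p, s)) ` (?C \<times> ?C)) (\<lambda>(x, t, y, s). g x t y s)"
        by (rule continuous_on_subset[OF assms(16)]) (use that in auto)
    qed
    then show ?thesis by (simp add: o_def case_prod_unfold)
  qed
  have pos: "0 < g x t y s" if "0 \<le> s" "s < t" "t \<le> T" "x \<in> ?C" "y \<in> ?C" for s t x y
    using assms(15) that by blast
  have CC: "?C \<times> ?C \<in> sets (lborel :: ((real^'d) \<times> (real^'d)) measure)"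
    by (simp add: closed_Times)
  have \<mu>_borel: "(\<lambda>(x, y). \<mu> x y) \<in> borel_measurable (restrict_space lborel (?C \<times> ?C))"
    using assms(18) CC unfolding set_integrable_def by (simp add: borel_measurable_restrict_space_iff)
  have pair: "?RC \<Otimes>\<^sub>M ?RC = restrict_space lborel (?C \<times> ?C)"
    by (intro pair_restrict_space_lborel) auto
  have \<mu>_total: "(\<integral>\<^sup>+(x, y). ennreal (\<mu> x y) \<partial>(?RC \<Otimes>\<^sub>M ?RC)) = 1"
  proof -
    have "(\<integral>\<^sup>+(x, y). ennreal (\<mu> x y) \<partial>restrict_space lborel (?C \<times> ?C)) =
        (\<integral>\<^sup>+z. ennreal (indicator (?C \<times> ?C) z *\<^sub>R (\<lambda>(x, y). \<mu> x y) z) \<partial>lborel)"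
      using CC by (subst nn_integral_restrict_space) (auto intro!: nn_integral_cong simp: indicator_def)
    also have "\<dots> = ennreal (\<integral>z. indicator (?C \<times> ?C) z *\<^sub>R (\<lambda>(x, y). \<mu> x y) z \<partial>lborel)"
      using assms(17,18) unfolding set_integrable_def
      by (intro nn_integral_eq_integral AE_I2) (auto simp: indicator_def)
    also have "\<dots> = 1" using assms(19) unfolding set_lebesgue_integral_def by simp
    finally show ?thesis by (simp only: pair)
  qed
  interpret bridge_kernel T ?C g \<mu>
  proof
    show "0 < T" by fact
    show "(\<integral>\<^sup>+z. ennreal (g x t z r * g z r y s) \<partial>?RC) = ennreal (g x t y s)"
      if "0 \<le> s" "s < r" "r < t" "t \<le> T" "x \<in> ?C" "y \<in> ?C" for s r t x y
      using Green_function_Chapman_Kolmogorov[OF assms(5,4,6,14) pos cont that] by blast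
    show "(\<lambda>(x, y). \<mu> x y) \<in> borel_measurable (?RC \<Otimes>\<^sub>M ?RC)" using \<mu>_borel by (simp only: pair)
  qed (use C cont pos \<mu>_total assms(17) in auto)
  obtain N where N: "prob_space N" "sets N = sets (PiM {0..T} (\<lambda>_. R))"
    "\<forall>J. time_grid J \<longrightarrow> distr N (PiM J (\<lambda>_. R)) (\<lambda>\<omega>. restrict \<omega> J) = grid_law J"
    using path_measure_exists by blast
  define Z :: "real \<Rightarrow> (real \<Rightarrow> real^'d) \<Rightarrow> real^'d" where "Z \<tau> \<omega> = \<omega> \<tau>" for \<tau> \<omega>
  \<comment> \<open>Completeness is part of the notion of a Bernstein process; the coordinate
    process keeps its laws under completion.\<close>
  let ?M = "completion N"
  have ZN: "Z \<tau> \<in> N \<rightarrow>\<^sub>M R" if "\<tau> \<in> {0..T}" for \<tau>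
    unfolding Z_def measurable_cong_sets[OF N(2) refl] using that by (rule measurable_component_singleton)
  interpret M: bridge_process T ?C g \<mu> ?M Z
  proof (intro bridge_process.intro bridge_process_axioms.intro)
    show "bridge_kernel T ?C g \<mu>" by (rule bridge_kernel_axioms)
    show "prob_space ?M" using N(1) by (rule prob_space.prob_space_completion)
    show "Z \<tau> \<in> ?M \<rightarrow>\<^sub>M R" if "\<tau> \<in> {0..T}" for \<tau> using ZN[OF that] by (rule measurable_completion)
    fix J assume J: "time_grid J"
    have "(\<lambda>\<omega>. restrict \<omega> J) \<in> N \<rightarrow>\<^sub>M PiM J (\<lambda>_. R)"
      unfolding measurable_cong_sets[OF N(2) refl] by (rule restrict_measurable[OF time_gridD(4)[OF J]])
    from distr_completion[OF this] N(3)[rule_format, OF J]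
    show "distr ?M (PiM J (\<lambda>_. R)) (\<lambda>\<omega>. \<lambda>\<tau>\<in>J. Z \<tau> \<omega>) = grid_law J" by (simp add: Z_def)
  qed
  have real: "Bernstein_realization T D g \<mu> ?M Z"
    by (rule M.Bernstein_realization[OF completion.complete_measure_axioms refl])
  have sR: "sets (PiM {0..T} (\<lambda>_. restrict_space borel ?C)) = sets N"
    unfolding N(2) by (intro sets_PiM_cong refl sets_R[symmetric])
  \<comment> \<open>Paths in \<open>space N\<close> are already extensional on
    \<open>{0..T}\<close>, so recording the coordinates is the identity there. The path law is thus
    the restriction of \<open>M'\<close> to the sets of \<open>N\<close>, and uniqueness of the law
    becomes uniqueness of the measure on those sets.\<close>
  have emeasure_path_law: "emeasure (path_law T D M' Z) A = emeasure M' A"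
    if sets: "sets M' = sets ?M" and A: "A \<in> sets N" for M' A
  proof -
    have sub: "sets N \<subseteq> sets M'" unfolding sets by auto
    have sp: "space M' = space N" using sets_eq_imp_space_eq[OF sets] by simp
    have ext: "(\<lambda>\<tau>\<in>{0..T}. Z \<tau> \<omega>) = \<omega>" if "\<omega> \<in> space N" for \<omega>
      using that sets_eq_imp_space_eq[OF N(2)] by (auto simp: Z_def space_PiM PiE_iff extensional_restrict)
    have id: "(\<lambda>\<omega>. \<omega>) \<in> M' \<rightarrow>\<^sub>M PiM {0..T} (\<lambda>_. restrict_space borel ?C)"
      unfolding measurable_cong_sets[OF refl sR] using sub sp sets.sets_into_space[of _ N]
      by (auto simp: measurable_def Int_absorb2)
    have X: "(\<lambda>\<omega>. \<lambda>\<tau>\<in>{0..T}. Z \<tau> \<omega>) \<in> M' \<rightarrow>\<^sub>M PiM {0..T} (\<lambda>_. restrict_space borel ?C)"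
      using id by (rule measurable_cong[THEN iffD1, rotated]) (simp add: ext sp)
    have "emeasure (path_law T D M' Z) A = emeasure M' ((\<lambda>\<omega>. \<lambda>\<tau>\<in>{0..T}. Z \<tau> \<omega>) -` A \<inter> space M')"
      unfolding path_law_def using A sR by (intro emeasure_distr[OF X]) simp
    also have "(\<lambda>\<omega>. \<lambda>\<tau>\<in>{0..T}. Z \<tau> \<omega>) -` A \<inter> space M' = A"
      using ext sp sets.sets_into_space[OF A] by auto
    finally show ?thesis .
  qed
  have unique: "M' = ?M" if sets: "sets M' = sets ?M" and r: "Bernstein_realization T D g \<mu> M' Z" for M'
  proof (rule completion_measure_eqI[OF sets])
    fix A assume A: "A \<in> sets N"
    have "emeasure M' A = emeasure (path_law T D M' Z) A" using emeasure_path_law[OF sets A] by simp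
    also have "\<dots> = emeasure (path_law T D ?M Z) A"
      using path_law_unique[OF T_pos r real] by simp
    also have "\<dots> = emeasure N A" using emeasure_path_law[OF refl A] A by simp
    finally show "emeasure M' A = emeasure N A" .
  qed
  show ?thesis
    by (intro exI[of _ ?M] exI[of _ Z] conjI allI impI real)
      (use unique path_law_unique[OF T_pos _ real] in blast)+
qed

end
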